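(* Let $V=\{(a,b,c,d,e,f,g)^T\in\mathbb{C}^7: e+f+g-a-b-c-d=1\}$ and let $G_L=\langle (12),(23),(34),(67),A\rangle\leq GL(7,\mathbb{C})$. Then $G_L$ is an invariance group for the function $L$: for every $\alpha\in G_L$ and every $\vec{x}\in V$ such that both sides are defined, $$L(\vec{x})=L(\alpha\vec{x}).$$
   Context: A permutation $\sigma\in S_7$ is identified with the matrix in $GL(7,\mathbb{C})$ that permutes the standard basis by $e_i\mapsto e_{\sigma(i)}$; $(12),(23),(34),(67)$ are the corresponding transposition matrices. The matrix $A$ is $$A=\begin{pmatrix}1&0&0&0&0&0&0\\0&1&0&0&0&0&0\\0&0&-1&0&0&0&1\\0&0&0&-1&0&0&1\\0&0&-1&-1&1&0&1\\0&0&-1&-1&0&1&1\\0&0&0&0&0&0&1\end{pmatrix}.$$ All elements of $G_L$ map $V$ to itself. For complex parameters with no $b_i$ a nonpositive integer, ${}_4F_3\left[{a_1,a_2,a_3,a_4;\atop b_1,b_2,b_3;}1\right]=\sum_{n=0}^{\infty}\frac{(a_1)_n(a_2)_n(a_3)_n(a_4)_n}{n!\,(b_1)_n(b_2)_n(b_3)_n}$, where $(x)_0=1$ and $(x)_n=x(x+1)\cdots(x+n-1)$ for $n>0$. For $\vec{x}=(a,b,c,d,e,f,g)^T\in V$, define $L(\vec{x})=L(a,b,c,d;e;f,g)$ by $$L(a,b,c,d;e;f,g)=\frac{{}_4F_3\left[{a,b,c,d;\atop e,f,g;}1\right]}{\sin (\pi e)\,\Gamma(e)\Gamma(f)\Gamma(g)\Gamma(1+a-e)\Gamma(1+b-e)\Gamma(1+c-e)\Gamma(1+d-e)}-\frac{{}_4F_3\left[{1+a-e,\,1+b-e,\,1+c-e,\,1+d-e;\atop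 1+f-e,\,1+g-e,\,2-e;}1\right]}{\sin (\pi e)\,\Gamma(a)\Gamma(b)\Gamma(c)\Gamma(d)\Gamma(1+f-e)\Gamma(1+g-e)\Gamma(2-e)},$$ where $1/\Gamma$ is regarded as an entire function. $L(a,b,c,d;e;f,g)$ is defined when $e\notin\mathbb{Z}$ and none of $f,\ g,\ 1+f-e,\ 1+g-e$ is a nonpositive integer. *)

theory Defs
  imports "HOL-Analysis.Analysis" "HOL-Algebra.Generated_Groups"
begin

definition GL7 :: "(complex^7^7) monoid" where
  "GL7 = \<lparr>carrier = {M. invertible M}, mult = (**), one = mat 1\<rparr>"

text \<open>The matrix sending the basis vector \<open>e\<^sub>i\<close> to the basis vector with index \<open>\<sigma> i\<close>;
  the entry in row \<open>i\<close>, column \<open>j\<close> is therefore \<open>1\<close> iff \<open>i = \<sigma> j\<close>.\<close>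

definition perm_matrix :: "(7 \<Rightarrow> 7) \<Rightarrow> complex^7^7" where
  "perm_matrix \<sigma> = (\<chi> i j. if i = \<sigma> j then 1 else 0)"

definition A_mat :: "complex^7^7" where
  "A_mat = vector
    [vector [1, 0,  0,  0, 0, 0, 0],
     vector [0, 1,  0,  0, 0, 0, 0],
     vector [0, 0, -1,  0, 0, 0, 1],
     vector [0, 0,  0, -1, 0, 0, 1],
     vector [0, 0, -1, -1, 1, 0, 1],
     vector [0, 0, -1, -1, 0, 1, 1],
     vector [0, 0,  0,  0, 0, 0, 1]]"

definition GL_generators :: "(complex^7^7) set" where
  "GL_generators =
    {perm_matrix (Transposition.transpose 1 2), perm_matrix (Transposition.transpose 2 3),
     perm_matrix (Transposition.transpose 3 4), perm_matrix (Transposition.transpose 6 7), A_mat}"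

definition G_L :: "(complex^7^7) set" where
  "G_L = generate GL7 GL_generators"

text \<open>The coordinates \<open>a, b, c, d, e, f, g\<close> of a vector are its components \<open>1, \<dots>, 7\<close>
  (in the index type, \<open>7\<close> is the same element as \<open>0\<close>).\<close>

definition V :: "(complex^7) set" where
  "V = {x. x$5 + x$6 + x$7 - x$1 - x$2 - x$3 - x$4 = 1}"

text \<open>The series \<open>\<^sub>4F\<^sub>3\<close> at unit argument.  It is meaningful when no lower parameter is a nonpositive
  integer and the series converges; both hold for the two series in \<open>L_fun\<close> at
  points of \<open>V\<close> satisfying \<open>L_defined\<close>.\<close>

definition hyp4F3 ::
  "complex \<Rightarrow> complex \<Rightarrow> complex \<Rightarrow> complex \<Rightarrow> complex \<Rightarrow> complex \<Rightarrow> complex \<Rightarrow> complex" where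
  "hyp4F3 a1 a2 a3 a4 b1 b2 b3 =
    (\<Sum>n. (pochhammer a1 n * pochhammer a2 n * pochhammer a3 n * pochhammer a4 n) /
          (fact n * pochhammer b1 n * pochhammer b2 n * pochhammer b3 n))"

text \<open>\<open>rGamma\<close> is the entire function \<open>1/\<Gamma>\<close>.\<close>

definition L_fun ::
  "complex \<Rightarrow> complex \<Rightarrow> complex \<Rightarrow> complex \<Rightarrow> complex \<Rightarrow> complex \<Rightarrow> complex \<Rightarrow> complex" where
  "L_fun a b c d e f g =
     hyp4F3 a b c d e f g / sin (of_real pi * e)
       * (rGamma e * rGamma f * rGamma g * rGamma (1 + a - e) * rGamma (1 + b - e)
          * rGamma (1 + c - e) * rGamma (1 + d - e))
   - hyp4F3 (1 + a - e) (1 + b - e) (1 + c - e) (1 + d - e) (1 + f - e) (1 + g - e) (2 - e)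
       / sin (of_real pi * e)
       * (rGamma a * rGamma b * rGamma c * rGamma d * rGamma (1 + f - e) * rGamma (1 + g - e)
          * rGamma (2 - e))"

definition L :: "complex^7 \<Rightarrow> complex" where
  "L x = L_fun (x$1) (x$2) (x$3) (x$4) (x$5) (x$6) (x$7)"

definition L_defined :: "complex^7 \<Rightarrow> bool" where
  "L_defined x \<longleftrightarrow>
     x$5 \<notin> \<int> \<and> x$6 \<notin> \<int>\<^sub>\<le>\<^sub>0 \<and> x$7 \<notin> \<int>\<^sub>\<le>\<^sub>0 \<and>
     1 + x$6 - x$5 \<notin> \<int>\<^sub>\<le>\<^sub>0 \<and> 1 + x$7 - x$5 \<notin> \<int>\<^sub>\<le>\<^sub>0"

lemma exhaust_7: "(i::7) = 1 \<or> i = 2 \<or> i = 3 \<or> i = 4 \<or> i = 5 \<or> i = 6 \<or> i = 7"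
proof (induct i)
  case (of_int z)
  then have "z = 0 \<or> z = 1 \<or> z = 2 \<or> z = 3 \<or> z = 4 \<or> z = 5 \<or> z = 6"
    by simp arith
  then show ?case
    by auto
qed

lemma UNIV_7: "UNIV = {1, 2, 3, 4, 5, 6, 7::7}"
  using exhaust_7 by auto

lemma forall_7: "(\<forall>i::7. P i) \<longleftrightarrow> P 1 \<and> P 2 \<and> P 3 \<and> P 4 \<and> P 5 \<and> P 6 \<and> P 7"
  by (metis exhaust_7)

lemma sum_7: "sum h (UNIV::7 set) = h 1 + h 2 + h 3 + h 4 + h 5 + h 6 + h 7"
  unfolding UNIV_7 by (simp add: ac_simps)

lemma vector_7:
  fixes x1 :: "'a::zero"
  shows "(vector [x1, x2, x3, x4, x5, x6, x7] :: 'a^7) $ 1 = x1"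
    "(vector [x1, x2, x3, x4, x5, x6, x7] :: 'a^7) $ 2 = x2"
    "(vector [x1, x2, x3, x4, x5, x6, x7] :: 'a^7) $ 3 = x3"
    "(vector [x1, x2, x3, x4, x5, x6, x7] :: 'a^7) $ 4 = x4"
    "(vector [x1, x2, x3, x4, x5, x6, x7] :: 'a^7) $ 5 = x5"
    "(vector [x1, x2, x3, x4, x5, x6, x7] :: 'a^7) $ 6 = x6"
    "(vector [x1, x2, x3, x4, x5, x6, x7] :: 'a^7) $ 7 = x7"
  unfolding vector_def by simp_all

lemma group_GL7: "group GL7"
proof (rule groupI)
  fix M assume "M \<in> carrier GL7"
  then obtain N where "M ** N = mat 1" "N ** M = mat 1"
    unfolding GL7_def invertible_def by auto
  then have "N \<in> carrier GL7" "N \<otimes>\<^bsub>GL7\<^esub> M = \<one>\<^bsub>GL7\<^esub>"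
    unfolding GL7_def invertible_def by auto
  then show "\<exists>N\<in>carrier GL7. N \<otimes>\<^bsub>GL7\<^esub> M = \<one>\<^bsub>GL7\<^esub>" by blast
next
  show "\<one>\<^bsub>GL7\<^esub> \<in> carrier GL7"
    unfolding GL7_def invertible_def by (auto intro: exI[of _ "mat 1"])
qed (auto simp: GL7_def invertible_mult matrix_mul_assoc)

lemma perm_matrix_axis: "perm_matrix \<sigma> *v axis i 1 = axis (\<sigma> i) 1"
proof -
  have "(\<Sum>j\<in>UNIV. (if k = \<sigma> j then 1 else 0) * (if j = i then 1 else 0)) =
      (\<Sum>j\<in>UNIV. if j = i then (if k = \<sigma> i then 1 else 0) else 0 :: complex)" for k
    by (intro sum.cong) auto
  then show ?thesis
    by (simp add: vec_eq_iff perm_matrix_def matrix_vector_mult_def axis_def)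
qed

lemma perm_matrix_transpose_vec:
  "(perm_matrix (Transposition.transpose i j) *v x) $ k = x $ Transposition.transpose i j k"
proof -
  have "\<And>l. k = Transposition.transpose i j l \<longleftrightarrow> l = Transposition.transpose i j k"
    by (metis transpose_involutory)
  then have "(perm_matrix (Transposition.transpose i j) *v x) $ k
      = (\<Sum>l\<in>UNIV. if l = Transposition.transpose i j k then x $ l else 0)"
    unfolding perm_matrix_def matrix_vector_mult_def vec_lambda_beta
    by (intro sum.cong) simp_all
  then show ?thesis
    by simp
qed

lemma A_mat_vec:
  "A_mat *v x = vector [x$1, x$2, x$7 - x$3, x$7 - x$4, x$5 + x$7 - x$3 - x$4,
     x$6 + x$7 - x$3 - x$4, x$7]"
  unfolding vec_eq_iff forall_7 matrix_vector_mult_def A_mat_def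
  by (simp only: vector_7 vec_lambda_beta sum_7) simp

lemma GL_generators_involutive:
  assumes "M \<in> GL_generators"
  shows "M ** M = mat 1"
proof -
  have perm: "perm_matrix (Transposition.transpose i j) *v
      (perm_matrix (Transposition.transpose i j) *v x) = x" for i j x
    by (rule vec_eq_iff[THEN iffD2]) (simp add: perm_matrix_transpose_vec)
  have "A_mat *v (A_mat *v x) = x" for x
    unfolding A_mat_vec vec_eq_iff forall_7 by (simp only: vector_7) simp
  with perm have "M *v (M *v x) = x" for x
    using assms unfolding GL_generators_def by blast
  then show ?thesis
    by (simp add: matrix_eq flip: matrix_vector_mul_assoc)
qed

lemma GL_generators_subset: "GL_generators \<subseteq> carrier GL7"
  using GL_generators_involutive unfolding GL7_def invertible_def by auto

lemma subgroup_G_L: "subgroup G_L GL7"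
  unfolding G_L_def
  by (rule group.generate_is_subgroup[OF group_GL7 GL_generators_subset])

lemma G_L_preserves_V:
  assumes "\<alpha> \<in> G_L" "x \<in> V"
  shows "\<alpha> *v x \<in> V"
proof -
  have gen: "M *v y \<in> V" if "M \<in> GL_generators" "y \<in> V" for M y
    using that unfolding GL_generators_def V_def
    by (auto simp: perm_matrix_transpose_vec A_mat_vec vector_7 transpose_def algebra_simps)
  have self_inv: "inv\<^bsub>GL7\<^esub> M = M" if "M \<in> GL_generators" for M
    using group.inv_equality[OF group_GL7, of M M] GL_generators_subset that
      GL_generators_involutive[OF that] by (auto simp: GL7_def)
  have "\<beta> *v y \<in> V" if "\<beta> \<in> generate GL7 GL_generators" "y \<in> V" for \<beta> y
    using that
  proof (induction arbitrary: y rule: generate.induct)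
    case (inv h)
    then show ?case
      using self_inv gen by simp
  qed (auto simp: gen GL7_def simp flip: matrix_vector_mul_assoc)
  then show ?thesis
    using assms unfolding G_L_def by blast
qed

end

theory Submission
  imports Defs "HOL-Complex_Analysis.Conformal_Mappings"
begin

text \<open>
  Put \<open>s = 1 + a + b - e = f + g - c - d\<close>.  Writing the quotients of Gamma functions in the two series of
  \<open>L\<close> as Mellin transforms (Beta integral and Gauss's theorem) and summing under the integral with
  the connection formula between the hypergeometric functions at \<open>0\<close> and at \<open>1\<close> gives, for
  parameters in a suitable open set,
  \<open>L(a,b,c,d;e;f,g) = (\<pi> \<Gamma>(c) \<Gamma>(d) \<Gamma>(1+c-e) \<Gamma>(1+d-e) \<Gamma>(s)\<^sup>2)\<^bsup>-1\<^esup>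
    \<integral> u\<^bsup>c-1\<^esup> (1-u)\<^bsup>s-1\<^esup> F(a,b;s;1-u) F(f-d,g-d;s;1-u) du\<close> over \<open>(0,1)\<close>.
  The integral is visibly unchanged when the two hypergeometric functions are exchanged, and so is the
  factor in front.  This is an invariance of \<open>L\<close> under an involution \<open>S\<close>, which extends to all parameters
  by analytic continuation along complex lines in \<open>V\<close>.  Finally \<open>A = S (23) S (34)\<close>, and invariances
  compose because \<open>L\<close> is continuous along lines.
\<close>

section \<open>Gauss's summation theorem\<close>

text \<open>The form of \<open>L\<close> is what makes a single integral possible. Against the
  weight u^(c-1) (1-u)^(s-1) F(f-d,g-d;s;1-u) the power u^n integrates to a constant times (c)_n
  (d)_n / ((f)_n (g)_n), so F(a,b;e;u) produces the first series. The companion solution u^(1-e)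
  F(1+a-e,1+b-e;2-e;u) only moves c to 1+c-e and produces the second. The Gamma factors and the sine
  in \<open>L\<close> are those of the one combination of both solutions that is regular at u = 1,
  namely F(a,b;s;1-u). The obstacle is that the representation holds in a small region only, while
  \<open>L\<close> is undefined on infinitely many hyperplanes. A complex line through one point of
  the domain meets these in a countable set, whose complement in the plane is connected, so one
  complex variable suffices for the continuation. Holomorphy along lines rests on a decay of the
  terms that is uniform on compact sets and comes from the Saalschuetz condition. The continuation
  for S starts at a fixed point of S, so that the lines towards x and S x begin at the same
  place.\<close>

lemma powr_Suc_le:
  fixes x :: real
  shows "\<exists>K>0. \<forall>n\<ge>1. real n powr x \<le> K * real (Suc n) powr x"
proof (intro exI[of _ "max 1 (2 powr (-x))"] conjI allI impI)
  fix n :: nat assume n: "n \<ge> 1"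
  show "real n powr x \<le> max 1 (2 powr (-x)) * real (Suc n) powr x"
  proof (cases "x \<ge> 0")
    case True
    have "real n powr x \<le> real (Suc n) powr x"
      using True by (intro powr_mono2) auto
    also have "\<dots> \<le> max 1 (2 powr (-x)) * real (Suc n) powr x"
      using mult_right_mono[of 1 "max 1 (2 powr (-x))" "real (Suc n) powr x"] by simp
    finally show ?thesis .
  next
    case False
    have "real n powr x \<le> (real (Suc n) / 2) powr x"
      using False n by (intro powr_mono2') auto
    also have "\<dots> = 2 powr (-x) * real (Suc n) powr x"
      by (simp add: powr_divide powr_minus field_simps)
    also have "\<dots> \<le> max 1 (2 powr (-x)) * real (Suc n) powr x"
      by (intro mult_right_mono) auto
    finally show ?thesis .
  qed
qed auto

text \<open>Euler's product for 1/Gamma converges at every z, the poles of Gamma included, and a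
  convergent sequence is bounded. \<open>rGamma_series\<close> of index m carries m + 1 factors, so
  \<open>powr_Suc_le\<close> trades the power of m for one of n = m + 1.\<close>

lemma pochhammer_norm_upper:
  fixes z :: complex
  shows "\<exists>K>0. \<forall>n\<ge>2. norm (pochhammer z n) \<le> K * (fact n * real n powr (Re z - 1))"
proof -
  have "Bseq (rGamma_series z)"
    using rGamma_series_LIMSEQ[of z] convergentI convergent_imp_Bseq by blast
  then obtain K where K: "K > 0" "\<And>n. norm (rGamma_series z n) \<le> K"
    by (auto simp: Bseq_def)
  obtain C where C: "C > 0" "\<And>n. n \<ge> 1 \<Longrightarrow> real n powr Re z \<le> C * real (Suc n) powr Re z"
    using powr_Suc_le[of "Re z"] by blast
  have "norm (pochhammer z n) \<le> (K * C) * (fact n * real n powr (Re z - 1))" if n: "n \<ge> 2" for n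
  proof -
    obtain m where m: "n = Suc m" "m \<ge> 1" using n by (cases n) auto
    have "norm (pochhammer z n) = norm (rGamma_series z m) * (fact m * real m powr Re z)"
      using m by (simp add: rGamma_series_def norm_mult norm_divide norm_exp_eq_Re powr_def)
    also have "\<dots> \<le> K * (fact m * (C * real n powr Re z))"
      using K C(2)[of m] m by (intro mult_mono mult_left_mono) auto
    also have "real n powr Re z = real n * real n powr (Re z - 1)"
      using n by (simp add: powr_diff)
    also have "K * (fact m * (C * (real n * real n powr (Re z - 1)))) =
        (K * C) * (fact n * real n powr (Re z - 1))"
      by (simp add: m algebra_simps)
    finally show ?thesis .
  qed
  with K C show ?thesis by (intro exI[of _ "K * C"]) auto
qed

text \<open>The reciprocal product \<open>Gamma_series'\<close> has exactly n factors in its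
  denominator and is bounded for the same reason; excluding nonpositive integers keeps that
  denominator nonzero.\<close>

lemma pochhammer_norm_lower:
  fixes z :: complex
  assumes "z \<notin> \<int>\<^sub>\<le>\<^sub>0"
  shows "\<exists>K>0. \<forall>n\<ge>2. fact n * real n powr (Re z - 1) \<le> K * norm (pochhammer z n)"
proof -
  have "Bseq (Gamma_series' z)"
    using Gamma_series'_LIMSEQ[of z] convergentI convergent_imp_Bseq by blast
  then obtain K where K: "K > 0" "\<And>n. norm (Gamma_series' z n) \<le> K"
    by (auto simp: Bseq_def)
  have "fact n * real n powr (Re z - 1) \<le> K * norm (pochhammer z n)" if n: "n \<ge> 2" for n
  proof -
    have nz: "pochhammer z n \<noteq> 0"
      using assms pochhammer_eq_0_imp_nonpos_Int by blast
    have "fact n * real n powr (Re z - 1) = fact (n - 1) * real n powr Re z"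
      using n by (simp add: powr_diff fact_reduce)
    also have "\<dots> = norm (Gamma_series' z n) * norm (pochhammer z n)"
      using n nz by (simp add: Gamma_series'_def norm_mult norm_divide norm_exp_eq_Re powr_def)
    also have "\<dots> \<le> K * norm (pochhammer z n)"
      using K by (intro mult_right_mono) auto
    finally show ?thesis .
  qed
  with K show ?thesis by blast
qed

definition gauss_coeff :: "complex \<Rightarrow> complex \<Rightarrow> complex \<Rightarrow> nat \<Rightarrow> complex" where
  "gauss_coeff a b c n = pochhammer a n * pochhammer b n / (fact n * pochhammer c n)"

definition hyp2F1 :: "complex \<Rightarrow> complex \<Rightarrow> complex \<Rightarrow> complex \<Rightarrow> complex" where
  "hyp2F1 a b c z = (\<Sum>n. gauss_coeff a b c n * z ^ n)"

lemma gauss_coeff_0 [simp]: "gauss_coeff a b c 0 = 1"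
  by (simp add: gauss_coeff_def)

lemma gauss_coeff_Suc:
  assumes "c \<notin> \<int>\<^sub>\<le>\<^sub>0"
  shows "of_nat (Suc n) * (c + of_nat n) * gauss_coeff a b c (Suc n) =
    (a + of_nat n) * (b + of_nat n) * gauss_coeff a b c n"
proof -
  have "pochhammer c n \<noteq> 0" "c + of_nat n \<noteq> 0"
    using assms pochhammer_eq_0_imp_nonpos_Int plus_of_nat_eq_0_imp by blast+
  then show ?thesis
    by (simp add: gauss_coeff_def pochhammer_rec' divide_simps del: of_nat_Suc)
qed

lemma gauss_coeff_shift:
  assumes "c \<notin> \<int>\<^sub>\<le>\<^sub>0"
  shows "(c + of_nat n) * gauss_coeff a b (c + 1) n = c * gauss_coeff a b c n"
proof -
  have nz: "pochhammer c n \<noteq> 0" "pochhammer (c + 1) n \<noteq> 0"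
    using assms pochhammer_eq_0_imp_nonpos_Int plus_one_in_nonpos_Ints_imp by blast+
  have "(c + of_nat n) * pochhammer c n = c * pochhammer (c + 1) n"
    using pochhammer_rec[of c n] pochhammer_rec'[of c n] by simp
  with nz show ?thesis
    by (simp add: gauss_coeff_def frac_eq_eq)
qed

lemma gauss_coeff_bound:
  assumes "c \<notin> \<int>\<^sub>\<le>\<^sub>0"
  shows "\<exists>K>0. \<forall>n\<ge>2. norm (gauss_coeff a b c n) \<le> K * real n powr (Re (a + b - c) - 1)"
proof -
  obtain A where A: "A > 0" "\<And>n. n\<ge>2 \<Longrightarrow> norm (pochhammer a n) \<le> A * (fact n * real n powr (Re a - 1))"
    using pochhammer_norm_upper[of a] by blast
  obtain B where B: "B > 0" "\<And>n. n\<ge>2 \<Longrightarrow> norm (pochhammer b n) \<le> B * (fact n * real n powr (Re b - 1))"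
    using pochhammer_norm_upper[of b] by blast
  obtain C where C: "C > 0" "\<And>n. n\<ge>2 \<Longrightarrow> fact n * real n powr (Re c - 1) \<le> C * norm (pochhammer c n)"
    using pochhammer_norm_lower[OF assms] by blast
  have "norm (gauss_coeff a b c n) \<le> (A * B * C) * real n powr (Re (a + b - c) - 1)" if n: "n \<ge> 2" for n
  proof -
    have nz: "pochhammer c n \<noteq> 0"
      using assms pochhammer_eq_0_imp_nonpos_Int by blast
    have pos: "real n powr x > 0" for x using n by simp
    have "1 / norm (pochhammer c n) \<le> C / (fact n * real n powr (Re c - 1))"
      using C(2)[OF n] C(1) nz pos by (simp add: field_simps)
    then have "norm (pochhammer a n) * norm (pochhammer b n) / fact n * (1 / norm (pochhammer c n)) \<le>
        (A * (fact n * real n powr (Re a - 1))) * (B * (fact n * real n powr (Re b - 1))) / fact n *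
        (C / (fact n * real n powr (Re c - 1)))"
      using A(1) B(1) A(2)[OF n] B(2)[OF n] by (intro mult_mono divide_right_mono) auto
    then have "norm (gauss_coeff a b c n) \<le> (A * (fact n * real n powr (Re a - 1))) *
        (B * (fact n * real n powr (Re b - 1))) / fact n * (C / (fact n * real n powr (Re c - 1)))"
      by (simp add: gauss_coeff_def norm_divide norm_mult)
    also have "\<dots> = (A * B * C) * (real n powr (Re a - 1) * real n powr (Re b - 1) / real n powr (Re c - 1))"
      by simp
    also have "real n powr (Re a - 1) * real n powr (Re b - 1) / real n powr (Re c - 1) =
       real n powr (Re (a + b - c) - 1)"
      by (simp flip: powr_add powr_diff add: algebra_simps)
    finally show ?thesis .
  qed
  with A B C show ?thesis by (intro exI[of _ "A * B * C"]) auto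
qed

lemma summable_norm_gauss_coeff:
  assumes "c \<notin> \<int>\<^sub>\<le>\<^sub>0" "Re (c - a - b) > 0"
  shows "summable (\<lambda>n. norm (gauss_coeff a b c n))"
proof -
  obtain K where K: "\<And>n. n \<ge> 2 \<Longrightarrow> norm (gauss_coeff a b c n) \<le> K * real n powr (Re (a + b - c) - 1)"
    using gauss_coeff_bound[OF assms(1)] by blast
  have "summable (\<lambda>n. K * real n powr (Re (a + b - c) - 1))"
    using assms by (intro summable_mult) (simp add: summable_real_powr_iff)
  then show ?thesis
    by (rule summable_comparison_test'[where N=2]) (use K in auto)
qed

text \<open>Removes the boundary term at infinity when \<open>Gauss_sum_recurrence\<close>
  telescopes.\<close>

lemma tendsto_n_gauss_coeff:
  assumes "c \<notin> \<int>\<^sub>\<le>\<^sub>0" "Re (c - a - b) > 0"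
  shows "(\<lambda>n. of_nat n * gauss_coeff a b c n) \<longlonglongrightarrow> 0"
proof -
  obtain K where K: "\<And>n. n \<ge> 2 \<Longrightarrow> norm (gauss_coeff a b c n) \<le> K * real n powr (Re (a + b - c) - 1)"
    using gauss_coeff_bound[OF assms(1)] by blast
  have "(\<lambda>n. K * real n powr Re (a + b - c)) \<longlonglongrightarrow> K * 0"
    using assms by (intro tendsto_mult tendsto_const tendsto_neg_powr filterlim_real_sequentially) auto
  then have lim: "(\<lambda>n. K * real n powr Re (a + b - c)) \<longlonglongrightarrow> 0" by simp
  show ?thesis
  proof (rule Lim_null_comparison[OF _ lim])
    show "\<forall>\<^sub>F n in sequentially. norm (of_nat n * gauss_coeff a b c n) \<le> K * real n powr Re (a + b - c)"
      using eventually_ge_at_top[of 2]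
    proof eventually_elim
      case (elim n)
      have "norm (of_nat n * gauss_coeff a b c n) \<le> real n * (K * real n powr (Re (a + b - c) - 1))"
        using K[OF elim] unfolding norm_mult by (intro mult_mono) auto
      also have "\<dots> = K * real n powr Re (a + b - c)"
        using elim by (simp add: powr_diff)
      finally show ?case .
    qed
  qed
qed

text \<open>Termwise the two sides differ, but by G(n+1) - G(n) with G(0) = 0 and G tending to 0, so
  the difference sums to 0.\<close>

lemma Gauss_sum_recurrence:
  assumes c: "c \<notin> \<int>\<^sub>\<le>\<^sub>0" and re: "Re (c - a - b) > 0"
  shows "c * (c - a - b) * (\<Sum>n. gauss_coeff a b c n) =
     (c - a) * (c - b) * (\<Sum>n. gauss_coeff a b (c + 1) n)"
proof -
  have c1: "c + 1 \<notin> \<int>\<^sub>\<le>\<^sub>0"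
    using c plus_one_in_nonpos_Ints_imp by blast
  have s0: "summable (gauss_coeff a b c)"
    using summable_norm_cancel[OF summable_norm_gauss_coeff[OF c re]] .
  have s1: "summable (gauss_coeff a b (c + 1))"
    using re by (intro summable_norm_cancel[OF summable_norm_gauss_coeff[OF c1]]) auto
  \<comment> \<open>Zeilberger's certificate for the shift from \<open>c\<close> to \<open>c + 1\<close>\<close>
  define G where "G = (\<lambda>n. - c * (of_nat n * gauss_coeff a b c n))"
  have tele: "c * (c - a - b) * gauss_coeff a b c n - (c - a) * (c - b) * gauss_coeff a b (c + 1) n
      = G (Suc n) - G n" for n
  proof -
    have nz: "c + of_nat n \<noteq> 0" using c plus_of_nat_eq_0_imp by blast
    have e1: "gauss_coeff a b (c + 1) n = c * gauss_coeff a b c n / (c + of_nat n)"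
      using gauss_coeff_shift[OF c] nz by (simp add: field_simps)
    have e2: "of_nat (Suc n) * gauss_coeff a b c (Suc n) =
        (a + of_nat n) * (b + of_nat n) * gauss_coeff a b c n / (c + of_nat n)"
      using gauss_coeff_Suc[OF c, of n a b] nz by (simp add: field_simps)
    show ?thesis
      unfolding G_def e1 e2 using nz
      by (simp add: divide_simps) (simp add: algebra_simps)
  qed
  have "G \<longlonglongrightarrow> - c * 0"
    unfolding G_def by (intro tendsto_mult tendsto_const tendsto_n_gauss_coeff assms)
  then have "(\<lambda>n. G (Suc n) - G n) sums (0 - G 0)"
    by (intro telescope_sums) simp
  moreover have "(\<lambda>n. c * (c - a - b) * gauss_coeff a b c n - (c - a) * (c - b) * gauss_coeff a b (c + 1) n)
     sums (c * (c - a - b) * (\<Sum>n. gauss_coeff a b c n) -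
     (c - a) * (c - b) * (\<Sum>n. gauss_coeff a b (c + 1) n))"
    by (intro sums_diff sums_mult summable_sums s0 s1)
  ultimately show ?thesis
    unfolding tele by (simp add: G_def sums_iff)
qed

lemma Re_pos_not_nonpos_Int: "Re z > 0 \<Longrightarrow> z \<notin> \<int>\<^sub>\<le>\<^sub>0"
  by (auto elim!: nonpos_Ints_cases)

lemma pochhammer_neq_0_if_not_nonpos_Int:
  "z \<notin> \<int>\<^sub>\<le>\<^sub>0 \<Longrightarrow> pochhammer (z :: complex) n \<noteq> 0"
  using pochhammer_eq_0_imp_nonpos_Int by blast

text \<open>Iteration pushes c to infinity, where only the term k = 0 survives; the Pochhammer
  quotients then turn into the Gamma quotient of Gauss's theorem.\<close>

lemma Gauss_sum_iterated:
  assumes c: "Re c > 0" and re: "Re (c - a - b) > 0"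
  shows "pochhammer c n * pochhammer (c - a - b) n * (\<Sum>k. gauss_coeff a b c k) =
     pochhammer (c - a) n * pochhammer (c - b) n * (\<Sum>k. gauss_coeff a b (c + of_nat n) k)"
proof (induction n)
  case (Suc n)
  have "pochhammer c (Suc n) * pochhammer (c - a - b) (Suc n) * (\<Sum>k. gauss_coeff a b c k) =
     (c + of_nat n) * (c - a - b + of_nat n) * (pochhammer c n * pochhammer (c - a - b) n * (\<Sum>k. gauss_coeff a b c k))"
    by (simp add: pochhammer_rec')
  also have "\<dots> = pochhammer (c - a) n * pochhammer (c - b) n * ((c + of_nat n) * (c + of_nat n - a - b) * (\<Sum>k. gauss_coeff a b (c + of_nat n) k))"
    unfolding Suc by (simp add: algebra_simps)
  also have "(c + of_nat n) * (c + of_nat n - a - b) * (\<Sum>k. gauss_coeff a b (c + of_nat n) k) =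
     (c + of_nat n - a) * (c + of_nat n - b) * (\<Sum>k. gauss_coeff a b (c + of_nat n + 1) k)"
    using assms by (intro Gauss_sum_recurrence Re_pos_not_nonpos_Int) auto
  finally show ?case by (simp add: pochhammer_rec' algebra_simps)
qed auto

text \<open>A shift to the right increases the positive real part of each factor and keeps its
  imaginary part. It makes the unshifted series a majorant for Tannery's theorem.\<close>

lemma norm_pochhammer_shift_ge:
  assumes "Re c > 0"
  shows "norm (pochhammer c k) \<le> norm (pochhammer (c + of_nat n) k)"
proof (induction k)
  case (Suc k)
  have "norm (c + of_nat k) \<le> norm (c + of_nat n + of_nat k)"
    using assms unfolding cmod_def by (intro real_sqrt_le_mono add_mono) (auto intro: power_mono)
  then show ?case using Suc
    by (simp add: pochhammer_rec' norm_mult mult_mono)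
qed auto

lemma Gauss_sum_shift_tendsto:
  assumes c: "Re c > 0" and re: "Re (c - a - b) > 0"
  shows "(\<lambda>n. \<Sum>k. gauss_coeff a b (c + of_nat n) k) \<longlonglongrightarrow> 1"
proof -
  \<comment> \<open>For k > 0 the leading factor c + n of the denominator forces decay like 1/n; the
    other m = k - 1 factors stay bounded below by \<open>norm_pochhammer_shift_ge\<close>.\<close>
  have lim: "(\<lambda>n. gauss_coeff a b (c + of_nat n) k) \<longlonglongrightarrow> (if k = 0 then 1 else 0)" for k
  proof (cases k)
    case (Suc m)
    define D where "D = norm (pochhammer a k * pochhammer b k) / (fact k * norm (pochhammer (c + 1) m))"
    have "pochhammer (c + 1) m \<noteq> 0"
      using c by (intro pochhammer_neq_0_if_not_nonpos_Int Re_pos_not_nonpos_Int) auto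
    then have pos: "norm (pochhammer (c + 1) m) > 0" by simp
    have "\<forall>\<^sub>F n in sequentially. norm (gauss_coeff a b (c + of_nat n) k) \<le> D / real n"
      using eventually_gt_at_top[of 0]
    proof eventually_elim
      case (elim n)
      have "real n \<le> Re (c + of_nat n)" using c by simp
      also have "\<dots> \<le> norm (c + of_nat n)" by (rule complex_Re_le_cmod)
      finally have "real n * norm (pochhammer (c + 1) m) \<le>
          norm (c + of_nat n) * norm (pochhammer (c + 1 + of_nat n) m)"
        using c by (intro mult_mono norm_pochhammer_shift_ge) auto
      also have "\<dots> = norm (pochhammer (c + of_nat n) k)"
        by (simp add: Suc pochhammer_rec norm_mult add_ac)
      finally have "real n * norm (pochhammer (c + 1) m) \<le> norm (pochhammer (c + of_nat n) k)" .
      moreover have "pochhammer (c + of_nat n) k \<noteq> 0"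
        using c by (intro pochhammer_neq_0_if_not_nonpos_Int Re_pos_not_nonpos_Int) auto
      ultimately have "norm (pochhammer a k * pochhammer b k) / (fact k * norm (pochhammer (c + of_nat n) k))
          \<le> norm (pochhammer a k * pochhammer b k) / (fact k * (real n * norm (pochhammer (c + 1) m)))"
        using elim pos by (intro divide_left_mono mult_left_mono mult_pos_pos) auto
      then show ?case
        by (simp add: gauss_coeff_def D_def norm_mult norm_divide mult_ac)
    qed
    then have "(\<lambda>n. gauss_coeff a b (c + of_nat n) k) \<longlonglongrightarrow> 0"
      by (rule Lim_null_comparison) (rule lim_const_over_n)
    with Suc show ?thesis by simp
  qed simp
  have dom: "norm (gauss_coeff a b (c + of_nat n) k) \<le> norm (gauss_coeff a b c k)" for n k
  proof -
    have "pochhammer c k \<noteq> 0"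
      using c by (intro pochhammer_neq_0_if_not_nonpos_Int Re_pos_not_nonpos_Int) auto
    then have "norm (pochhammer c k) > 0" by simp
    then show ?thesis
      unfolding gauss_coeff_def norm_divide norm_mult[of "fact k"]
      using norm_pochhammer_shift_ge[OF c, of k n]
      by (intro divide_left_mono mult_left_mono mult_pos_pos) (auto intro: less_le_trans)
  qed
  have "(\<lambda>n. \<Sum>k. gauss_coeff a b (c + of_nat n) k) \<longlonglongrightarrow> (\<Sum>k. if k = 0 then 1 else 0)"
  proof (rule tannerys_theorem[THEN conjunct2, THEN conjunct2])
    show "summable (\<lambda>k. norm (gauss_coeff a b c k))"
      using assms by (intro summable_norm_gauss_coeff Re_pos_not_nonpos_Int) auto
    show "\<forall>\<^sub>F (k, n) in at_top \<times>\<^sub>F sequentially.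
        norm (gauss_coeff a b (c + of_nat n) k) \<le> norm (gauss_coeff a b c k)"
      using dom by (simp add: always_eventually case_prod_unfold)
  qed (use lim in auto)
  then show ?thesis using sums_unique[OF sums_single[of 0 "\<lambda>_. 1 :: complex"]] by simp
qed

theorem Gauss_sum:
  assumes c: "Re c > 0" and re: "Re (c - a - b) > 0"
  shows "(\<Sum>k. gauss_coeff a b c k) = Gamma c * Gamma (c - a - b) * rGamma (c - a) * rGamma (c - b)"
proof -
  have nz: "Gamma c \<noteq> 0" "Gamma (c - a - b) \<noteq> 0"
    using Re_pos_not_nonpos_Int[OF c] Re_pos_not_nonpos_Int[OF re] by (auto simp: Gamma_eq_zero_iff)
  define S where "S = (\<Sum>k. gauss_coeff a b c k)"
  have eq: "rGamma_series c n * rGamma_series (c - a - b) n * S = 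
      rGamma_series (c - a) n * rGamma_series (c - b) n * (\<Sum>k. gauss_coeff a b (c + of_nat (Suc n)) k)" for n
  proof -
    define l where "l = (of_real (ln (of_nat n)) :: complex)"
    \<comment> \<open>The powers of n in the four Euler products cancel because c + (c-a-b) = (c-a)
      + (c-b). The iteration is used at \<open>Suc n\<close> because each product has n + 1
      factors.\<close>
    have "exp (c * l) * exp ((c - a - b) * l) = exp ((c - a) * l) * exp ((c - b) * l)"
      by (simp flip: exp_add add: algebra_simps)
    with Gauss_sum_iterated[OF assms, of "Suc n"] show ?thesis
      unfolding rGamma_series_def S_def l_def[symmetric]
      by (simp add: field_simps del: of_nat_Suc exp_of_nat_mult)
  qed
  have "(\<lambda>n. rGamma_series c n * rGamma_series (c - a - b) n * S) \<longlonglongrightarrow> rGamma c * rGamma (c - a - b) * S"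
    by (intro tendsto_intros)
  moreover have "(\<lambda>n. rGamma_series c n * rGamma_series (c - a - b) n * S) \<longlonglongrightarrow> rGamma (c - a) * rGamma (c - b) * 1"
    unfolding eq by (intro tendsto_intros LIMSEQ_Suc[OF Gauss_sum_shift_tendsto] assms)
  ultimately have "rGamma c * rGamma (c - a - b) * S = rGamma (c - a) * rGamma (c - b) * 1"
    by (rule LIMSEQ_unique)
  then show ?thesis using nz unfolding S_def[symmetric]
    by (simp add: rGamma_inverse_Gamma field_simps)
qed

section \<open>Convergence of the Gauss series inside the unit disc\<close>

lemma tendsto_ratio_shift: "(\<lambda>n. (a + of_nat n) / (c + of_nat n) :: complex) \<longlonglongrightarrow> 1"
proof -
  have inf: "filterlim (\<lambda>n. c + of_nat n :: complex) at_infinity sequentially"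
    by (rule tendsto_add_filterlim_at_infinity[OF tendsto_const tendsto_of_nat])
  have "(\<lambda>n. 1 + (a - c) / (c + of_nat n)) \<longlonglongrightarrow> 1 + 0"
    by (intro tendsto_add tendsto_const tendsto_divide_0[OF tendsto_const inf])
  moreover have "\<forall>\<^sub>F n in sequentially. 1 + (a - c) / (c + of_nat n) = (a + of_nat n) / (c + of_nat n)"
    using filterlim_at_infinity_imp_eventually_ne[OF inf, of 0]
    by eventually_elim (simp add: field_simps)
  ultimately show ?thesis using Lim_transform_eventually by fastforce
qed

lemma summable_gauss_power:
  assumes c: "c \<notin> \<int>\<^sub>\<le>\<^sub>0" and z: "norm z < 1"
  shows "summable (\<lambda>n. norm (gauss_coeff a b c n * z ^ n))"
proof -
  have "(\<lambda>n. norm ((a + of_nat n) / (1 + of_nat n) * ((b + of_nat n) / (c + of_nat n)) * z))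
      \<longlonglongrightarrow> norm (1 * 1 * z)"
    by (intro tendsto_norm tendsto_mult tendsto_ratio_shift tendsto_const)
  moreover have "norm (1 * 1 * z) < (1 + norm z) / 2" using z by simp
  ultimately have "\<forall>\<^sub>F n in sequentially. norm ((a + of_nat n) / (1 + of_nat n) *
      ((b + of_nat n) / (c + of_nat n)) * z) < (1 + norm z) / 2"
    by (rule order_tendstoD)
  then obtain N where N: "\<And>n. n \<ge> N \<Longrightarrow> norm ((a + of_nat n) / (1 + of_nat n) *
      ((b + of_nat n) / (c + of_nat n)) * z) < (1 + norm z) / 2"
    unfolding eventually_sequentially by blast
  show ?thesis
  proof (rule summable_ratio_test[of "(1 + norm z) / 2" N])
    fix n assume n: "n \<ge> N"
    have nz: "c + of_nat n \<noteq> 0" "1 + of_nat n \<noteq> (0::complex)"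
      using plus_of_nat_eq_0_imp[of c n] c of_nat_neq_0[of n, where 'a=complex] by auto
    have "(1 + of_nat n) * (c + of_nat n) * gauss_coeff a b c (Suc n) =
        (a + of_nat n) * (b + of_nat n) * gauss_coeff a b c n"
      using gauss_coeff_Suc[OF c, of n a b] by simp
    with nz have "gauss_coeff a b c (Suc n) =
        (a + of_nat n) * (b + of_nat n) * gauss_coeff a b c n / ((1 + of_nat n) * (c + of_nat n))"
      by (subst eq_divide_eq) (simp add: mult_ac)
    then have "gauss_coeff a b c (Suc n) * z ^ Suc n = ((a + of_nat n) / (1 + of_nat n) *
      ((b + of_nat n) / (c + of_nat n)) * z) * (gauss_coeff a b c n * z ^ n)"
      by (simp only: times_divide_eq_left times_divide_eq_right divide_divide_eq_left power_Suc mult_ac)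
    then have "norm (gauss_coeff a b c (Suc n) * z ^ Suc n) =
        norm ((a + of_nat n) / (1 + of_nat n) * ((b + of_nat n) / (c + of_nat n)) * z) *
        norm (gauss_coeff a b c n * z ^ n)"
      by (simp only: norm_mult)
    also have "\<dots> \<le> (1 + norm z) / 2 * norm (gauss_coeff a b c n * z ^ n)"
      using N[OF n] by (intro mult_right_mono) auto
    finally show "norm (norm (gauss_coeff a b c (Suc n) * z ^ Suc n)) \<le>
        (1 + norm z) / 2 * norm (norm (gauss_coeff a b c n * z ^ n))"
      by (simp only: real_norm_def abs_norm_cancel)
  qed (use z in auto)
qed

lemma summable_gauss_power':
  "c \<notin> \<int>\<^sub>\<le>\<^sub>0 \<Longrightarrow> norm z < 1 \<Longrightarrow> summable (\<lambda>n. gauss_coeff a b c n * z ^ n)"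
  by (rule summable_norm_cancel[OF summable_gauss_power])

section \<open>Beta integrals and Mellin transforms\<close>

text \<open>The space itself is the open interval, so power identities and expansions valid for 0 <
  u < 1 hold at every point of it rather than almost everywhere.\<close>

definition unit_measure :: "real measure" where
  "unit_measure = restrict_space lborel {0<..<1}"

lemma space_unit_measure [simp]: "space unit_measure = {0<..<1}"
  by (simp add: unit_measure_def space_restrict_space)

lemma measurable_unit_measure_continuous:
  fixes f :: "real \<Rightarrow> 'a::topological_space"
  assumes "continuous_on {0<..<1} f"
  shows "f \<in> borel_measurable unit_measure"
proof -
  have "f \<in> borel_measurable (restrict_space borel {0<..<1})"
    using assms by (rule borel_measurable_continuous_on_restrict)
  moreover have "sets unit_measure = sets (restrict_space borel {0<..<1::real})"
    unfolding unit_measure_def by (intro sets_restrict_space_cong) simp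
  ultimately show ?thesis by (simp cong: measurable_cong_sets)
qed

lemma unit_measure_lborel:
  fixes f :: "real \<Rightarrow> 'a::{banach, second_countable_topology}"
  shows "integrable unit_measure f \<longleftrightarrow> set_integrable lborel {0<..<1} f"
    and "integral\<^sup>L unit_measure f = set_lebesgue_integral lborel {0<..<1} f"
  by (simp_all add: unit_measure_def set_integrable_def set_lebesgue_integral_def
      integrable_restrict_space integral_restrict_space)

text \<open>Carries values obtained by gauge integration, such as those of the fundamental theorem,
  over to the Lebesgue integral in which sums are exchanged.\<close>

lemma unit_integral_eqI:
  fixes f :: "real \<Rightarrow> 'a::euclidean_space"
  assumes "integrable unit_measure f" "(f has_integral I) {0..1}"
  shows "integral\<^sup>L unit_measure f = I"
proof -
  have "integral\<^sup>L unit_measure f = integral {0<..<1} f"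
    using assms(1) unfolding unit_measure_lborel by (intro set_borel_integral_eq_integral)
  also have "(f has_integral I) {0<..<1}"
    using assms(2) by (simp add: has_integral_Icc_iff_Ioo)
  then have "integral {0<..<1} f = I" by (rule integral_unique)
  finally show ?thesis .
qed

lemma unit_integral_real_Beta:
  assumes "x > 0" "y > (0::real)"
  shows "integrable unit_measure (\<lambda>u. u powr (x - 1) * (1 - u) powr (y - 1))"
    and "integral\<^sup>L unit_measure (\<lambda>u. u powr (x - 1) * (1 - u) powr (y - 1)) = Beta x y"
proof -
  show *: "integrable unit_measure (\<lambda>u. u powr (x - 1) * (1 - u) powr (y - 1))"
    unfolding unit_measure_lborel by (rule set_integrable_subset[OF integrable_Beta[OF assms]]) auto
  show "integral\<^sup>L unit_measure (\<lambda>u. u powr (x - 1) * (1 - u) powr (y - 1)) = Beta x y"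
    by (rule unit_integral_eqI[OF * has_integral_Beta_real[OF assms]])
qed

lemma unit_integral_sums:
  fixes f :: "nat \<Rightarrow> real \<Rightarrow> complex"
  assumes "\<And>n. integrable unit_measure (f n)"
    and "\<And>u. 0 < u \<Longrightarrow> u < 1 \<Longrightarrow> summable (\<lambda>n. norm (f n u))"
    and "summable (\<lambda>n. \<integral>u. norm (f n u) \<partial>unit_measure)"
  shows "integrable unit_measure (\<lambda>u. \<Sum>n. f n u)"
    and "(\<lambda>n. \<integral>u. f n u \<partial>unit_measure) sums (\<integral>u. (\<Sum>n. f n u) \<partial>unit_measure)"
proof -
  have ae: "AE u in unit_measure. summable (\<lambda>n. norm (f n u))"
    by (rule AE_I2) (use assms(2) in auto)
  show "integrable unit_measure (\<lambda>u. \<Sum>n. f n u)"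
    by (rule integrable_suminf[OF assms(1) ae assms(3)])
  show "(\<lambda>n. \<integral>u. f n u \<partial>unit_measure) sums (\<integral>u. (\<Sum>n. f n u) \<partial>unit_measure)"
    by (rule sums_integral[OF assms(1) ae assms(3)])
qed

lemma norm_of_real_powr: "u > 0 \<Longrightarrow> norm (of_real u powr z :: complex) = u powr Re z"
  by (simp add: norm_powr_real_powr)

lemma norm_one_minus_powr: "u < 1 \<Longrightarrow> norm ((1 - of_real u) powr z :: complex) = (1 - u) powr Re z"
  using norm_of_real_powr[of "1 - u" z] by simp

lemma continuous_on_of_real_powr [continuous_intros]:
  assumes "continuous_on A g" "\<And>u. u \<in> A \<Longrightarrow> g u > 0"
  shows "continuous_on A (\<lambda>u. of_real (g u) powr (z :: complex))"
  using assms by (intro continuous_intros) (auto intro: less_imp_le dest: assms(2))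

lemma integrable_complex_Beta:
  assumes "Re z > 0" "Re w > 0"
  shows "integrable unit_measure (\<lambda>u. of_real u powr (z - 1) * of_real (1 - u) powr (w - 1) :: complex)"
proof (rule Bochner_Integration.integrable_bound)
  show "integrable unit_measure (\<lambda>u. u powr (Re z - 1) * (1 - u) powr (Re w - 1))"
    by (rule unit_integral_real_Beta) (use assms in auto)
  show "(\<lambda>u. of_real u powr (z - 1) * of_real (1 - u) powr (w - 1) :: complex) \<in> borel_measurable unit_measure"
    by (intro measurable_unit_measure_continuous continuous_intros) auto
  show "AE u in unit_measure. norm (of_real u powr (z - 1) * of_real (1 - u) powr (w - 1) :: complex)
      \<le> norm (u powr (Re z - 1) * (1 - u) powr (Re w - 1))"
    by (rule AE_I2) (auto simp: norm_mult norm_of_real_powr norm_one_minus_powr)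
qed

lemma integrable_unit_powr:
  assumes "Re z > 0"
  shows "integrable unit_measure (\<lambda>u. of_real u powr (z - 1) :: complex)"
proof -
  have "integrable unit_measure (\<lambda>u. of_real u powr (z - 1) * of_real (1 - u) powr (1 - 1) :: complex)"
    by (rule integrable_complex_Beta) (use assms in auto)
  moreover have "integrable unit_measure (\<lambda>u. of_real u powr (z - 1) * of_real (1 - u) powr (1 - 1) :: complex)
     \<longleftrightarrow> integrable unit_measure (\<lambda>u. of_real u powr (z - 1) :: complex)"
    by (rule Bochner_Integration.integrable_cong) auto
  ultimately show ?thesis by simp
qed

lemma unit_integral_powr:
  assumes "Re z > 0"
  shows "(\<integral>u. of_real u powr (z - 1) \<partial>unit_measure) = 1 / z"
proof (rule unit_integral_eqI[OF integrable_unit_powr[OF assms]])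
  have nz: "z \<noteq> 0" using assms by auto
  have "((\<lambda>u. of_real u powr (z - 1)) has_integral (of_real 1 powr z / z - of_real 0 powr z / z)) {0..1::real}"
  proof (rule fundamental_theorem_of_calculus_interior)
    show "continuous_on {0..1} (\<lambda>u::real. of_real u powr z / z)"
      using nz assms by (intro continuous_intros) auto
    fix x :: real assume "x \<in> {0<..<1}"
    then have "((\<lambda>u. u powr z / z) has_field_derivative (z * of_real x powr (z - 1)) / z) (at (of_real x))"
      by (intro DERIV_cdivide has_field_derivative_powr) (auto simp: complex_nonpos_Reals_iff)
    then show "((\<lambda>u::real. of_real u powr z / z) has_vector_derivative of_real x powr (z - 1)) (at x)"
      using nz by (intro has_vector_derivative_real_field) simp
  qed auto
  then show "((\<lambda>u. of_real u powr (z - 1)) has_integral 1 / z) {0..1::real}" by simp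
qed

text \<open>Expanding \<open>(1 - u)\<^bsup>w-1\<^esup>\<close> binomially turns the integral into a series summed by Gauss's theorem.\<close>

theorem unit_integral_complex_Beta:
  assumes z: "Re z > 0" and w: "Re w > 0"
  shows "(\<integral>u. of_real u powr (z - 1) * of_real (1 - u) powr (w - 1) \<partial>unit_measure) = 
    Gamma z * Gamma w * rGamma (z + w)"
proof -
  \<comment> \<open>\<open>gauss_coeff (1 - w) 1 1 n\<close> is (1-w)_n / n!, the coefficient of u^n
    in (1-u)^(w-1).\<close>
  define f where "f = (\<lambda>n u. gauss_coeff (1 - w) 1 1 n * of_real u ^ n * of_real u powr (z - 1) :: complex)"
  \<comment> \<open>Integrating u^n gives 1/(x+n) = (x)_n / (x (x+1)_n), which makes the series one
    of Gauss's type at 1. A general x is needed because the norms of the terms lead to x = Re z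
    while w stays complex.\<close>
  have coeff: "gauss_coeff (1 - w) 1 1 n / (x + of_nat n) = gauss_coeff (1 - w) x (x + 1) n / x"
    if "Re x > 0" for n x
  proof -
    have nz: "pochhammer x n \<noteq> 0" "pochhammer (x + 1) n \<noteq> 0" "x + of_nat n \<noteq> 0" "x \<noteq> 0"
    proof -
      show "pochhammer x n \<noteq> 0" "pochhammer (x + 1) n \<noteq> 0"
        using that by (auto intro!: pochhammer_neq_0_if_not_nonpos_Int Re_pos_not_nonpos_Int)
      show "x + of_nat n \<noteq> 0" "x \<noteq> 0"
        using that by (auto simp: complex_eq_iff)
    qed
    have "(x + of_nat n) * pochhammer x n = x * pochhammer (x + 1) n"
      using pochhammer_rec[of x n] pochhammer_rec'[of x n] by simp
    with nz show ?thesis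
      by (simp add: gauss_coeff_def frac_eq_eq pochhammer_fact[symmetric] mult.commute)
  qed
  have f_eq: "f n u = gauss_coeff (1 - w) 1 1 n * of_real u powr (z + of_nat n - 1)"
    if "0 < u" "u < 1" for n u
    using that by (simp add: f_def powr_diff powr_add powr_nat')
  have int: "integrable unit_measure (f n)" for n
    by (subst Bochner_Integration.integrable_cong[OF refl f_eq])
      (use z in \<open>auto intro!: integrable_mult_right integrable_unit_powr\<close>)
  have fint: "(\<integral>u. f n u \<partial>unit_measure) = gauss_coeff (1 - w) z (z + 1) n / z" for n
  proof -
    have "(\<integral>u. f n u \<partial>unit_measure) = (\<integral>u. gauss_coeff (1 - w) 1 1 n * of_real u powr (z + of_nat n - 1) \<partial>unit_measure)"
      by (rule Bochner_Integration.integral_cong) (auto simp: f_eq)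
    also have "\<dots> = gauss_coeff (1 - w) 1 1 n / (z + of_nat n)"
      using unit_integral_powr[of "z + of_nat n"] z by simp
    also have "\<dots> = gauss_coeff (1 - w) z (z + 1) n / z" by (rule coeff[OF z])
    finally show ?thesis .
  qed
  have nint: "(\<integral>u. norm (f n u) \<partial>unit_measure) = norm (gauss_coeff (1 - w) (of_real (Re z)) (of_real (Re z) + 1) n) / Re z" for n
  proof -
    have "of_real (\<integral>u. norm (f n u) \<partial>unit_measure) =
        (\<integral>u. of_real (norm (gauss_coeff (1 - w) 1 1 n)) * of_real u powr (of_real (Re z) + of_nat n - 1) \<partial>unit_measure :: complex)"
      unfolding integral_complex_of_real[symmetric]
    proof (rule Bochner_Integration.integral_cong)
      fix u assume "u \<in> space unit_measure"
      then have u: "0 < u" "u < 1" by auto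
      have "complex_of_real u powr (of_real (Re z) + of_nat n - 1) = of_real (u powr (Re z + real n - 1))"
        using powr_of_real[of u "Re z + real n - 1"] u by simp
      then show "complex_of_real (norm (f n u)) =
          of_real (norm (gauss_coeff (1 - w) 1 1 n)) * of_real u powr (of_real (Re z) + of_nat n - 1)"
        using u by (simp add: f_eq norm_mult norm_of_real_powr)
    qed simp
    also have "\<dots> = of_real (norm (gauss_coeff (1 - w) 1 1 n) / (Re z + of_nat n))"
      using unit_integral_powr[of "of_real (Re z) + of_nat n"] z by simp
    finally have "(\<integral>u. norm (f n u) \<partial>unit_measure) = norm (gauss_coeff (1 - w) 1 1 n) / (Re z + of_nat n)"
      by (simp only: of_real_eq_iff)
    also have "\<dots> = norm (gauss_coeff (1 - w) 1 1 n / (of_real (Re z) + of_nat n))"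
      using norm_of_real[of "Re z + real n", where 'a=complex] z by (simp add: norm_divide)
    also have "\<dots> = norm (gauss_coeff (1 - w) (of_real (Re z)) (of_real (Re z) + 1) n / of_real (Re z))"
      using z by (subst coeff) auto
    finally show ?thesis using z by (simp add: norm_divide)
  qed
  have "(\<lambda>n. \<integral>u. f n u \<partial>unit_measure) sums (\<integral>u. (\<Sum>n. f n u) \<partial>unit_measure)"
  proof (rule unit_integral_sums(2)[OF int])
    show "summable (\<lambda>n. norm (f n u))" if "0 < u" "u < 1" for u
      unfolding f_def norm_mult[of _ "of_real u powr _"]
      using that by (intro summable_mult2 summable_gauss_power) auto
    show "summable (\<lambda>n. \<integral>u. norm (f n u) \<partial>unit_measure)"
      unfolding nint using z w
      by (intro summable_divide summable_norm_gauss_coeff Re_pos_not_nonpos_Int) auto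
  qed
  moreover have "(\<Sum>n. f n u) = of_real u powr (z - 1) * of_real (1 - u) powr (w - 1)"
    if u: "0 < u" "u < 1" for u
  proof -
    have "(\<lambda>n. ((w - 1) gchoose n) * (- of_real u) ^ n) sums (1 + (- of_real u)) powr (w - 1)"
      by (rule gen_binomial_complex) (use u in auto)
    moreover have "((w - 1) gchoose n) * (- of_real u) ^ n = gauss_coeff (1 - w) 1 1 n * of_real u ^ n" for n
      by (simp add: gbinomial_pochhammer gauss_coeff_def power_minus[of "of_real u"] pochhammer_fact[symmetric])
    ultimately have "(\<lambda>n. gauss_coeff (1 - w) 1 1 n * of_real u ^ n) sums of_real (1 - u) powr (w - 1)"
      by simp
    from sums_mult2[OF this] show ?thesis
      unfolding f_def by (simp add: sums_iff mult.commute)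
  qed
  then have "(\<integral>u. (\<Sum>n. f n u) \<partial>unit_measure) =
      (\<integral>u. of_real u powr (z - 1) * of_real (1 - u) powr (w - 1) \<partial>unit_measure)"
    by (intro Bochner_Integration.integral_cong) auto
  moreover have "(\<lambda>n. gauss_coeff (1 - w) z (z + 1) n / z) sums (Gamma z * Gamma w * rGamma (z + w))"
  proof -
    have "summable (gauss_coeff (1 - w) z (z + 1))"
      using z w by (intro summable_norm_cancel[OF summable_norm_gauss_coeff] Re_pos_not_nonpos_Int) auto
    then have "gauss_coeff (1 - w) z (z + 1) sums (Gamma (z + 1) * Gamma (z + 1 - (1 - w) - z) * rGamma (z + 1 - (1 - w)) * rGamma (z + 1 - z))"
      using Gauss_sum[of "z + 1" "1 - w" z] z w by (simp add: sums_iff)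
    moreover have "Gamma (z + 1) = z * Gamma z"
      using z by (intro Gamma_plus1 Re_pos_not_nonpos_Int)
    ultimately have "gauss_coeff (1 - w) z (z + 1) sums (z * (Gamma z * Gamma w * rGamma (z + w)))"
      by (simp add: mult_ac)
    from sums_divide[OF this, of z] z show ?thesis by (cases "z = 0") auto
  qed
  ultimately show ?thesis
    unfolding fint by (simp add: sums_iff)
qed

section \<open>Derivative, bounds and Mellin transform of the Gauss function\<close>

lemma diffs_gauss_coeff:
  assumes "c \<notin> \<int>\<^sub>\<le>\<^sub>0"
  shows "diffs (gauss_coeff a b c) n = a * b / c * gauss_coeff (a + 1) (b + 1) (c + 1) n"
  using of_nat_neq_0[of n, where 'a=complex]
  unfolding diffs_def gauss_coeff_def pochhammer_rec[where n=n] by (simp add: mult_ac)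

lemma has_field_derivative_hyp2F1:
  assumes c: "c \<notin> \<int>\<^sub>\<le>\<^sub>0" and z: "norm z < 1"
  shows "(hyp2F1 a b c has_field_derivative a * b / c * hyp2F1 (a + 1) (b + 1) (c + 1) z) (at z)"
proof -
  have c1: "c + 1 \<notin> \<int>\<^sub>\<le>\<^sub>0"
    using c plus_one_in_nonpos_Ints_imp by blast
  define r where "r = (1 + norm z) / 2"
  have r: "norm z < r" "r < 1" "r > 0"
    using z by (auto simp: r_def add_pos_nonneg)
  have "summable (\<lambda>n. gauss_coeff a b c n * of_real r ^ n)"
    using r by (intro summable_gauss_power' c) simp
  then have "((\<lambda>z. \<Sum>n. gauss_coeff a b c n * z ^ n) has_field_derivative
      (\<Sum>n. diffs (gauss_coeff a b c) n * z ^ n)) (at z)"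
    by (rule termdiffs_strong) (use r in simp)
  also have "(\<Sum>n. diffs (gauss_coeff a b c) n * z ^ n) =
      a * b / c * (\<Sum>n. gauss_coeff (a + 1) (b + 1) (c + 1) n * z ^ n)"
    using suminf_mult[OF summable_gauss_power'[OF c1 z], of "a * b / c" "a + 1" "b + 1"]
    by (simp add: diffs_gauss_coeff[OF c] mult.assoc)
  finally show ?thesis
    unfolding hyp2F1_def[abs_def] .
qed

lemma norm_hyp2F1_le:
  assumes "c \<notin> \<int>\<^sub>\<le>\<^sub>0" "Re (c - a - b) > 0" "norm z \<le> 1"
  shows "norm (hyp2F1 a b c z) \<le> (\<Sum>n. norm (gauss_coeff a b c n))"
proof -
  have le: "norm (gauss_coeff a b c n * z ^ n) \<le> norm (gauss_coeff a b c n)" for n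
    using assms(3) by (simp add: norm_mult norm_power mult_left_le power_le_one)
  have sm: "summable (\<lambda>n. norm (gauss_coeff a b c n))"
    by (rule summable_norm_gauss_coeff) fact+
  have sm': "summable (\<lambda>n. norm (gauss_coeff a b c n * z ^ n))"
    by (rule summable_comparison_test'[OF sm, of 0]) (use le in auto)
  show ?thesis
    unfolding hyp2F1_def
    by (rule order_trans[OF summable_norm[OF sm'] suminf_le[OF le sm' sm]])
qed

text \<open>Beta x (y+n) is Beta x y times (y)_n / (x+y)_n, and the growth of the two Pochhammer
  symbols leaves n^(-x).\<close>

lemma Beta_shift_bound:
  fixes x y :: real
  assumes "x > 0" "y > 0"
  shows "\<exists>K>0. \<forall>n\<ge>2. Beta x (y + real n) \<le> K * real n powr (- x)"
proof -
  obtain A where A: "A > 0" "\<And>n. n \<ge> 2 \<Longrightarrow> norm (pochhammer (complex_of_real y) n) \<le> A * (fact n * real n powr (y - 1))"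
    using pochhammer_norm_upper[of "of_real y"] by auto
  have "complex_of_real (x + y) \<notin> \<int>\<^sub>\<le>\<^sub>0"
    using assms by (intro Re_pos_not_nonpos_Int) simp
  then obtain B where B: "B > 0" "\<And>n. n \<ge> 2 \<Longrightarrow> fact n * real n powr (x + y - 1) \<le> B * norm (pochhammer (complex_of_real (x + y)) n)"
    using pochhammer_norm_lower[of "of_real (x + y)"] by auto
  have "Beta x (y + real n) \<le> (Beta x y * A * B) * real n powr (- x)" if n: "n \<ge> 2" for n
  proof -
    have nn: "y \<notin> \<int>\<^sub>\<le>\<^sub>0" "x + y \<notin> \<int>\<^sub>\<le>\<^sub>0"
      using assms by (auto elim!: nonpos_Ints_cases)
    have G: "Gamma (y + real n) = pochhammer y n * Gamma y"
      "Gamma (x + y + real n) = pochhammer (x + y) n * Gamma (x + y)"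
      using pochhammer_Gamma[OF nn(1), of n] pochhammer_Gamma[OF nn(2), of n] assms
      by (auto simp: Gamma_eq_zero_iff nn)
    have pos: "pochhammer y n > 0" "pochhammer (x + y) n > 0"
      using assms by (auto intro: pochhammer_pos)
    have P: "pochhammer y n \<le> A * (fact n * real n powr (y - 1))"
      using A(2)[OF n] pos unfolding pochhammer_of_real norm_of_real by simp
    have Q: "fact n * real n powr (x + y - 1) \<le> B * pochhammer (x + y) n"
      using B(2)[OF n] pos unfolding pochhammer_of_real norm_of_real by simp
    have "1 / pochhammer (x + y) n \<le> B / (fact n * real n powr (x + y - 1))"
      using Q pos n by (simp add: field_simps)
    then have "pochhammer y n * (1 / pochhammer (x + y) n) \<le>
        A * (fact n * real n powr (y - 1)) * (B / (fact n * real n powr (x + y - 1)))"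
      using P pos A(1) by (intro mult_mono) auto
    also have "\<dots> = A * B * (real n powr (y - 1) / real n powr (x + y - 1))"
      by simp
    also have "real n powr (y - 1) / real n powr (x + y - 1) = real n powr (- x)"
      by (simp flip: powr_diff)
    finally have "Beta x y * (pochhammer y n * (1 / pochhammer (x + y) n)) \<le>
        Beta x y * (A * B * real n powr (- x))"
      using assms by (intro mult_left_mono) (auto simp: Beta_def intro!: divide_nonneg_nonneg mult_nonneg_nonneg Gamma_real_nonneg)
    also have "Beta x y * (pochhammer y n * (1 / pochhammer (x + y) n)) = Beta x (y + real n)"
      using G by (simp add: Beta_def add.assoc mult_ac)
    finally show ?thesis by (simp add: mult_ac)
  qed
  moreover have "Beta x y * A * B > 0"
    using A(1) B(1) assms by (simp add: Beta_def)
  ultimately show ?thesis by blast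
qed

lemma one_minus_powr_shift:
  assumes "0 < u" "u < (1::real)"
  shows "complex_of_real (1 - u) ^ n * of_real (1 - u) powr (s - 1) = of_real (1 - u) powr (s + of_nat n - 1)"
proof -
  have "s + of_nat n - 1 = of_nat n + (s - 1)" by simp
  then show ?thesis using assms
    by (simp only: powr_add) (simp add: powr_nat')
qed

text \<open>Since the exponent s - 1 matches the lower parameter s, the Beta integral of the n-th
  term contributes (s)_n / (c+s)_n. This replaces the lower parameter by c + s, and Gauss's theorem
  sums the result.\<close>

theorem Mellin_hyp2F1:
  assumes s: "Re s > 0" and c: "Re c > 0" and re: "Re (c + s - A - B) > 0"
  shows "integrable unit_measure
      (\<lambda>u. of_real u powr (c - 1) * of_real (1 - u) powr (s - 1) * hyp2F1 A B s (of_real (1 - u)))" (is ?int)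
    and "(\<integral>u. of_real u powr (c - 1) * of_real (1 - u) powr (s - 1) * hyp2F1 A B s (of_real (1 - u)) \<partial>unit_measure) =
      Gamma c * Gamma s * Gamma (c + s - A - B) * rGamma (c + s - A) * rGamma (c + s - B)" (is ?val)
proof -
  have sn: "s \<notin> \<int>\<^sub>\<le>\<^sub>0" and csn: "c + s \<notin> \<int>\<^sub>\<le>\<^sub>0"
    using s c by (auto intro!: Re_pos_not_nonpos_Int)
  define f where "f = (\<lambda>n u. gauss_coeff A B s n * of_real (1 - u) ^ n *
      (of_real u powr (c - 1) * of_real (1 - u) powr (s - 1)))"
  have f_eq: "f n u = gauss_coeff A B s n * (of_real u powr (c - 1) * of_real (1 - u) powr (s + of_nat n - 1))"
    if "0 < u" "u < 1" for n u
    using one_minus_powr_shift[OF that, of n s] by (simp add: f_def mult_ac)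
  have int: "integrable unit_measure (f n)" for n
    by (subst Bochner_Integration.integrable_cong[OF refl f_eq])
      (use s c in \<open>auto intro!: integrable_mult_right integrable_complex_Beta simp del: of_real_diff\<close>)
  have fint: "(\<integral>u. f n u \<partial>unit_measure) = Gamma c * Gamma s * rGamma (c + s) * gauss_coeff A B (c + s) n" for n
  proof -
    have "(\<integral>u. f n u \<partial>unit_measure) =
      (\<integral>u. gauss_coeff A B s n * (of_real u powr (c - 1) * of_real (1 - u) powr (s + of_nat n - 1)) \<partial>unit_measure)"
      by (rule Bochner_Integration.integral_cong) (use f_eq in auto)
    also have "\<dots> = gauss_coeff A B s n * (Gamma c * Gamma (s + of_nat n) * rGamma (c + (s + of_nat n)))"
      using unit_integral_complex_Beta[of c "s + of_nat n"] s c by simp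
    also have "Gamma (s + of_nat n) = pochhammer s n * Gamma s"
      using pochhammer_Gamma[OF sn, of n] sn by (simp add: Gamma_eq_zero_iff)
    also have "rGamma (c + (s + of_nat n)) = rGamma (c + s) / pochhammer (c + s) n"
      using pochhammer_rGamma[of "c + s" n] pochhammer_neq_0_if_not_nonpos_Int[OF csn, of n]
      by (simp add: add.assoc)
    also have "gauss_coeff A B s n * (Gamma c * (pochhammer s n * Gamma s) * (rGamma (c + s) / pochhammer (c + s) n)) =
        Gamma c * Gamma s * rGamma (c + s) * gauss_coeff A B (c + s) n"
      using pochhammer_neq_0_if_not_nonpos_Int[OF sn, of n]
      by (simp add: gauss_coeff_def)
    finally show ?thesis .
  qed
  have nint: "(\<integral>u. norm (f n u) \<partial>unit_measure) = norm (gauss_coeff A B s n) * Beta (Re c) (Re s + real n)" for n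
  proof -
    have "(\<integral>u. norm (f n u) \<partial>unit_measure) =
      (\<integral>u. norm (gauss_coeff A B s n) * (u powr (Re c - 1) * (1 - u) powr (Re s + real n - 1)) \<partial>unit_measure)"
      by (rule Bochner_Integration.integral_cong)
        (auto simp: f_eq norm_mult norm_of_real_powr norm_one_minus_powr)
    also have "\<dots> = norm (gauss_coeff A B s n) * Beta (Re c) (Re s + real n)"
      using unit_integral_real_Beta(2)[of "Re c" "Re s + real n"] s c by simp
    finally show ?thesis .
  qed
  \<comment> \<open>Coefficients of size n^(Re(A+B-s)-1) meet Beta values of size n^(-Re c), so
    \<open>re\<close> is just what convergence needs; the Gauss function itself may be unbounded as
    u tends to 0.\<close>
  have summ: "summable (\<lambda>n. \<integral>u. norm (f n u) \<partial>unit_measure)"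
  proof -
    obtain K where K: "K > 0" "\<And>n. n \<ge> 2 \<Longrightarrow> norm (gauss_coeff A B s n) \<le> K * real n powr (Re (A + B - s) - 1)"
      using gauss_coeff_bound[OF sn] by blast
    obtain K' where K': "K' > 0" "\<And>n. n \<ge> 2 \<Longrightarrow> Beta (Re c) (Re s + real n) \<le> K' * real n powr (- Re c)"
      using Beta_shift_bound[of "Re c" "Re s"] s c by auto
    have "summable (\<lambda>n. K * K' * real n powr (Re (A + B - s) - 1 - Re c))"
      using re by (intro summable_mult) (simp add: summable_real_powr_iff)
    then show ?thesis
    proof (rule summable_comparison_test'[where N=2])
      fix n :: nat assume n: "n \<ge> 2"
      have B0: "Beta (Re c) (Re s + real n) \<ge> 0"
        using s c by (auto simp: Beta_def intro!: divide_nonneg_nonneg mult_nonneg_nonneg Gamma_real_nonneg)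
      then have "norm (gauss_coeff A B s n) * Beta (Re c) (Re s + real n) \<le>
          (K * real n powr (Re (A + B - s) - 1)) * (K' * real n powr (- Re c))"
        using K K' n by (intro mult_mono) auto
      also have "\<dots> = K * K' * (real n powr (Re (A + B - s) - 1) * real n powr (- Re c))"
        by (simp add: mult_ac)
      also have "\<dots> = K * K' * real n powr (Re (A + B - s) - 1 - Re c)"
        by (simp flip: powr_add)
      finally show "norm (\<integral>u. norm (f n u) \<partial>unit_measure) \<le> K * K' * real n powr (Re (A + B - s) - 1 - Re c)"
        unfolding nint using B0 by simp
    qed
  qed
  have pt: "summable (\<lambda>n. norm (f n u))" if "0 < u" "u < 1" for u
    unfolding f_def norm_mult[of _ "_ powr _ * _"]
    using that norm_of_real[of "1 - u", where 'a=complex]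
    by (intro summable_mult2 summable_gauss_power sn) simp
  have sum_eq: "(\<Sum>n. f n u) = of_real u powr (c - 1) * of_real (1 - u) powr (s - 1) * hyp2F1 A B s (of_real (1 - u))"
    if "0 < u" "u < 1" for u
    unfolding f_def hyp2F1_def
    using that norm_of_real[of "1 - u", where 'a=complex]
    by (subst suminf_mult2[symmetric]) (auto intro!: summable_gauss_power' sn)
  have "integrable unit_measure (\<lambda>u. \<Sum>n. f n u)"
    by (rule unit_integral_sums(1)[OF int pt summ])
  then show ?int
    by (subst Bochner_Integration.integrable_cong[OF refl sum_eq[symmetric]]) auto
  have "(\<lambda>n. \<integral>u. f n u \<partial>unit_measure) sums (\<integral>u. (\<Sum>n. f n u) \<partial>unit_measure)"
    by (rule unit_integral_sums(2)[OF int pt summ])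
  also have "(\<integral>u. (\<Sum>n. f n u) \<partial>unit_measure) =
     (\<integral>u. of_real u powr (c - 1) * of_real (1 - u) powr (s - 1) * hyp2F1 A B s (of_real (1 - u)) \<partial>unit_measure)"
    by (rule Bochner_Integration.integral_cong) (use sum_eq in auto)
  finally have "(\<lambda>n. Gamma c * Gamma s * rGamma (c + s) * gauss_coeff A B (c + s) n) sums \<dots>"
    unfolding fint .
  moreover have "(\<lambda>n. Gamma c * Gamma s * rGamma (c + s) * gauss_coeff A B (c + s) n) sums
     (Gamma c * Gamma s * rGamma (c + s) * (Gamma (c + s) * Gamma (c + s - A - B) * rGamma (c + s - A) * rGamma (c + s - B)))"
  proof (rule sums_mult)
    have "summable (gauss_coeff A B (c + s))"
      using re by (intro summable_norm_cancel[OF summable_norm_gauss_coeff] csn)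
    then show "gauss_coeff A B (c + s) sums (Gamma (c + s) * Gamma (c + s - A - B) * rGamma (c + s - A) * rGamma (c + s - B))"
      using Gauss_sum[of "c + s" A B] s c re by (simp add: sums_iff)
  qed
  ultimately have "(\<integral>u. of_real u powr (c - 1) * of_real (1 - u) powr (s - 1) * hyp2F1 A B s (of_real (1 - u)) \<partial>unit_measure) =
     (Gamma c * Gamma s * rGamma (c + s) * (Gamma (c + s) * Gamma (c + s - A - B) * rGamma (c + s - A) * rGamma (c + s - B)))"
    by (rule sums_unique2)
  moreover have "rGamma (c + s) * Gamma (c + s) = 1"
    using csn by (simp add: rGamma_inverse_Gamma Gamma_eq_zero_iff)
  ultimately show ?val by simp
qed

text \<open>Evaluating the Mellin transform at c + n supplies the Pochhammer symbols of c, d, f, g,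
  and the coefficients of F(a,b;e;u) supply those of a, b, e. Since s - A - B = d - c, the condition
  on its real part says Re c < Re d; it bounds F(A,B;s;1-u) on the interval, so that Beta integrals
  dominate.\<close>

theorem hyp4F3_integral:
  assumes s: "Re s > 0" "s = 1 + a + b - e" and c: "Re c > 0" and re: "Re (s - A - B) > 0"
    and d: "d = c + s - A - B" and e: "e \<notin> \<int>\<^sub>\<le>\<^sub>0"
    and f: "f = c + s - A" "f \<notin> \<int>\<^sub>\<le>\<^sub>0" and g: "g = c + s - B" "g \<notin> \<int>\<^sub>\<le>\<^sub>0"
  shows "integrable unit_measure
      (\<lambda>u. of_real u powr (c - 1) * of_real (1 - u) powr (s - 1) * hyp2F1 A B s (of_real (1 - u)) *
        hyp2F1 a b e (of_real u))" (is ?int)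
    and "(\<integral>u. of_real u powr (c - 1) * of_real (1 - u) powr (s - 1) * hyp2F1 A B s (of_real (1 - u)) *
        hyp2F1 a b e (of_real u) \<partial>unit_measure) =
      Gamma c * Gamma d * Gamma s * rGamma f * rGamma g * hyp4F3 a b c d e f g" (is ?val)
proof -
  have sn: "s \<notin> \<int>\<^sub>\<le>\<^sub>0" and cn: "c \<notin> \<int>\<^sub>\<le>\<^sub>0" and dn: "d \<notin> \<int>\<^sub>\<le>\<^sub>0"
    using s(1) c re by (auto intro!: Re_pos_not_nonpos_Int simp: d)
  define M where "M = (\<Sum>n. norm (gauss_coeff A B s n))"
  have M: "norm (hyp2F1 A B s (of_real (1 - u))) \<le> M" if "0 < u" "u < 1" for u
    unfolding M_def using that norm_of_real[of "1 - u", where 'a=complex]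
    by (intro norm_hyp2F1_le sn re) simp
  define \<Phi> where "\<Phi> = (\<lambda>u. hyp2F1 A B s (of_real (1 - u)))"
  define h where "h = (\<lambda>n u. gauss_coeff a b e n * of_real u ^ n *
      (of_real u powr (c - 1) * of_real (1 - u) powr (s - 1) * \<Phi> u))"
  have h_eq: "h n u = gauss_coeff a b e n * (of_real u powr (c + of_nat n - 1) * of_real (1 - u) powr (s - 1) * \<Phi> u)"
    if "0 < u" "u < 1" for n u
    using one_minus_powr_shift[of "1 - u" n c] that by (simp add: h_def mult_ac)
  have int: "integrable unit_measure (h n)" for n
  proof -
    have "integrable unit_measure (\<lambda>u. of_real u powr (c + of_nat n - 1) * of_real (1 - u) powr (s - 1) * \<Phi> u)"
      unfolding \<Phi>_def by (rule Mellin_hyp2F1) (use s(1) c re in auto)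
    from integrable_mult_right[OF this, of "gauss_coeff a b e n"] show ?thesis
      by (subst Bochner_Integration.integrable_cong[OF refl h_eq]) auto
  qed
  have hint: "(\<integral>u. h n u \<partial>unit_measure) = Gamma c * Gamma d * Gamma s * rGamma f * rGamma g *
     ((pochhammer a n * pochhammer b n * pochhammer c n * pochhammer d n) /
          (fact n * pochhammer e n * pochhammer f n * pochhammer g n))" for n
  proof -
    have "(\<integral>u. h n u \<partial>unit_measure) =
      (\<integral>u. gauss_coeff a b e n * (of_real u powr (c + of_nat n - 1) * of_real (1 - u) powr (s - 1) * \<Phi> u) \<partial>unit_measure)"
      by (rule Bochner_Integration.integral_cong) (use h_eq in auto)
    also have "\<dots> = gauss_coeff a b e n * (Gamma (c + of_nat n) * Gamma s * Gamma (d + of_nat n) *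
        rGamma (f + of_nat n) * rGamma (g + of_nat n))"
    proof -
      have "c + of_nat n + s - A - B = d + of_nat n" "c + of_nat n + s - A = f + of_nat n"
        "c + of_nat n + s - B = g + of_nat n"
        by (simp_all add: d f g)
      moreover have "Re (c + of_nat n) > 0" "Re (c + of_nat n + s - A - B) > 0"
        using c re by simp_all
      ultimately show ?thesis
        using Mellin_hyp2F1(2)[OF s(1), of "c + of_nat n" A B]
        unfolding \<Phi>_def by (simp only: integral_mult_right_zero)
    qed
    also have "Gamma (c + of_nat n) = pochhammer c n * Gamma c"
      using pochhammer_Gamma[OF cn, of n] cn by (simp add: Gamma_eq_zero_iff)
    also have "Gamma (d + of_nat n) = pochhammer d n * Gamma d"
      using pochhammer_Gamma[OF dn, of n] dn by (simp add: Gamma_eq_zero_iff)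
    also have "rGamma (f + of_nat n) = rGamma f / pochhammer f n"
      using pochhammer_rGamma[of f n] pochhammer_neq_0_if_not_nonpos_Int[OF f(2), of n] by simp
    also have "rGamma (g + of_nat n) = rGamma g / pochhammer g n"
      using pochhammer_rGamma[of g n] pochhammer_neq_0_if_not_nonpos_Int[OF g(2), of n] by simp
    finally show ?thesis by (simp add: gauss_coeff_def mult_ac)
  qed
  have nint: "(\<integral>u. norm (h n u) \<partial>unit_measure) \<le> norm (gauss_coeff a b e n) * M * Beta (Re s) (Re c + real n)" for n
  proof -
    have intB: "integrable unit_measure (\<lambda>u. u powr (Re c + real n - 1) * (1 - u) powr (Re s - 1))"
      by (rule unit_integral_real_Beta) (use s c in auto)
    have "(\<integral>u. norm (h n u) \<partial>unit_measure) \<le>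
      (\<integral>u. norm (gauss_coeff a b e n) * M * (u powr (Re c + real n - 1) * (1 - u) powr (Re s - 1)) \<partial>unit_measure)"
    proof (rule integral_mono)
      fix u assume "u \<in> space unit_measure"
      then have u: "0 < u" "u < 1" by auto
      have "norm (h n u) = norm (gauss_coeff a b e n) * (u powr (Re c + real n - 1) * (1 - u) powr (Re s - 1)) * norm (\<Phi> u)"
        using u by (simp add: h_eq norm_mult norm_of_real_powr norm_one_minus_powr)
      also have "\<dots> \<le> norm (gauss_coeff a b e n) * (u powr (Re c + real n - 1) * (1 - u) powr (Re s - 1)) * M"
        using M[OF u] unfolding \<Phi>_def by (intro mult_left_mono) auto
      finally show "norm (h n u) \<le> norm (gauss_coeff a b e n) * M * (u powr (Re c + real n - 1) * (1 - u) powr (Re s - 1))"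
        by (simp add: mult_ac)
    qed (use int intB in auto)
    also have "\<dots> = norm (gauss_coeff a b e n) * M * Beta (Re s) (Re c + real n)"
      using unit_integral_real_Beta(2)[of "Re c + real n" "Re s"] s(1) c
      by (simp add: Beta_commute[of "Re s" "Re c + real n"])
    finally show ?thesis .
  qed
  have summ: "summable (\<lambda>n. \<integral>u. norm (h n u) \<partial>unit_measure)"
  proof -
    obtain K where K: "K > 0" "\<And>n. n \<ge> 2 \<Longrightarrow> norm (gauss_coeff a b e n) \<le> K * real n powr (Re (a + b - e) - 1)"
      using gauss_coeff_bound[OF e] by blast
    obtain K' where K': "K' > 0" "\<And>n. n \<ge> 2 \<Longrightarrow> Beta (Re s) (Re c + real n) \<le> K' * real n powr (- Re s)"
      using Beta_shift_bound[of "Re s" "Re c"] s c by auto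
    have M0: "M \<ge> 0"
      unfolding M_def by (intro suminf_nonneg summable_norm_gauss_coeff sn re) auto
    \<comment> \<open>The exponent is -2 because s = 1 + a + b - e, which for the given d, f, g is
      the Saalschuetz condition.\<close>
    have "summable (\<lambda>n. K * M * K' * real n powr (Re (a + b - e) - 1 - Re s))"
      using s(2) by (intro summable_mult) (simp add: summable_real_powr_iff)
    then show ?thesis
    proof (rule summable_comparison_test'[where N=2])
      fix n :: nat assume n: "n \<ge> 2"
      have B0: "Beta (Re s) (Re c + real n) \<ge> 0"
        using s c by (auto simp: Beta_def intro!: divide_nonneg_nonneg mult_nonneg_nonneg Gamma_real_nonneg)
      have "norm (\<integral>u. norm (h n u) \<partial>unit_measure) = (\<integral>u. norm (h n u) \<partial>unit_measure)"
        by (simp add: integral_nonneg_AE)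
      also have "\<dots> \<le> norm (gauss_coeff a b e n) * M * Beta (Re s) (Re c + real n)"
        by (rule nint)
      also have "\<dots> \<le> (K * real n powr (Re (a + b - e) - 1)) * M * (K' * real n powr (- Re s))"
        using K K' n B0 M0 by (intro mult_mono) auto
      also have "\<dots> = K * M * K' * (real n powr (Re (a + b - e) - 1) * real n powr (- Re s))"
        by (simp add: mult_ac)
      also have "\<dots> = K * M * K' * real n powr (Re (a + b - e) - 1 - Re s)"
        by (simp flip: powr_add)
      finally show "norm (\<integral>u. norm (h n u) \<partial>unit_measure) \<le> \<dots>" .
    qed
  qed
  have pt: "summable (\<lambda>n. norm (h n u))" if "0 < u" "u < 1" for u
    unfolding h_def norm_mult[of _ "_ powr _ * _ powr _ * _"]
    using that by (intro summable_mult2 summable_gauss_power e) simp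
  have sum_eq: "(\<Sum>n. h n u) = of_real u powr (c - 1) * of_real (1 - u) powr (s - 1) * hyp2F1 A B s (of_real (1 - u)) *
        hyp2F1 a b e (of_real u)"
    if "0 < u" "u < 1" for u
  proof -
    have "(\<Sum>n. h n u) = hyp2F1 a b e (of_real u) * (of_real u powr (c - 1) * of_real (1 - u) powr (s - 1) * \<Phi> u)"
      unfolding h_def hyp2F1_def
      using that by (intro suminf_mult2[symmetric] summable_gauss_power' e) simp
    then show ?thesis by (simp add: \<Phi>_def mult_ac)
  qed
  have "integrable unit_measure (\<lambda>u. \<Sum>n. h n u)"
    by (rule unit_integral_sums(1)[OF int pt summ])
  then show ?int
    by (subst Bochner_Integration.integrable_cong[OF refl sum_eq[symmetric]]) auto
  have "(\<lambda>n. \<integral>u. h n u \<partial>unit_measure) sums (\<integral>u. (\<Sum>n. h n u) \<partial>unit_measure)"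
    by (rule unit_integral_sums(2)[OF int pt summ])
  also have "(\<integral>u. (\<Sum>n. h n u) \<partial>unit_measure) =
     (\<integral>u. of_real u powr (c - 1) * of_real (1 - u) powr (s - 1) * hyp2F1 A B s (of_real (1 - u)) *
        hyp2F1 a b e (of_real u) \<partial>unit_measure)"
    by (rule Bochner_Integration.integral_cong) (use sum_eq in auto)
  finally have sums: "(\<lambda>n. Gamma c * Gamma d * Gamma s * rGamma f * rGamma g *
     ((pochhammer a n * pochhammer b n * pochhammer c n * pochhammer d n) /
          (fact n * pochhammer e n * pochhammer f n * pochhammer g n))) sums \<dots>"
    unfolding hint .
  \<comment> \<open>The constant factor must be nonzero so that summability of the 4F3 series itself
    can be read off from \<open>sums\<close>.\<close>
  have nz: "Gamma c * Gamma d * Gamma s * rGamma f * rGamma g \<noteq> 0"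
    using sn cn dn f(2) g(2) by (simp add: Gamma_eq_zero_iff rGamma_eq_zero_iff)
  then have "summable (\<lambda>n. (pochhammer a n * pochhammer b n * pochhammer c n * pochhammer d n) /
          (fact n * pochhammer e n * pochhammer f n * pochhammer g n))"
    using sums_summable[OF sums] by (simp only: summable_cmult_iff) auto
  from sums_unique2[OF sums sums_mult[OF summable_sums[OF this]]] show ?val
    by (simp add: hyp4F3_def)
qed

section \<open>The hypergeometric equation and the connection formula\<close>

text \<open>The Euler operator theta = z d/dz acts on coefficients as multiplication by n.\<close>

lemma sums_diffs_mult:
  fixes t :: "nat \<Rightarrow> complex"
  assumes "(\<lambda>n. diffs t n * z ^ n) sums D"
  shows "(\<lambda>n. of_nat n * t n * z ^ n) sums (z * D)"
proof -
  have "(\<lambda>n. z * (diffs t n * z ^ n)) sums (z * D)"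
    by (intro sums_mult assms)
  also have "(\<lambda>n. z * (diffs t n * z ^ n)) = (\<lambda>n. of_nat (Suc n) * t (Suc n) * z ^ Suc n)"
    by (simp add: diffs_def fun_eq_iff del: of_nat_Suc)
  finally show ?thesis by (subst (asm) sums_Suc_iff) simp
qed

definition hyp2F1_deriv :: "complex \<Rightarrow> complex \<Rightarrow> complex \<Rightarrow> complex \<Rightarrow> complex" where
  "hyp2F1_deriv a b c z = a * b / c * hyp2F1 (a + 1) (b + 1) (c + 1) z"

definition hyp2F1_deriv2 :: "complex \<Rightarrow> complex \<Rightarrow> complex \<Rightarrow> complex \<Rightarrow> complex" where
  "hyp2F1_deriv2 a b c z = a * b / c * hyp2F1_deriv (a + 1) (b + 1) (c + 1) z"

lemma DERIV_hyp2F1: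
  assumes "c \<notin> \<int>\<^sub>\<le>\<^sub>0" "norm z < 1"
  shows "(hyp2F1 a b c has_field_derivative hyp2F1_deriv a b c z) (at z)"
    and "(hyp2F1_deriv a b c has_field_derivative hyp2F1_deriv2 a b c z) (at z)"
proof -
  have c1: "c + 1 \<notin> \<int>\<^sub>\<le>\<^sub>0"
    using assms(1) plus_one_in_nonpos_Ints_imp by blast
  show "(hyp2F1 a b c has_field_derivative hyp2F1_deriv a b c z) (at z)"
    unfolding hyp2F1_deriv_def by (rule has_field_derivative_hyp2F1) fact+
  show "(hyp2F1_deriv a b c has_field_derivative hyp2F1_deriv2 a b c z) (at z)"
    unfolding hyp2F1_deriv_def[abs_def] hyp2F1_deriv2_def
    by (intro DERIV_cmult has_field_derivative_hyp2F1 c1 assms)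
qed

text \<open>With theta = z d/dz the equation reads (theta + c) y' = (theta + a)(theta + b) y, which
  on coefficients is \<open>gauss_coeff_Suc\<close>.\<close>

lemma hyp2F1_ODE:
  assumes c: "c \<notin> \<int>\<^sub>\<le>\<^sub>0" and z: "norm z < 1"
  shows "z * (1 - z) * hyp2F1_deriv2 a b c z + (c - (a + b + 1) * z) * hyp2F1_deriv a b c z =
    a * b * hyp2F1 a b c z"
proof -
  define t where "t = gauss_coeff a b c"
  have c1: "c + 1 \<notin> \<int>\<^sub>\<le>\<^sub>0" and c2: "c + 1 + 1 \<notin> \<int>\<^sub>\<le>\<^sub>0"
    using c plus_one_in_nonpos_Ints_imp by blast+
  have t0: "(\<lambda>n. t n * z ^ n) sums hyp2F1 a b c z"
    unfolding t_def hyp2F1_def by (intro summable_sums summable_gauss_power' c z)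
  have t1: "(\<lambda>n. diffs t n * z ^ n) sums hyp2F1_deriv a b c z"
    unfolding t_def diffs_gauss_coeff[OF c] hyp2F1_deriv_def hyp2F1_def mult.assoc[of "_ / _"]
    by (intro sums_mult summable_sums summable_gauss_power' c1 z)
  have t2: "(\<lambda>n. diffs (diffs t) n * z ^ n) sums hyp2F1_deriv2 a b c z"
  proof -
    have "diffs (diffs t) n = a * b / c * ((a + 1) * (b + 1) / (c + 1) *
        gauss_coeff (a + 1 + 1) (b + 1 + 1) (c + 1 + 1) n)" for n
      using diffs_gauss_coeff[OF c1, of "a + 1" "b + 1" n]
      unfolding t_def diffs_def[of "diffs _"] diffs_gauss_coeff[OF c]
      by (simp add: diffs_def mult_ac)
    then show ?thesis
      unfolding hyp2F1_deriv2_def hyp2F1_deriv_def hyp2F1_def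
      by (simp only: mult.assoc) (intro sums_mult summable_sums summable_gauss_power' c2 z)
  qed
  have L: "(\<lambda>n. of_nat n * diffs t n * z ^ n + c * (diffs t n * z ^ n)) sums
      (z * hyp2F1_deriv2 a b c z + c * hyp2F1_deriv a b c z)"
    by (intro sums_add sums_mult sums_diffs_mult t1 t2)
  \<comment> \<open>Since (n+a)(n+b) = n (n+a+b) + ab, one Euler operator applied to the series with
    coefficients (n+a+b) t_n yields the right-hand side.\<close>
  have "diffs (\<lambda>n. (of_nat n + a + b) * t n) n = of_nat n * diffs t n + (a + b + 1) * diffs t n" for n
    by (simp add: diffs_def algebra_simps)
  then have "(\<lambda>n. diffs (\<lambda>n. (of_nat n + a + b) * t n) n * z ^ n) sums
      (z * hyp2F1_deriv2 a b c z + (a + b + 1) * hyp2F1_deriv a b c z)"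
    using sums_add[OF sums_diffs_mult[OF t2] sums_mult[OF t1, of "a + b + 1"]]
    by (simp add: algebra_simps)
  from sums_add[OF sums_diffs_mult[OF this] sums_mult[OF t0, of "a * b"]]
  have R: "(\<lambda>n. of_nat n * ((of_nat n + a + b) * t n) * z ^ n + a * b * (t n * z ^ n)) sums
      (z * (z * hyp2F1_deriv2 a b c z + (a + b + 1) * hyp2F1_deriv a b c z) + a * b * hyp2F1 a b c z)" .
  have "of_nat n * diffs t n * z ^ n + c * (diffs t n * z ^ n) =
      of_nat n * ((of_nat n + a + b) * t n) * z ^ n + a * b * (t n * z ^ n)" for n
  proof -
    have "(of_nat n + c) * diffs t n = (a + of_nat n) * (b + of_nat n) * t n"
      using gauss_coeff_Suc[OF c, of n a b] by (simp add: t_def diffs_def mult_ac add_ac)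
    then have "(of_nat n + c) * diffs t n * z ^ n = (a + of_nat n) * (b + of_nat n) * t n * z ^ n"
      by simp
    then show ?thesis by (simp add: algebra_simps)
  qed
  with L R have "z * hyp2F1_deriv2 a b c z + c * hyp2F1_deriv a b c z =
      z * (z * hyp2F1_deriv2 a b c z + (a + b + 1) * hyp2F1_deriv a b c z) + a * b * hyp2F1 a b c z"
    by (simp add: sums_iff)
  then show ?thesis by (simp add: algebra_simps)
qed

text \<open>The series at 0 and those at 1 converge here together. The set is convex and avoids the
  branch cuts of the principal powers of z and of 1 - z.\<close>

definition lens :: "complex set" where
  "lens = ball 0 1 \<inter> ball 1 1"

lemma convex_lens: "convex lens"
  by (auto simp: lens_def convex_Int)

lemma lensD:
  assumes "z \<in> lens"
  shows "norm z < 1" "norm (1 - z) < 1" "Re z > 0" "Re (1 - z) > 0" "z \<noteq> 0" "1 - z \<noteq> 0"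
proof -
  show 1: "norm z < 1" and 2: "norm (1 - z) < 1"
    using assms by (auto simp: lens_def dist_norm norm_minus_commute)
  show 3: "Re z > 0" using 2 complex_Re_le_cmod[of "1 - z"] by simp
  show 4: "Re (1 - z) > 0" using 1 complex_Re_le_cmod[of z] by simp
  show "z \<noteq> 0" "1 - z \<noteq> 0" using 3 4 by auto
qed

lemma of_real_in_lens: "0 < u \<Longrightarrow> u < 1 \<Longrightarrow> of_real u \<in> lens"
  using norm_of_real[of "1 - u", where 'a=complex] norm_of_real[of "u", where 'a=complex]
  by (simp add: lens_def dist_norm)

text \<open>The first derivative is a parameter because Wronskians are formed from it; the second is
  only needed to state the equation.\<close>

definition hyp_solution ::
  "complex \<Rightarrow> complex \<Rightarrow> complex \<Rightarrow> (complex \<Rightarrow> complex) \<Rightarrow> (complex \<Rightarrow> complex) \<Rightarrow> bool" where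
  "hyp_solution a b c y y' \<longleftrightarrow>
     (\<forall>z\<in>lens. (y has_field_derivative y' z) (at z) \<and>
        (\<exists>y''. (y' has_field_derivative y'') (at z) \<and>
          z * (1 - z) * y'' + (c - (a + b + 1) * z) * y' z = a * b * y z))"

text \<open>Abel's identity: divided by z (1-z), the equation has y'-coefficient c/z -
  (a+b+1-c)/(1-z), and the power factor is the exponential of its primitive.\<close>

lemma Wronskian_constant:
  assumes y: "hyp_solution a b c y y'" and w: "hyp_solution a b c w w'"
  shows "\<exists>k. \<forall>z\<in>lens. z powr c * (1 - z) powr (a + b + 1 - c) * (y z * w' z - y' z * w z) = k"
proof -
  have "((\<lambda>z. z powr c * (1 - z) powr (a + b + 1 - c) * (y z * w' z - y' z * w z))
      has_field_derivative 0) (at z within lens)" if z: "z \<in> lens" for z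
  proof -
    note zD = lensD[OF z]
    obtain y'' where y'': "(y has_field_derivative y' z) (at z)" "(y' has_field_derivative y'') (at z)"
       "z * (1 - z) * y'' + (c - (a + b + 1) * z) * y' z = a * b * y z"
      using y z by (auto simp: hyp_solution_def)
    obtain w'' where w'': "(w has_field_derivative w' z) (at z)" "(w' has_field_derivative w'') (at z)"
       "z * (1 - z) * w'' + (c - (a + b + 1) * z) * w' z = a * b * w z"
      using w z by (auto simp: hyp_solution_def)
    define P where "P = z powr c"
    define Q where "Q = (1 - z) powr (a + b + 1 - c)"
    have nr: "z \<notin> \<real>\<^sub>\<le>\<^sub>0" "1 - z \<notin> \<real>\<^sub>\<le>\<^sub>0"
      using zD(3,4) by (auto simp: complex_nonpos_Reals_iff)
    have dP: "((\<lambda>z. z powr c) has_field_derivative c * P / z) (at z)"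
      using has_field_derivative_powr[OF nr(1), of c] zD by (simp add: P_def powr_diff)
    have dQ: "((\<lambda>z. (1 - z) powr (a + b + 1 - c)) has_field_derivative - ((a + b + 1 - c) * Q / (1 - z))) (at z)"
    proof -
      have d1: "((\<lambda>z. 1 - z) has_field_derivative - 1) (at z)"
        by (auto intro!: derivative_eq_intros)
      have "((\<lambda>z. (1 - z) powr (a + b + 1 - c)) has_field_derivative
          (a + b + 1 - c) * (1 - z) powr (a + b + 1 - c - 1) * - 1) (at z)"
        by (rule DERIV_chain2[OF has_field_derivative_powr[OF nr(2)] d1])
      moreover have "(1 - z) powr (a + b + 1 - c - 1) = Q / (1 - z)"
        using powr_diff[of "1 - z" "a + b + 1 - c" 1] zD(6) by (simp add: Q_def)
      ultimately show ?thesis by (metis mult.commute mult_minus1 times_divide_eq_right)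
    qed
    have "((\<lambda>z. z powr c * (1 - z) powr (a + b + 1 - c) * (y z * w' z - y' z * w z))
      has_field_derivative (c * P / z * Q + - ((a + b + 1 - c) * Q / (1 - z)) * P) * (y z * w' z - y' z * w z)
        + ((y' z * w' z + w'' * y z) - (y'' * w z + w' z * y' z)) * (P * Q)) (at z)"
      unfolding P_def Q_def
      by (intro DERIV_mult DERIV_diff y'' w'' dP[unfolded P_def] dQ[unfolded Q_def])
    also have "(c * P / z * Q + - ((a + b + 1 - c) * Q / (1 - z)) * P) * (y z * w' z - y' z * w z)
        + ((y' z * w' z + w'' * y z) - (y'' * w z + w' z * y' z)) * (P * Q) =
        P * Q / (z * (1 - z)) * ((c * (1 - z) - (a + b + 1 - c) * z) * (y z * w' z - y' z * w z)
         + (z * (1 - z) * w'' * y z - z * (1 - z) * y'' * w z))"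
      using zD(5,6) by (simp add: divide_simps) (simp add: algebra_simps)
    also have "z * (1 - z) * w'' = a * b * w z - (c - (a + b + 1) * z) * w' z"
      using w''(3) by (simp add: algebra_simps)
    also have "z * (1 - z) * y'' = a * b * y z - (c - (a + b + 1) * z) * y' z"
      using y''(3) by (simp add: algebra_simps)
    also have "(c * (1 - z) - (a + b + 1 - c) * z) * (y z * w' z - y' z * w z)
         + ((a * b * w z - (c - (a + b + 1) * z) * w' z) * y z - (a * b * y z - (c - (a + b + 1) * z) * y' z) * w z) = 0"
      by (simp add: algebra_simps)
    finally show ?thesis by (simp add: has_field_derivative_at_within)
  qed
  then show ?thesis
    using has_field_derivative_zero_constant[OF convex_lens] by blast
qed

lemma hyp_solution_at_0:
  assumes "c \<notin> \<int>\<^sub>\<le>\<^sub>0"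
  shows "hyp_solution a b c (hyp2F1 a b c) (hyp2F1_deriv a b c)"
  unfolding hyp_solution_def
  using DERIV_hyp2F1[OF assms] hyp2F1_ODE[OF assms] lensD(1) by blast

text \<open>Under z -> 1 - z the equation keeps its form, with c replaced by 1 + a + b - c.\<close>

lemma hyp_solution_at_1:
  assumes s: "s = 1 + a + b - c" "s \<notin> \<int>\<^sub>\<le>\<^sub>0"
  shows "hyp_solution a b c (\<lambda>z. hyp2F1 a b s (1 - z)) (\<lambda>z. - hyp2F1_deriv a b s (1 - z))"
  unfolding hyp_solution_def
proof (intro ballI conjI exI)
  fix z assume "z \<in> lens"
  note zD = lensD[OF this]
  have d1: "((\<lambda>z. 1 - z) has_field_derivative - 1) (at z)"
    by (auto intro!: derivative_eq_intros)
  show "((\<lambda>z. hyp2F1 a b s (1 - z)) has_field_derivative - hyp2F1_deriv a b s (1 - z)) (at z)"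
    using DERIV_chain'[OF d1 DERIV_hyp2F1(1)[OF s(2) zD(2), of a b]] by simp
  show "((\<lambda>z. - hyp2F1_deriv a b s (1 - z)) has_field_derivative hyp2F1_deriv2 a b s (1 - z)) (at z)"
    using DERIV_minus[OF DERIV_chain'[OF d1 DERIV_hyp2F1(2)[OF s(2) zD(2), of a b]]] by simp
  show "z * (1 - z) * hyp2F1_deriv2 a b s (1 - z) + (c - (a + b + 1) * z) * - hyp2F1_deriv a b s (1 - z) =
      a * b * hyp2F1 a b s (1 - z)"
    using hyp2F1_ODE[OF s(2) zD(2), of a b] by (simp add: s(1) algebra_simps)
qed

text \<open>The Frobenius solution for the second exponent q = 1 - c at 0: removing z^q leaves the
  hypergeometric equation with parameters a + q, b + q, 1 + q.\<close>

lemma hyp_solution_at_0':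
  fixes a b c :: complex
  assumes c: "2 - c \<notin> \<int>\<^sub>\<le>\<^sub>0"
  defines "F \<equiv> hyp2F1 (1 + a - c) (1 + b - c) (2 - c)"
    and "F' \<equiv> hyp2F1_deriv (1 + a - c) (1 + b - c) (2 - c)"
  shows "hyp_solution a b c (\<lambda>z. z powr (1 - c) * F z) (\<lambda>z. z powr (1 - c) * ((1 - c) / z * F z + F' z))"
  unfolding hyp_solution_def
proof (intro ballI conjI exI)
  fix z assume "z \<in> lens"
  note zD = lensD[OF this]
  have nr: "z \<notin> \<real>\<^sub>\<le>\<^sub>0"
    using zD(3) by (auto simp: complex_nonpos_Reals_iff)
  define q where "q = 1 - c"
  define P where "P = z powr q"
  define F'' where "F'' = hyp2F1_deriv2 (1 + a - c) (1 + b - c) (2 - c) z"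
  have dP: "((\<lambda>z. z powr q) has_field_derivative q * P / z) (at z)"
    using has_field_derivative_powr[OF nr, of q] zD by (simp add: P_def powr_diff)
  have dF: "(F has_field_derivative F' z) (at z)" "(F' has_field_derivative F'') (at z)"
    unfolding F_def F'_def F''_def by (intro DERIV_hyp2F1 c zD)+
  have "((\<lambda>z. z powr q * F z) has_field_derivative q * P / z * F z + F' z * P) (at z)"
    unfolding P_def by (intro DERIV_mult dP[unfolded P_def] dF)
  also have "q * P / z * F z + F' z * P = P * (q / z * F z + F' z)"
    by (simp add: algebra_simps)
  finally show "((\<lambda>z. z powr (1 - c) * F z) has_field_derivative
      z powr (1 - c) * ((1 - c) / z * F z + F' z)) (at z)"
    by (simp add: P_def q_def)
  have dq: "((\<lambda>z. q / z) has_field_derivative - (q / z\<^sup>2)) (at z)"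
    using zD(5) by (auto intro!: derivative_eq_intros simp: power2_eq_square)
  have "((\<lambda>z. z powr q * (q / z * F z + F' z)) has_field_derivative
      (q * P / z) * (q / z * F z + F' z) + ((- (q / z\<^sup>2)) * F z + F' z * (q / z) + F'') * P) (at z)"
    unfolding P_def by (intro DERIV_mult DERIV_add dP[unfolded P_def] dF dq)
  then show "((\<lambda>z. z powr (1 - c) * ((1 - c) / z * F z + F' z)) has_field_derivative
      (q * P / z) * (q / z * F z + F' z) + ((- (q / z\<^sup>2)) * F z + F' z * (q / z) + F'') * P) (at z)"
    by (simp add: q_def)
  have "z * (1 - z) * F'' + ((2 - c) - ((1 + a - c) + (1 + b - c) + 1) * z) * F' z =
      (1 + a - c) * (1 + b - c) * F z"
    unfolding F_def F'_def F''_def by (rule hyp2F1_ODE[OF c zD(1)])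
  then have ode: "z * (1 - z) * F'' = (q + a) * (q + b) * F z - (q + 1 - (2 * q + a + b + 1) * z) * F' z"
    by (simp add: q_def algebra_simps)
  have "z * (1 - z) * ((q * P / z) * (q / z * F z + F' z) + ((- (q / z\<^sup>2)) * F z + F' z * (q / z) + F'') * P) =
      P * (((1 - z) * (q * (q - 1)) / z * F z + 2 * q * (1 - z) * F' z) + z * (1 - z) * F'')"
    using zD(5) by (simp add: divide_simps power2_eq_square) (simp add: algebra_simps)
  also have "\<dots> + (1 - q - (a + b + 1) * z) * (P * (q / z * F z + F' z)) = a * b * (P * F z)"
    unfolding ode using zD(5) by (simp add: divide_simps) (simp add: algebra_simps)
  finally show "z * (1 - z) * ((q * P / z) * (q / z * F z + F' z) + ((- (q / z\<^sup>2)) * F z + F' z * (q / z) + F'') * P) +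
      (c - (a + b + 1) * z) * (z powr (1 - c) * ((1 - c) / z * F z + F' z)) = a * b * (z powr (1 - c) * F z)"
    by (simp add: P_def q_def)
qed

section \<open>Boundary values and the connection coefficients\<close>

lemma continuous_on_hyp2F1_cball:
  assumes "c \<notin> \<int>\<^sub>\<le>\<^sub>0" "Re (c - a - b) > 0"
  shows "continuous_on (cball 0 1) (hyp2F1 a b c)"
proof -
  \<comment> \<open>Absolute convergence at 1 majorises the series on the whole closed disc, so the
    value at 1 is a limit by uniform convergence and Abel's theorem can be avoided.\<close>
  have "uniform_limit (cball 0 1) (\<lambda>n z. \<Sum>i<n. gauss_coeff a b c i * z ^ i)
      (\<lambda>z. \<Sum>i. gauss_coeff a b c i * z ^ i) sequentially"
    by (rule Weierstrass_m_test[OF _ summable_norm_gauss_coeff[OF assms]])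
      (simp add: norm_mult norm_power mult_left_le power_le_one)
  then show ?thesis
    unfolding hyp2F1_def[abs_def]
    by (rule uniform_limit_theorem[rotated]) (auto intro!: continuous_intros always_eventually)
qed

lemma hyp2F1_0 [simp]: "hyp2F1 a b c 0 = 1"
  unfolding hyp2F1_def by (simp add: powser_zero)

lemma tendsto_hyp2F1_0:
  assumes "c \<notin> \<int>\<^sub>\<le>\<^sub>0"
  shows "((\<lambda>u. hyp2F1 a b c (of_real u)) \<longlongrightarrow> 1) (at_right (0::real))"
    and "((\<lambda>u. hyp2F1_deriv a b c (of_real u)) \<longlongrightarrow> hyp2F1_deriv a b c 0) (at_right (0::real))"
proof -
  have lim: "((\<lambda>u. complex_of_real u) \<longlongrightarrow> 0) (at_right (0::real))"
    by (rule tendsto_eq_intros refl tendsto_ident_at)+ simp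
  show "((\<lambda>u. hyp2F1 a b c (of_real u)) \<longlongrightarrow> 1) (at_right (0::real))"
    using isCont_tendsto_compose[OF DERIV_isCont[OF DERIV_hyp2F1(1)[OF assms, of 0 a b]] lim] by simp
  show "((\<lambda>u. hyp2F1_deriv a b c (of_real u)) \<longlongrightarrow> hyp2F1_deriv a b c 0) (at_right (0::real))"
    using isCont_tendsto_compose[OF DERIV_isCont[OF DERIV_hyp2F1(2)[OF assms, of 0 a b]] lim] by simp
qed

lemma tendsto_hyp2F1_1:
  assumes "c \<notin> \<int>\<^sub>\<le>\<^sub>0" "Re (c - a - b) > 0"
  shows "((\<lambda>u. hyp2F1 a b c (of_real (1 - u))) \<longlongrightarrow> hyp2F1 a b c 1) (at_right (0::real))"
proof -
  have "continuous_on {0..1} (\<lambda>u::real. hyp2F1 a b c (of_real (1 - u)))"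
  proof (rule continuous_on_compose2[OF continuous_on_hyp2F1_cball[OF assms]])
    show "(\<lambda>u. complex_of_real (1 - u)) ` {0..1} \<subseteq> cball 0 1"
    proof (rule image_subsetI)
      fix x :: real assume "x \<in> {0..1}"
      then have "norm (complex_of_real (1 - x)) \<le> 1" unfolding norm_of_real by simp
      then show "complex_of_real (1 - x) \<in> cball 0 1" by (simp only: mem_cball_0)
    qed
  qed (intro continuous_intros)
  then have "((\<lambda>u. hyp2F1 a b c (of_real (1 - u))) \<longlongrightarrow> hyp2F1 a b c (of_real (1 - 0))) (at 0 within {0..1})"
    unfolding continuous_on_def by (rule bspec) simp
  then show ?thesis by (simp add: at_within_Icc_at_right)
qed

lemma hyp2F1_at_1:
  assumes "Re c > 0" "Re (c - a - b) > 0"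
  shows "hyp2F1 a b c 1 = Gamma c * Gamma (c - a - b) * rGamma (c - a) * rGamma (c - b)"
  unfolding hyp2F1_def using Gauss_sum[OF assms] by simp

lemma eventually_at_right_0_unit: "eventually (\<lambda>u. 0 < u \<and> u < 1) (at_right (0::real))"
  by (rule eventually_at_rightI[of 0 1]) auto

text \<open>Cramer's rule with Wronskians: after multiplication by the weight \<open>p\<close> all
  determinants are constants, so the coefficients exist as soon as the Wronskian of the two
  solutions at 0 is nonzero.\<close>

lemma connection_exists:
  assumes c: "c \<notin> \<int>\<^sub>\<le>\<^sub>0" "2 - c \<notin> \<int>\<^sub>\<le>\<^sub>0" "c \<noteq> 1" and s: "s = 1 + a + b - c" "s \<notin> \<int>\<^sub>\<le>\<^sub>0"
  shows "\<exists>\<alpha> \<beta>. \<forall>z\<in>lens. hyp2F1 a b s (1 - z) = \<alpha> * hyp2F1 a b c z +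
     \<beta> * (z powr (1 - c) * hyp2F1 (1 + a - c) (1 + b - c) (2 - c) z)"
proof -
  define y1 where "y1 = hyp2F1 a b c"
  define y1' where "y1' = hyp2F1_deriv a b c"
  define F where "F = hyp2F1 (1 + a - c) (1 + b - c) (2 - c)"
  define F' where "F' = hyp2F1_deriv (1 + a - c) (1 + b - c) (2 - c)"
  define y2 where "y2 = (\<lambda>z. z powr (1 - c) * F z)"
  define y2' where "y2' = (\<lambda>z. z powr (1 - c) * ((1 - c) / z * F z + F' z))"
  define G where "G = (\<lambda>z. hyp2F1 a b s (1 - z))"
  define G' where "G' = (\<lambda>z. - hyp2F1_deriv a b s (1 - z))"
  define p where "p = (\<lambda>z. z powr c * (1 - z) powr (a + b + 1 - c))"
  have sol1: "hyp_solution a b c y1 y1'"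
    unfolding y1_def y1'_def by (rule hyp_solution_at_0) fact
  have sol2: "hyp_solution a b c y2 y2'"
    unfolding y2_def y2'_def F_def F'_def by (rule hyp_solution_at_0') fact
  have solG: "hyp_solution a b c G G'"
    unfolding G_def G'_def by (rule hyp_solution_at_1) fact+
  obtain k where k: "\<And>z. z \<in> lens \<Longrightarrow> p z * (y1 z * y2' z - y1' z * y2 z) = k"
    using Wronskian_constant[OF sol1 sol2] by (auto simp: p_def)
  obtain k1 where k1: "\<And>z. z \<in> lens \<Longrightarrow> p z * (G z * y2' z - G' z * y2 z) = k1"
    using Wronskian_constant[OF solG sol2] by (auto simp: p_def)
  obtain k2 where k2: "\<And>z. z \<in> lens \<Longrightarrow> p z * (G z * y1' z - G' z * y1 z) = k2"
    using Wronskian_constant[OF solG sol1] by (auto simp: p_def)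
  \<comment> \<open>The constant is found by letting z tend to 0: z^c from the weight and z^(1-c)
    from \<open>y2\<close> combine to z, which cancels the pole of (1-c)/z.\<close>
  have "k = 1 - c"
  proof -
    have "((\<lambda>u. (1 - complex_of_real u) powr (a + b + 1 - c) *
        (y1 (of_real u) * ((1 - c) * F (of_real u) + of_real u * F' (of_real u)) -
         of_real u * y1' (of_real u) * F (of_real u)))
       \<longlongrightarrow> (1 - of_real 0) powr (a + b + 1 - c) * (1 * ((1 - c) * 1 + of_real 0 * F' 0) - of_real 0 * y1' 0 * 1))
       (at_right (0::real))"
      unfolding y1_def y1'_def F_def F'_def
      by (intro tendsto_intros tendsto_hyp2F1_0 c tendsto_powr_complex) auto
    moreover have "\<forall>\<^sub>F u in at_right 0. (1 - complex_of_real u) powr (a + b + 1 - c) *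
        (y1 (of_real u) * ((1 - c) * F (of_real u) + of_real u * F' (of_real u)) -
         of_real u * y1' (of_real u) * F (of_real u)) = k"
      using eventually_at_right_0_unit
    proof eventually_elim
      case (elim u)
      define z where "z = complex_of_real u"
      have z: "z \<in> lens" using elim by (simp add: z_def of_real_in_lens)
      have nz: "z \<noteq> 0" using lensD[OF z] by blast
      have zz: "z powr c * z powr (1 - c) = z"
        using nz by (simp flip: powr_add)
      have "k = p z * (y1 z * y2' z - y1' z * y2 z)" using k[OF z] by simp
      also have "\<dots> = (z powr c * z powr (1 - c)) * (1 - z) powr (a + b + 1 - c) *
          (y1 z * ((1 - c) / z * F z + F' z) - y1' z * F z)"
        unfolding p_def y2_def y2'_def by (simp add: algebra_simps)
      also have "\<dots> = (1 - z) powr (a + b + 1 - c) *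
          (y1 z * ((1 - c) * F z + z * F' z) - z * y1' z * F z)"
        unfolding zz using nz by (simp add: field_simps)
      finally show ?case by (simp add: z_def)
    qed
    ultimately have "((\<lambda>_. k) \<longlongrightarrow> 1 - c) (at_right (0::real))"
      by (simp add: filterlim_cong)
    then show ?thesis by (simp add: tendsto_const_iff)
  qed
  then have knz: "k \<noteq> 0" using c by simp
  show ?thesis
  proof (intro exI ballI)
    fix z assume z: "z \<in> lens"
    \<comment> \<open>A linear identity between 2x2 determinants; the terms with \<open>G'\<close>
      cancel.\<close>
    have "k * G z = y1 z * k1 - y2 z * k2"
      unfolding k[OF z, symmetric] k1[OF z, symmetric] k2[OF z, symmetric] by (simp add: algebra_simps)
    then have "G z = (k1 / k) * y1 z + (- k2 / k) * y2 z"
      using knz by (simp add: field_simps)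
    then show "hyp2F1 a b s (1 - z) = (k1 / k) * hyp2F1 a b c z +
       (- k2 / k) * (z powr (1 - c) * hyp2F1 (1 + a - c) (1 + b - c) (2 - c) z)"
      by (simp add: G_def y1_def y2_def F_def)
  qed
qed

text \<open>Once the reflection formula has turned all Gamma products into sines, this is the
  identity that \<open>hyp2F1_connection\<close> reduces to.\<close>

lemma sin_product_difference:
  "sin (x - y) * sin (x - z) - sin y * sin z = sin x * sin (x - y - (z::complex))"
proof -
  have "cos (z - y) = cos (y - z)"
    using cos_minus[of "y - z"] by simp
  moreover have "x - y - (x - z) = z - y" "x - (x - y - z) = y + z"
    "x - y + (x - z) = x + (x - y - z)" by simp_all
  ultimately show ?thesis
    unfolding sin_times_sin by (simp add: diff_divide_distrib)
qed

lemma Gamma_mult_rGamma: "z \<notin> \<int>\<^sub>\<le>\<^sub>0 \<Longrightarrow> Gamma z * rGamma z = (1 :: complex)"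
  by (simp add: rGamma_inverse_Gamma Gamma_eq_zero_iff)

text \<open>Letting \<open>u\<close> tend to \<open>0\<close> gives the first connection coefficient and letting \<open>u\<close> tend to \<open>1\<close> a linear
  equation for the second; both limits are values of Gauss's theorem since \<open>Re e < 1\<close> and \<open>Re s < 1\<close>.\<close>

theorem hyp2F1_connection:
  assumes s: "s = 1 + a + b - e" "0 < Re s" "Re s < 1"
    and e: "0 < Re e" "Re e < 1" and a: "0 < Re a" "Re a < 1" and b: "0 < Re b" "Re b < 1"
    and u: "0 < u" "u < 1"
  shows "(hyp2F1 a b e (of_real u) * (rGamma e * rGamma (1 + a - e) * rGamma (1 + b - e)) -
     of_real u powr (1 - e) * hyp2F1 (1 + a - e) (1 + b - e) (2 - e) (of_real u) *
       (rGamma a * rGamma b * rGamma (2 - e))) / sin (of_real pi * e) =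
     rGamma s / of_real pi * hyp2F1 a b s (of_real (1 - u))"
proof -
  have en: "e \<notin> \<int>\<^sub>\<le>\<^sub>0" "2 - e \<notin> \<int>\<^sub>\<le>\<^sub>0" "1 - e \<notin> \<int>\<^sub>\<le>\<^sub>0" "s \<notin> \<int>\<^sub>\<le>\<^sub>0" "1 - s \<notin> \<int>\<^sub>\<le>\<^sub>0"
    "1 - a \<notin> \<int>\<^sub>\<le>\<^sub>0" "1 - b \<notin> \<int>\<^sub>\<le>\<^sub>0" "a \<notin> \<int>\<^sub>\<le>\<^sub>0" "b \<notin> \<int>\<^sub>\<le>\<^sub>0"
    using s e a b by (auto intro!: Re_pos_not_nonpos_Int)
  have "e \<noteq> 1" using e by auto
  then obtain \<alpha> \<beta> where conn: "\<And>z. z \<in> lens \<Longrightarrow> hyp2F1 a b s (1 - z) = \<alpha> * hyp2F1 a b e z +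
     \<beta> * (z powr (1 - e) * hyp2F1 (1 + a - e) (1 + b - e) (2 - e) z)"
    using connection_exists[OF en(1,2) _ s(1) en(4)] by blast
  have conn0: "\<forall>\<^sub>F u in at_right 0. \<alpha> * hyp2F1 a b e (of_real u) +
     \<beta> * (of_real u powr (1 - e) * hyp2F1 (1 + a - e) (1 + b - e) (2 - e) (of_real u)) =
     hyp2F1 a b s (of_real (1 - u))"
    using eventually_at_right_0_unit by eventually_elim (simp add: conn of_real_in_lens)
  \<comment> \<open>Because Re e < 1 the second solution vanishes at 0, which isolates the first
    coefficient.\<close>
  have "((\<lambda>u. complex_of_real u powr (1 - e)) \<longlongrightarrow> 0) (at_right (0::real))"
  proof (rule Lim_null_comparison)
    show "((\<lambda>u. u powr Re (1 - e)) \<longlongrightarrow> 0) (at_right (0::real))"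
      using e by (intro tendsto_zero_powrI[where b = "Re (1 - e)"]) (auto simp: eventually_at_filter)
  qed (auto simp: eventually_at_filter norm_of_real_powr)
  then have "((\<lambda>u. \<alpha> * hyp2F1 a b e (of_real u) +
     \<beta> * (of_real u powr (1 - e) * hyp2F1 (1 + a - e) (1 + b - e) (2 - e) (of_real u))) \<longlongrightarrow>
     \<alpha> * 1 + \<beta> * (0 * 1)) (at_right (0::real))"
    by (intro tendsto_intros tendsto_hyp2F1_0 en)
  then have "((\<lambda>u. hyp2F1 a b s (of_real (1 - u))) \<longlongrightarrow> \<alpha>) (at_right (0::real))"
    using conn0 by (simp add: filterlim_cong)
  moreover have "((\<lambda>u. hyp2F1 a b s (of_real (1 - u))) \<longlongrightarrow> hyp2F1 a b s 1) (at_right (0::real))"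
    using e by (intro tendsto_hyp2F1_1 en) (simp add: s(1))
  ultimately have "\<alpha> = hyp2F1 a b s 1"
    by (rule tendsto_unique[rotated]) simp
  also have "\<dots> = Gamma s * Gamma (1 - e) * rGamma (1 + b - e) * rGamma (1 + a - e)"
    using hyp2F1_at_1[OF s(2), of a b] e by (simp add: s(1) algebra_simps)
  finally have \<alpha>: "\<alpha> = Gamma s * Gamma (1 - e) * rGamma (1 + b - e) * rGamma (1 + a - e)" .

  have conn1: "\<forall>\<^sub>F u in at_right 0. \<alpha> * hyp2F1 a b e (of_real (1 - u)) +
     \<beta> * (of_real (1 - u) powr (1 - e) * hyp2F1 (1 + a - e) (1 + b - e) (2 - e) (of_real (1 - u))) =
     hyp2F1 a b s (of_real u)"
    using eventually_at_right_0_unit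
  proof eventually_elim
    case (elim u)
    then show ?case using conn[OF of_real_in_lens[of "1 - u"]] by simp
  qed
  have "((\<lambda>u. \<alpha> * hyp2F1 a b e (of_real (1 - u)) +
     \<beta> * (of_real (1 - u) powr (1 - e) * hyp2F1 (1 + a - e) (1 + b - e) (2 - e) (of_real (1 - u)))) \<longlongrightarrow>
     \<alpha> * hyp2F1 a b e 1 + \<beta> * (of_real (1 - 0) powr (1 - e) * hyp2F1 (1 + a - e) (1 + b - e) (2 - e) 1)) (at_right (0::real))"
    using s e by (intro tendsto_intros tendsto_hyp2F1_1 en tendsto_powr_complex) auto
  then have "((\<lambda>u. hyp2F1 a b s (of_real u)) \<longlongrightarrow>
      \<alpha> * hyp2F1 a b e 1 + \<beta> * hyp2F1 (1 + a - e) (1 + b - e) (2 - e) 1) (at_right (0::real))"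
    using conn1 by (simp add: filterlim_cong)
  with tendsto_hyp2F1_0(1)[OF en(4), of a b]
  have one: "\<alpha> * hyp2F1 a b e 1 + \<beta> * hyp2F1 (1 + a - e) (1 + b - e) (2 - e) 1 = 1"
    by (intro tendsto_unique[of "at_right (0::real)"]) auto
  have v1: "hyp2F1 a b e 1 = Gamma e * Gamma (1 - s) * rGamma (e - a) * rGamma (e - b)"
  proof -
    have "e - a - b = 1 - s" by (simp add: s(1))
    with s(3) show ?thesis using hyp2F1_at_1[OF e(1), of a b] by simp
  qed
  have v2: "hyp2F1 (1 + a - e) (1 + b - e) (2 - e) 1 = Gamma (2 - e) * Gamma (1 - s) * rGamma (1 - a) * rGamma (1 - b)"
  proof -
    have eqs: "1 - a - (1 + b - e) = 1 - s" "2 - e - (1 + a - e) = 1 - a" "2 - e - (1 + b - e) = 1 - b"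
      by (simp_all add: s(1))
    have "0 < Re (2 - e)" "0 < Re (1 - s)" using s(3) e by simp_all
    then show ?thesis
      by (rule hyp2F1_at_1[of "2 - e" "1 + a - e" "1 + b - e", unfolded eqs])
  qed
  \<comment> \<open>The classical coefficient Gamma(s) Gamma(e-1) / (Gamma(a) Gamma(b)), with
    Gamma(e-1) rewritten so that Gamma(e) Gamma(1-e) = pi / sin(pi e) splits off. It is checked in
    the linear equation rather than solved for.\<close>
  define \<beta>' where "\<beta>' = - Gamma s * Gamma e * Gamma (1 - e) * rGamma a * rGamma b * rGamma (2 - e)"
  have one': "\<alpha> * hyp2F1 a b e 1 + \<beta>' * hyp2F1 (1 + a - e) (1 + b - e) (2 - e) 1 = 1"
  proof -
    have ra: "rGamma (e - a) * rGamma (1 + a - e) = sin (of_real pi * e - of_real pi * a) / of_real pi"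
      using rGamma_reflection_complex[of "e - a"] by (simp add: algebra_simps)
    have rb: "rGamma (e - b) * rGamma (1 + b - e) = sin (of_real pi * e - of_real pi * b) / of_real pi"
      using rGamma_reflection_complex[of "e - b"] by (simp add: algebra_simps)
    have rs: "rGamma s * rGamma (1 - s) = sin (of_real pi * e - of_real pi * a - of_real pi * b) / of_real pi"
      using rGamma_reflection_complex[of "1 - s"] by (simp add: s(1) algebra_simps)
    have "\<alpha> * hyp2F1 a b e 1 + \<beta>' * hyp2F1 (1 + a - e) (1 + b - e) (2 - e) 1 =
       (Gamma s * Gamma (1 - s)) * (Gamma e * Gamma (1 - e)) *
       ((rGamma (e - a) * rGamma (1 + a - e)) * (rGamma (e - b) * rGamma (1 + b - e)) -
        (Gamma (2 - e) * rGamma (2 - e)) * (rGamma a * rGamma (1 - a)) * (rGamma b * rGamma (1 - b)))"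
      unfolding v1 v2 \<alpha> \<beta>'_def by (simp add: algebra_simps)
    also have "\<dots> = (Gamma s * Gamma (1 - s)) * (Gamma e * Gamma (1 - e)) *
       ((sin (of_real pi * e - of_real pi * a) * sin (of_real pi * e - of_real pi * b) -
         sin (of_real pi * a) * sin (of_real pi * b)) / (of_real pi * of_real pi))"
      unfolding ra rb Gamma_mult_rGamma[OF en(2)] rGamma_reflection_complex by (simp add: diff_divide_distrib)
    also have "\<dots> = (Gamma s * Gamma (1 - s)) * (Gamma e * Gamma (1 - e)) *
       ((rGamma e * rGamma (1 - e)) * (rGamma s * rGamma (1 - s)))"
      unfolding sin_product_difference rs rGamma_reflection_complex[of e] by simp
    also have "\<dots> = (Gamma s * rGamma s) * (Gamma (1 - s) * rGamma (1 - s)) * (Gamma e * rGamma e) * (Gamma (1 - e) * rGamma (1 - e))"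
      by (simp add: mult_ac)
    also have "\<dots> = 1" using en by (simp add: Gamma_mult_rGamma)
    finally show ?thesis .
  qed
  \<comment> \<open>Uniqueness in the linear equation; the bounds Re a < 1 and Re b < 1 keep
    1/Gamma(1-a) and 1/Gamma(1-b) from vanishing.\<close>
  have "hyp2F1 (1 + a - e) (1 + b - e) (2 - e) 1 \<noteq> 0"
    unfolding v2 using en by (simp add: Gamma_eq_zero_iff rGamma_eq_zero_iff)
  then have \<beta>: "\<beta> = \<beta>'" using one one' by (metis add_left_cancel mult_right_cancel)
  have refl: "Gamma e * Gamma (1 - e) = of_real pi / sin (of_real pi * e)"
    by (rule Gamma_reflection_complex)
  have "hyp2F1 a b s (of_real (1 - u)) = \<alpha> * hyp2F1 a b e (of_real u) +
     \<beta>' * (of_real u powr (1 - e) * hyp2F1 (1 + a - e) (1 + b - e) (2 - e) (of_real u))"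
    using conn[OF of_real_in_lens[OF u]] by (simp add: \<beta>)
  also have "\<alpha> = Gamma s * (Gamma e * Gamma (1 - e)) * (rGamma e * rGamma (1 + a - e) * rGamma (1 + b - e))"
    using Gamma_mult_rGamma[OF en(1)] unfolding \<alpha> by (simp add: mult_ac)
  also have "\<beta>' = - Gamma s * (Gamma e * Gamma (1 - e)) * (rGamma a * rGamma b * rGamma (2 - e))"
    unfolding \<beta>'_def by simp
  finally have "hyp2F1 a b s (of_real (1 - u)) = Gamma s * (Gamma e * Gamma (1 - e)) *
     (hyp2F1 a b e (of_real u) * (rGamma e * rGamma (1 + a - e) * rGamma (1 + b - e)) -
     of_real u powr (1 - e) * hyp2F1 (1 + a - e) (1 + b - e) (2 - e) (of_real u) *
       (rGamma a * rGamma b * rGamma (2 - e)))"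
    by (simp add: algebra_simps)
  then have "rGamma s * hyp2F1 a b s (of_real (1 - u)) = (Gamma s * rGamma s) * (Gamma e * Gamma (1 - e)) *
     (hyp2F1 a b e (of_real u) * (rGamma e * rGamma (1 + a - e) * rGamma (1 + b - e)) -
     of_real u powr (1 - e) * hyp2F1 (1 + a - e) (1 + b - e) (2 - e) (of_real u) *
       (rGamma a * rGamma b * rGamma (2 - e)))"
    by (simp only: mult_ac)
  then show ?thesis
    unfolding Gamma_mult_rGamma[OF en(4)] refl by simp
qed

section \<open>The integral representation of \<open>L\<close>\<close>

lemma hyp2F1_commute: "hyp2F1 a b c z = hyp2F1 b a c z"
  by (simp add: hyp2F1_def gauss_coeff_def mult.commute)

text \<open>Both series of \<open>L\<close> are integrals against the same weight \<open>w\<close>: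
  multiplying by u^(1-e) shifts c, d, f, g by 1 - e and leaves s, f - d and g - d alone. Under the
  integral, \<open>L\<close> becomes the left-hand side of \<open>hyp2F1_connection\<close>.\<close>

theorem L_fun_integral:
  assumes saal: "e + f + g - a - b - c - d = 1"
    and s: "s = 1 + a + b - e" "0 < Re s" "Re s < 1"
    and e: "0 < Re e" "Re e < 1" and a: "0 < Re a" "Re a < 1" and b: "0 < Re b" "Re b < 1"
    and cd: "0 < Re c" "Re c < Re d" and fg: "0 < Re f" "0 < Re g"
  shows "L_fun a b c d e f g = rGamma c * rGamma d * rGamma (1 + c - e) * rGamma (1 + d - e) *
     (rGamma s)\<^sup>2 / of_real pi *
     (\<integral>u. of_real u powr (c - 1) * of_real (1 - u) powr (s - 1) *
        hyp2F1 (f - d) (g - d) s (of_real (1 - u)) * hyp2F1 a b s (of_real (1 - u)) \<partial>unit_measure)"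
proof -
  define w where "w = (\<lambda>u. of_real u powr (c - 1) * of_real (1 - u) powr (s - 1) *
        hyp2F1 (f - d) (g - d) s (of_real (1 - u)))"
  define F1 where "F1 = (\<lambda>u. hyp2F1 a b e (complex_of_real u))"
  define F2 where "F2 = (\<lambda>u. complex_of_real u powr (1 - e) * hyp2F1 (1 + a - e) (1 + b - e) (2 - e) (of_real u))"
  define H1 where "H1 = hyp4F3 a b c d e f g"
  \<comment> \<open>Here 2 - e comes first among the lower parameters since it takes the place of
    \<open>e\<close> in \<open>hyp4F3_integral\<close>; \<open>H2'\<close> restores the order of
    \<open>L_fun\<close>.\<close>
  define H2 where "H2 = hyp4F3 (1 + a - e) (1 + b - e) (1 + c - e) (1 + d - e) (2 - e) (1 + f - e) (1 + g - e)"
  define \<sigma> where "\<sigma> = sin (of_real pi * e)"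
  have g_eq: "g = 1 + a + b + c + d - e - f"
    using saal by (simp add: algebra_simps)
  have sfg: "s = f + g - c - d" by (simp add: s(1) g_eq)
  have nn: "c \<notin> \<int>\<^sub>\<le>\<^sub>0" "d \<notin> \<int>\<^sub>\<le>\<^sub>0" "1 + c - e \<notin> \<int>\<^sub>\<le>\<^sub>0" "1 + d - e \<notin> \<int>\<^sub>\<le>\<^sub>0" "s \<notin> \<int>\<^sub>\<le>\<^sub>0"
    using s e cd by (auto intro!: Re_pos_not_nonpos_Int)
  have I1: "integrable unit_measure (\<lambda>u. w u * F1 u)"
    and V1: "(\<integral>u. w u * F1 u \<partial>unit_measure) = Gamma c * Gamma d * Gamma s * rGamma f * rGamma g * H1"
  proof -
    have *: "0 < Re (s - (g - d) - (f - d))" "d = c + s - (g - d) - (f - d)" "e \<notin> \<int>\<^sub>\<le>\<^sub>0"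
      "f = c + s - (g - d)" "f \<notin> \<int>\<^sub>\<le>\<^sub>0" "g = c + s - (f - d)" "g \<notin> \<int>\<^sub>\<le>\<^sub>0"
      using e cd fg by (auto simp: sfg intro!: Re_pos_not_nonpos_Int)
    note int = hyp4F3_integral[OF s(2,1) cd(1) *, folded hyp2F1_commute[of "f - d" "g - d"]]
    show "integrable unit_measure (\<lambda>u. w u * F1 u)"
      using int(1) unfolding w_def F1_def .
    show "(\<integral>u. w u * F1 u \<partial>unit_measure) = Gamma c * Gamma d * Gamma s * rGamma f * rGamma g * H1"
      using int(2) unfolding w_def F1_def H1_def .
  qed
  have I2: "integrable unit_measure (\<lambda>u. w u * F2 u)"
    and V2: "(\<integral>u. w u * F2 u \<partial>unit_measure) = Gamma (1 + c - e) * Gamma (1 + d - e) * Gamma s *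
       rGamma (1 + f - e) * rGamma (1 + g - e) * H2"
  proof -
    have *: "s = 1 + (1 + a - e) + (1 + b - e) - (2 - e)" "0 < Re (1 + c - e)"
      "0 < Re (s - (g - d) - (f - d))" "1 + d - e = (1 + c - e) + s - (g - d) - (f - d)" "2 - e \<notin> \<int>\<^sub>\<le>\<^sub>0"
      "1 + f - e = (1 + c - e) + s - (g - d)" "1 + f - e \<notin> \<int>\<^sub>\<le>\<^sub>0"
      "1 + g - e = (1 + c - e) + s - (f - d)" "1 + g - e \<notin> \<int>\<^sub>\<le>\<^sub>0"
      using e cd fg by (auto simp: sfg intro!: Re_pos_not_nonpos_Int) (simp add: g_eq)
    note int = hyp4F3_integral[OF s(2) *, folded hyp2F1_commute[of "f - d" "g - d"]]
    have eq: "of_real u powr (1 + c - e - 1) * of_real (1 - u) powr (s - 1) *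
        hyp2F1 (f - d) (g - d) s (of_real (1 - u)) * hyp2F1 (1 + a - e) (1 + b - e) (2 - e) (of_real u) = w u * F2 u"
      if "u \<in> space unit_measure" for u
    proof -
      have "complex_of_real u powr (1 + c - e - 1) = of_real u powr (c - 1) * of_real u powr (1 - e)"
        by (simp flip: powr_add)
      then show ?thesis by (simp add: w_def F2_def mult_ac)
    qed
    show "integrable unit_measure (\<lambda>u. w u * F2 u)"
      using int(1) by (subst Bochner_Integration.integrable_cong[OF refl eq[symmetric]])
    show "(\<integral>u. w u * F2 u \<partial>unit_measure) = Gamma (1 + c - e) * Gamma (1 + d - e) * Gamma s *
       rGamma (1 + f - e) * rGamma (1 + g - e) * H2"
      using int(2) unfolding H2_def by (subst Bochner_Integration.integral_cong[OF refl eq[symmetric]])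
  qed
  define p where "p = rGamma e * rGamma (1 + a - e) * rGamma (1 + b - e)"
  define q where "q = rGamma a * rGamma b * rGamma (2 - e)"
  \<comment> \<open>The common factor: it cancels the Gamma products of \<open>V1\<close> and of
    \<open>V2\<close> and leaves exactly the reciprocal Gammas missing from the other
    series.\<close>
  define R where "R = rGamma c * rGamma d * rGamma (1 + c - e) * rGamma (1 + d - e) * rGamma s"
  have R1: "R * (Gamma c * Gamma d * Gamma s) = rGamma (1 + c - e) * rGamma (1 + d - e)"
  proof -
    have "R * (Gamma c * Gamma d * Gamma s) = (Gamma c * rGamma c) * (Gamma d * rGamma d) *
        (Gamma s * rGamma s) * (rGamma (1 + c - e) * rGamma (1 + d - e))"
      by (simp add: R_def)
    then show ?thesis by (simp add: Gamma_mult_rGamma nn)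
  qed
  have R2: "R * (Gamma (1 + c - e) * Gamma (1 + d - e) * Gamma s) = rGamma c * rGamma d"
  proof -
    have "R * (Gamma (1 + c - e) * Gamma (1 + d - e) * Gamma s) = (Gamma (1 + c - e) * rGamma (1 + c - e)) *
        (Gamma (1 + d - e) * rGamma (1 + d - e)) * (Gamma s * rGamma s) * (rGamma c * rGamma d)"
      by (simp add: R_def)
    then show ?thesis by (simp add: Gamma_mult_rGamma nn)
  qed
  have H2': "hyp4F3 (1 + a - e) (1 + b - e) (1 + c - e) (1 + d - e) (1 + f - e) (1 + g - e) (2 - e) = H2"
    unfolding H2_def hyp4F3_def by (simp add: mult_ac)
  have "L_fun a b c d e f g =
      H1 * p * (rGamma (1 + c - e) * rGamma (1 + d - e)) * rGamma f * rGamma g / \<sigma> -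
      H2 * q * (rGamma c * rGamma d) * rGamma (1 + f - e) * rGamma (1 + g - e) / \<sigma>"
    unfolding L_fun_def H2' H1_def[symmetric] \<sigma>_def[symmetric] p_def q_def by (simp add: mult_ac)
  also have "\<dots> = R * (((\<integral>u. w u * F1 u \<partial>unit_measure) * p - (\<integral>u. w u * F2 u \<partial>unit_measure) * q) / \<sigma>)"
    unfolding V1 V2 R1[symmetric] R2[symmetric] by (simp add: diff_divide_distrib algebra_simps)
  also have "((\<integral>u. w u * F1 u \<partial>unit_measure) * p - (\<integral>u. w u * F2 u \<partial>unit_measure) * q) / \<sigma> =
     (\<integral>u. (w u * F1 u * p - w u * F2 u * q) / \<sigma> \<partial>unit_measure)"
    using I1 I2 by simp
  also have "\<dots> = (\<integral>u. rGamma s / of_real pi * (w u * hyp2F1 a b s (of_real (1 - u))) \<partial>unit_measure)"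
  proof (rule Bochner_Integration.integral_cong)
    fix u assume "u \<in> space unit_measure"
    then have u: "0 < u" "u < 1" by auto
    have "(w u * F1 u * p - w u * F2 u * q) / \<sigma> = w u * ((F1 u * p - F2 u * q) / \<sigma>)"
      by (simp add: diff_divide_distrib right_diff_distrib mult.assoc)
    also have "(F1 u * p - F2 u * q) / \<sigma> = rGamma s / of_real pi * hyp2F1 a b s (of_real (1 - u))"
      unfolding F1_def F2_def p_def q_def \<sigma>_def by (rule hyp2F1_connection[OF s e a b u])
    finally show "(w u * F1 u * p - w u * F2 u * q) / \<sigma> =
        rGamma s / of_real pi * (w u * hyp2F1 a b s (of_real (1 - u)))"
      by (simp add: mult_ac)
  qed simp
  finally show ?thesis
    by (simp add: R_def w_def power2_eq_square mult_ac)
qed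

text \<open>The new parameters are forced by the wish to exchange (a, b) with (f-d, g-d) while
  keeping c, s and the set {c, d, 1+c-e, 1+d-e}. The inequalities place both parameter vectors in
  the range of \<open>L_fun_integral\<close>.\<close>

corollary L_fun_local_symmetry:
  assumes saal: "e + f + g - a - b - c - d = 1"
    and s: "0 < Re (1 + a + b - e)" "Re (1 + a + b - e) < 1"
    and e: "0 < Re e" "Re e < 1" and a: "0 < Re a" "Re a < 1" and b: "0 < Re b" "Re b < 1"
    and cd: "0 < Re c" "Re c < Re d" "Re d < 1" and fg: "0 < Re f" "0 < Re g"
    and f: "0 < Re (f - d)" "Re (f - d) < 1" and g: "0 < Re (g - d)" "Re (g - d) < 1"
  shows "L_fun a b c d e f g = L_fun (f - d) (g - d) c (1 + c - e) (1 + c - d) (1 + a + c - e) (1 + b + c - e)"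
proof -
  define s where "s = 1 + a + b - e"
  have g_eq: "g = 1 + a + b + c + d - e - f"
    using saal by (simp add: algebra_simps)
  have eqs: "1 + c - (1 + c - d) = d" "1 + (1 + c - e) - (1 + c - d) = 1 + d - e"
    "1 + a + c - e - (1 + c - e) = a" "1 + b + c - e - (1 + c - e) = b"
    by simp_all
  have "L_fun (f - d) (g - d) c (1 + c - e) (1 + c - d) (1 + a + c - e) (1 + b + c - e) =
     rGamma c * rGamma (1 + c - e) * rGamma d * rGamma (1 + d - e) * (rGamma s)\<^sup>2 / of_real pi *
     (\<integral>u. of_real u powr (c - 1) * of_real (1 - u) powr (s - 1) *
        hyp2F1 a b s (of_real (1 - u)) * hyp2F1 (f - d) (g - d) s (of_real (1 - u)) \<partial>unit_measure)"
    by (rule L_fun_integral[where s = s and a = "f - d" and b = "g - d" and c = c and e = "1 + c - d" and d = "1 + c - e" and f = "1 + a + c - e"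
          and g = "1 + b + c - e", unfolded eqs])
      (use assms in \<open>auto simp: s_def g_eq\<close>)
  also have "\<dots> = L_fun a b c d e f g"
    by (subst L_fun_integral[OF saal s_def]) (use assms in \<open>auto simp: s_def mult_ac\<close>)
  finally show ?thesis by simp
qed

section \<open>Holomorphic dependence on the parameters\<close>

text \<open>Appends one factor 1 + x t to a product known up to second order; Y bounds the linear
  coefficient collected so far.\<close>

lemma one_plus_product_step:
  fixes P x y t :: complex
  assumes P: "norm (P - 1 - y * t) \<le> R * (norm t)\<^sup>2" and x: "norm x \<le> M" and y: "norm y \<le> Y"
    and t: "norm t \<le> 1" and R: "R \<ge> 0"
  shows "norm (P * (1 + x * t) - 1 - (y + x) * t) \<le> (R * (1 + M) + M * Y) * (norm t)\<^sup>2"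
proof -
  have M: "M \<ge> 0" and Y: "Y \<ge> 0" using x y norm_ge_zero order_trans by blast+
  have "P * (1 + x * t) - 1 - (y + x) * t = (P - 1 - y * t) * (1 + x * t) + x * y * t\<^sup>2"
    by (simp add: algebra_simps power2_eq_square)
  also have "norm \<dots> \<le> norm (P - 1 - y * t) * norm (1 + x * t) + norm x * norm y * (norm t)\<^sup>2"
    by (rule order_trans[OF norm_triangle_ineq]) (simp add: norm_mult norm_power)
  also have "\<dots> \<le> R * (norm t)\<^sup>2 * (1 + M) + M * Y * (norm t)\<^sup>2"
  proof (intro add_mono mult_mono P x y)
    have "norm (1 + x * t) \<le> 1 + norm x * norm t"
      using norm_triangle_ineq[of 1 "x * t"] by (simp add: norm_mult)
    also have "norm x * norm t \<le> M * 1" by (intro mult_mono x t M) auto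
    finally show "norm (1 + x * t) \<le> 1 + M" by simp
  qed (use R M Y in auto)
  finally show ?thesis by (simp add: algebra_simps)
qed

lemma product4_expansion:
  fixes M :: real
  assumes M: "M \<ge> 0"
  shows "\<exists>R\<ge>0. \<forall>a b c d t :: complex. norm a \<le> M \<longrightarrow> norm b \<le> M \<longrightarrow> norm c \<le> M \<longrightarrow> norm d \<le> M \<longrightarrow> norm t \<le> 1 \<longrightarrow>
    norm ((1 + a * t) * (1 + b * t) * (1 + c * t) * (1 + d * t) - 1 - (a + b + c + d) * t) \<le> R * (norm t)\<^sup>2"
proof -
  \<comment> \<open>The constants returned by successive uses of the previous lemma, with Y equal to
    M, 2 M and 3 M.\<close>
  define R2 where "R2 = M * M"
  define R3 where "R3 = R2 * (1 + M) + M * (2 * M)"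
  define R4 where "R4 = R3 * (1 + M) + M * (3 * M)"
  have nn: "R2 \<ge> 0" "R3 \<ge> 0" "R4 \<ge> 0" using M by (auto simp: R2_def R3_def R4_def)
  have "norm ((1 + a * t) * (1 + b * t) * (1 + c * t) * (1 + d * t) - 1 - (a + b + c + d) * t) \<le> R4 * (norm t)\<^sup>2"
    if h: "norm a \<le> M" "norm b \<le> M" "norm c \<le> M" "norm d \<le> M" "norm t \<le> 1" for a b c d t :: complex
  proof -
    have 2: "norm ((1 + a * t) * (1 + b * t) - 1 - (a + b) * t) \<le> R2 * (norm t)\<^sup>2"
      using one_plus_product_step[of "1 + a * t" a t 0 b M M] h by (simp add: R2_def)
    have ab: "norm (a + b) \<le> 2 * M" and abc: "norm (a + b + c) \<le> 3 * M"
      using h norm_triangle_ineq[of a b] norm_triangle_ineq[of "a + b" c] by linarith+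
    have 3: "norm ((1 + a * t) * (1 + b * t) * (1 + c * t) - 1 - (a + b + c) * t) \<le> R3 * (norm t)\<^sup>2"
      unfolding R3_def using one_plus_product_step[OF 2 h(3) ab h(5) nn(1)] .
    show ?thesis
      unfolding R4_def using one_plus_product_step[OF 3 h(4) abc h(5) nn(2)] .
  qed
  with nn(3) show ?thesis by blast
qed

text \<open>By the Saalschuetz condition the ratio of consecutive terms is \<open>1 - 2/n + O(1/n\<^sup>2)\<close> uniformly on compact
  sets; the slack down to \<open>1 - 3/(2(n+1))\<close> absorbs the error term.\<close>

lemma product_ratio_bound:
  fixes M :: real
  shows "\<exists>N\<ge>1. \<forall>n\<ge>N. \<forall>a b c d e f g :: complex.
    norm a \<le> M \<longrightarrow> norm b \<le> M \<longrightarrow> norm c \<le> M \<longrightarrow> norm d \<le> M \<longrightarrow> norm e \<le> M \<longrightarrow> norm f \<le> M \<longrightarrow> norm g \<le> M \<longrightarrow>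
    e + f + g - a - b - c - d = 1 \<longrightarrow>
    real (n + 1) * norm ((a + of_nat n) * (b + of_nat n) * (c + of_nat n) * (d + of_nat n)) \<le>
      (real n - 1 / 2) * norm ((1 + of_nat n) * (e + of_nat n) * (f + of_nat n) * (g + of_nat n))"
proof -
  define M' where "M' = max 1 M"
  have M'0: "M' \<ge> 0" by (simp add: M'_def)
  obtain R where R: "R \<ge> 0" "\<And>a b c d t :: complex. \<lbrakk>norm a \<le> M'; norm b \<le> M'; norm c \<le> M'; norm d \<le> M'; norm t \<le> 1\<rbrakk> \<Longrightarrow>
    norm ((1 + a * t) * (1 + b * t) * (1 + c * t) * (1 + d * t) - 1 - (a + b + c + d) * t) \<le> R * (norm t)\<^sup>2"
    using product4_expansion[of M', OF M'0] by (elim exE conjE) (rule that, assumption, blast)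
  \<comment> \<open>The error beside (1-2t) W below consists of \<open>rU\<close>,
    \<open>rW\<close>, 2 t \<open>rW\<close> and 2 S t^2, which contribute R, R, 2 R and 8 M'.
    Taking M' at least 1 lets the parameter 1 from n! be treated like the others.\<close>
  define C where "C = 4 * R + 8 * M'"
  have Cpos: "C \<ge> 8" using R(1) by (simp add: C_def M'_def)
  define N where "N = nat \<lceil>8 * C\<rceil> + 1"
  show ?thesis
  proof (intro exI[of _ N] conjI allI impI)
    show "N \<ge> 1" by (simp add: N_def)
    fix n a b c d e f g
    assume n: "n \<ge> N" and h: "norm a \<le> M" "norm b \<le> M" "norm c \<le> M" "norm d \<le> M" "norm e \<le> M" "norm f \<le> M" "norm (g::complex) \<le> M"
      and saal: "e + f + g - a - b - c - d = 1"
    have nC: "real n \<ge> 8 * C" using n Cpos unfolding N_def by linarith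
    then have npos: "real n > 0" using Cpos by linarith
    define t where "t = 1 / (of_nat n :: complex)"
    define \<tau> where "\<tau> = 1 / real n"
    have nt: "norm t = \<tau>" by (simp add: t_def \<tau>_def norm_divide)
    have \<tau>: "\<tau> > 0" "8 * C * \<tau> \<le> 1" "\<tau> \<le> 1"
      using nC npos Cpos by (auto simp: \<tau>_def field_simps)
    have t1: "norm t \<le> 1" using nt \<tau> by simp
    have hM: "norm a \<le> M'" "norm b \<le> M'" "norm c \<le> M'" "norm d \<le> M'" "norm e \<le> M'" "norm f \<le> M'" "norm g \<le> M'" "norm (1::complex) \<le> M'"
      using h by (auto simp: M'_def)
    define U where "U = (1 + a * t) * (1 + b * t) * (1 + c * t) * (1 + d * t)"
    define W where "W = (1 + 1 * t) * (1 + e * t) * (1 + f * t) * (1 + g * t)"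
    define rU where "rU = U - 1 - (a + b + c + d) * t"
    define rW where "rW = W - 1 - (1 + e + f + g) * t"
    have rU: "norm rU \<le> R * \<tau>\<^sup>2"
      unfolding rU_def U_def nt[symmetric] by (intro R hM t1)
    have rW: "norm rW \<le> R * \<tau>\<^sup>2"
      unfolding rW_def W_def nt[symmetric] by (intro R(2) hM t1)
    define S where "S = 1 + e + f + g"
    have S: "norm S \<le> 4 * M'"
      using norm_triangle_ineq[of "1 + e + f" g] norm_triangle_ineq[of "1 + e" f] norm_triangle_ineq[of 1 e] hM
      unfolding S_def by linarith
    have Weq: "W = 1 + S * t + rW" by (simp add: rW_def S_def)
    have tau2: "\<tau>\<^sup>2 \<le> \<tau>" using \<tau> by (simp add: power2_eq_square mult_left_le)
    have St: "norm (S * t) \<le> 4 * M' * \<tau>"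
      unfolding norm_mult nt using S \<tau> by (intro mult_right_mono) auto
    have RW': "R * \<tau>\<^sup>2 \<le> R * \<tau>" using tau2 R(1) by (intro mult_left_mono)
    have Wlow: "norm W \<ge> 1 / 2"
    proof -
      have "1 = W - S * t - rW" by (simp add: Weq)
      then have "1 \<le> norm W + norm (S * t) + norm rW"
        using norm_triangle_ineq4[of "W - S * t" rW] norm_triangle_ineq4[of W "S * t"]
        by (smt (verit) norm_one)
      moreover have "4 * M' * \<tau> + R * \<tau> \<le> 1 / 2"
      proof -
        have "4 * M' * \<tau> + R * \<tau> = (4 * M' + R) * \<tau>" by (simp add: algebra_simps)
        also have "\<dots> \<le> C * \<tau>" using \<tau> R(1) by (intro mult_right_mono) (auto simp: C_def M'_def)
        finally show ?thesis using \<tau> by linarith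
      qed
      ultimately show ?thesis using St rW RW' by linarith
    qed
    \<comment> \<open>The Saalschuetz condition makes the linear coefficients of U and W differ by
      exactly 2.\<close>
    have "U = (1 - 2 * t) * W + (rU - rW + 2 * t * rW + 2 * S * t\<^sup>2)"
    proof -
      have "a + b + c + d = S - 2" using saal by (simp add: S_def algebra_simps)
      then have "U = 1 + (S - 2) * t + rU" by (simp add: rU_def)
      then show ?thesis by (simp add: Weq algebra_simps power2_eq_square)
    qed
    then have "norm U \<le> norm (1 - 2 * t) * norm W + norm (rU - rW + 2 * t * rW + 2 * S * t\<^sup>2)"
      by (metis norm_triangle_ineq norm_mult)
    also have "norm (rU - rW + 2 * t * rW + 2 * S * t\<^sup>2) \<le> norm rU + norm rW + norm (2 * t * rW) + norm (2 * S * t\<^sup>2)"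
      by (smt (verit) norm_triangle_ineq norm_triangle_ineq4)
    also have "norm (2 * t * rW) \<le> 2 * 1 * (R * \<tau>\<^sup>2)"
      unfolding norm_mult using rW t1 by (intro mult_mono) auto
    also have "norm (2 * S * t\<^sup>2) \<le> 2 * (4 * M') * \<tau>\<^sup>2"
      unfolding norm_mult norm_power nt using S by (intro mult_right_mono) auto
    finally have "norm U \<le> norm (1 - 2 * t) * norm W + (R * \<tau>\<^sup>2 + R * \<tau>\<^sup>2 + 2 * 1 * (R * \<tau>\<^sup>2) + 2 * (4 * M') * \<tau>\<^sup>2)"
      using rU rW by linarith
    also have "R * \<tau>\<^sup>2 + R * \<tau>\<^sup>2 + 2 * 1 * (R * \<tau>\<^sup>2) + 2 * (4 * M') * \<tau>\<^sup>2 = C * \<tau>\<^sup>2"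
      by (simp add: C_def algebra_simps)
    also have "norm (1 - 2 * t) = 1 - 2 * \<tau>"
    proof -
      have "1 - 2 * t = of_real (1 - 2 * \<tau>)" by (simp add: t_def \<tau>_def)
      moreover have "1 - 2 * \<tau> \<ge> 0"
      proof -
        have "8 * 8 * \<tau> \<le> 8 * C * \<tau>" using Cpos \<tau> by (intro mult_right_mono) auto
        then show ?thesis using \<tau> by linarith
      qed
      ultimately show ?thesis by (simp only: norm_of_real abs_of_nonneg)
    qed
    \<comment> \<open>As W has norm at least 1/2, the additive error becomes a relative one at the
      cost of a factor 2; n >= 8 C then makes it at most 1/(4n).\<close>
    also have "C * \<tau>\<^sup>2 \<le> 2 * C * \<tau>\<^sup>2 * norm W"
    proof -
      have "C * \<tau>\<^sup>2 * 1 \<le> C * \<tau>\<^sup>2 * (2 * norm W)"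
        using Wlow Cpos by (intro mult_left_mono) auto
      then show ?thesis by (simp add: mult_ac)
    qed
    finally have "norm U \<le> (1 - 2 * \<tau> + 2 * C * \<tau>\<^sup>2) * norm W"
      by (simp add: algebra_simps)
    also have "\<dots> \<le> (1 - 2 * \<tau> + \<tau> / 4) * norm W"
    proof (intro mult_right_mono add_left_mono)
      have "2 * C * \<tau>\<^sup>2 = (8 * C * \<tau>) * (\<tau> / 4)" by (simp add: power2_eq_square)
      also have "\<dots> \<le> 1 * (\<tau> / 4)" using \<tau> by (intro mult_right_mono) auto
      finally show "2 * C * \<tau>\<^sup>2 \<le> \<tau> / 4" by simp
    qed auto
    finally have UW: "norm U \<le> (1 - 2 * \<tau> + \<tau> / 4) * norm W" .
    have fac: "x + of_nat n = of_nat n * (1 + x * t)" for x :: complex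
      using npos by (simp add: t_def field_simps)
    have lhs: "(a + of_nat n) * (b + of_nat n) * (c + of_nat n) * (d + of_nat n) = of_nat n ^ 4 * U"
      unfolding fac[of a] fac[of b] fac[of c] fac[of d] U_def by (simp add: eval_nat_numeral mult_ac)
    have rhs: "(1 + of_nat n) * (e + of_nat n) * (f + of_nat n) * (g + of_nat n) = of_nat n ^ 4 * W"
      unfolding fac[of 1] fac[of e] fac[of f] fac[of g] W_def by (simp add: eval_nat_numeral mult_ac)
    have "real (n + 1) * norm U \<le> real (n + 1) * ((1 - 2 * \<tau> + \<tau> / 4) * norm W)"
      using UW by (intro mult_left_mono) auto
    also have "\<dots> = (real (n + 1) * (1 - 2 * \<tau> + \<tau> / 4)) * norm W" by simp
    also have "\<dots> \<le> (real n - 1 / 2) * norm W"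
    proof (rule mult_right_mono)
      have "real (n + 1) * (1 - 2 * \<tau> + \<tau> / 4) = real n + 1 - 7 / 4 * (real n * \<tau> + \<tau>)"
        by (simp add: algebra_simps)
      also have "real n * \<tau> = 1" using npos by (simp add: \<tau>_def)
      finally have eq: "real (n + 1) * (1 - 2 * \<tau> + \<tau> / 4) = real n + 1 - 7 / 4 * (1 + \<tau>)" .
      have "real n + 1 - 7 / 4 * (1 + \<tau>) \<le> real n - 1 / 2"
        using \<tau>(1) by (simp add: field_simps)
      then show "real (n + 1) * (1 - 2 * \<tau> + \<tau> / 4) \<le> real n - 1 / 2" unfolding eq .
    qed auto
    finally show "real (n + 1) * norm ((a + of_nat n) * (b + of_nat n) * (c + of_nat n) * (d + of_nat n)) \<le>
      (real n - 1 / 2) * norm ((1 + of_nat n) * (e + of_nat n) * (f + of_nat n) * (g + of_nat n))"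
      unfolding lhs rhs norm_mult norm_power norm_of_nat
      using mult_left_mono[of "real (n + 1) * norm U" "(real n - 1 / 2) * norm W" "real n ^ 4"]
      by (simp add: mult_ac)
  qed
qed


text \<open>The step makes n^(3/2) T n nonincreasing from N on. The exponent 3/2 lies between the 1
  that summability must exceed and the generic order 2 of the terms.\<close>

lemma three_halves_decay:
  fixes T :: "nat \<Rightarrow> real"
  assumes N: "N \<ge> 1" and T: "\<And>n. T n \<ge> 0"
    and step: "\<And>n. n \<ge> N \<Longrightarrow> real (n + 1) * T (Suc n) \<le> (real n - 1 / 2) * T n"
    and n: "n \<ge> N"
  shows "T n \<le> sqrt (real N ^ 3) * T N / sqrt (real n ^ 3)"
proof -
  have "sqrt (real n ^ 3) * T n \<le> sqrt (real N ^ 3) * T N"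
    using n
  proof (induction n rule: dec_induct)
    case (step n)
    have n1: "real n \<ge> 1" using step N by simp
    have "sqrt (real (n + 1) ^ 3) * (real n - 1 / 2) \<le> sqrt (real n ^ 3) * real (n + 1)"
    proof (rule power2_le_imp_le)
      \<comment> \<open>After squaring, the factor (n+1)^2 is common and the claim becomes
        (n+1)(n-1/2)^2 <= n^3, whose two sides differ by (3n-1)/4.\<close>
      have "real (n + 1) ^ 2 * (real (n + 1) * (real n - 1 / 2)\<^sup>2) \<le> real (n + 1) ^ 2 * real n ^ 3"
      proof (rule mult_left_mono)
        have "real (n + 1) * (real n - 1 / 2)\<^sup>2 = real n ^ 3 - (3 * real n - 1) / 4"
          by (simp add: power2_eq_square power3_eq_cube field_simps)
        then show "real (n + 1) * (real n - 1 / 2)\<^sup>2 \<le> real n ^ 3" using n1 by simp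
      qed simp
      then show "(sqrt (real (n + 1) ^ 3) * (real n - 1 / 2))\<^sup>2 \<le> (sqrt (real n ^ 3) * real (n + 1))\<^sup>2"
        by (simp add: power_mult_distrib power3_eq_cube power2_eq_square mult_ac)
    qed simp
    then have sq: "sqrt (real (n + 1) ^ 3) * (real n - 1 / 2) * T n \<le> sqrt (real n ^ 3) * real (n + 1) * T n"
      by (rule mult_right_mono) (rule T)
    have "real (n + 1) * (sqrt (real (n + 1) ^ 3) * T (Suc n)) = sqrt (real (n + 1) ^ 3) * (real (n + 1) * T (Suc n))"
      by simp
    also have "\<dots> \<le> sqrt (real (n + 1) ^ 3) * ((real n - 1 / 2) * T n)"
      by (rule mult_left_mono) (use assms(3)[of n] step in auto)
    also have "\<dots> = sqrt (real (n + 1) ^ 3) * (real n - 1 / 2) * T n" by simp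
    also note sq
    also have "sqrt (real n ^ 3) * real (n + 1) * T n = real (n + 1) * (sqrt (real n ^ 3) * T n)" by simp
    finally have "real (n + 1) * (sqrt (real (n + 1) ^ 3) * T (Suc n)) \<le> real (n + 1) * (sqrt (real n ^ 3) * T n)" .
    then have "sqrt (real (n + 1) ^ 3) * T (Suc n) \<le> sqrt (real n ^ 3) * T n"
      by (rule mult_left_le_imp_le) simp
    with step show ?case by simp
  qed simp
  moreover have "sqrt (real n ^ 3) > 0" using n N by simp
  ultimately show ?thesis by (simp add: field_simps)
qed

text \<open>On a closed disc the parameters are bounded, so one N serves all points, and compactness
  bounds the N-th term. A uniform n^(-3/2) majorant follows, and locally uniform limits of
  holomorphic functions are holomorphic.\<close>

theorem hyp4F3_holomorphic:
  assumes S: "open S"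
    and hol: "a holomorphic_on S" "b holomorphic_on S" "c holomorphic_on S" "d holomorphic_on S"
      "e holomorphic_on S" "f holomorphic_on S" "g holomorphic_on S"
    and lower: "\<And>z. z \<in> S \<Longrightarrow> e z \<notin> \<int>\<^sub>\<le>\<^sub>0" "\<And>z. z \<in> S \<Longrightarrow> f z \<notin> \<int>\<^sub>\<le>\<^sub>0" "\<And>z. z \<in> S \<Longrightarrow> g z \<notin> \<int>\<^sub>\<le>\<^sub>0"
    and saal: "\<And>z. z \<in> S \<Longrightarrow> e z + f z + g z - a z - b z - c z - d z = 1"
  shows "(\<lambda>z. hyp4F3 (a z) (b z) (c z) (d z) (e z) (f z) (g z)) holomorphic_on S"
proof -
  define T where "T = (\<lambda>n z. (pochhammer (a z) n * pochhammer (b z) n * pochhammer (c z) n * pochhammer (d z) n) /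
          (fact n * pochhammer (e z) n * pochhammer (f z) n * pochhammer (g z) n))"
  have nz: "pochhammer (e z) n \<noteq> 0" "pochhammer (f z) n \<noteq> 0" "pochhammer (g z) n \<noteq> 0" if "z \<in> S" for z n
    using lower[OF that] by (auto dest: pochhammer_neq_0_if_not_nonpos_Int)
  have holT: "T n holomorphic_on S" for n
    unfolding T_def using nz by (intro holomorphic_intros hol) auto
  define U where "U = (\<lambda>n z. (a z + of_nat n) * (b z + of_nat n) * (c z + of_nat n) * (d z + of_nat n))"
  define D where "D = (\<lambda>n z. (1 + of_nat n) * (e z + of_nat n) * (f z + of_nat n) * (g z + of_nat n))"
  have D_nz: "D n z \<noteq> 0" if "z \<in> S" for n z
    using nz[OF that, of "Suc n"] of_nat_neq_0[of n, where 'a=complex] by (auto simp: D_def pochhammer_rec')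
  \<comment> \<open>Kept as a product instead of a quotient because terms vanish when an upper
    parameter is a nonpositive integer.\<close>
  have T_Suc: "T (Suc n) z * D n z = T n z * U n z" if z: "z \<in> S" for n z
  proof -
    define p where "p = pochhammer (a z) n * pochhammer (b z) n * pochhammer (c z) n * pochhammer (d z) n"
    define q where "q = fact n * pochhammer (e z) n * pochhammer (f z) n * pochhammer (g z) n"
    have "pochhammer (a z) (Suc n) * pochhammer (b z) (Suc n) * pochhammer (c z) (Suc n) * pochhammer (d z) (Suc n) = p * U n z"
      by (simp only: p_def U_def pochhammer_rec' mult_ac)
    moreover have "fact (Suc n) * pochhammer (e z) (Suc n) * pochhammer (f z) (Suc n) * pochhammer (g z) (Suc n) = q * D n z"
      by (simp only: q_def D_def pochhammer_rec' fact_Suc of_nat_Suc mult_ac)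
    ultimately have "T (Suc n) z = p * U n z / (q * D n z)" by (simp only: T_def)
    then show ?thesis using D_nz[OF z, of n] by (simp add: T_def p_def q_def)
  qed
  have lim: "\<exists>r. 0 < r \<and> cball z0 r \<subseteq> S \<and> uniform_limit (cball z0 r) (\<lambda>n z. \<Sum>k<n. T k z) (\<lambda>z. \<Sum>k. T k z) sequentially"
    if z0: "z0 \<in> S" for z0
  proof -
    obtain r where r: "r > 0" "cball z0 r \<subseteq> S"
      using S z0 open_contains_cball by blast
    have bdd: "\<exists>M. \<forall>z\<in>cball z0 r. norm (h z) \<le> M" if "h holomorphic_on S" for h :: "complex \<Rightarrow> complex"
    proof -
      have "continuous_on (cball z0 r) h"
        using that r(2) holomorphic_on_imp_continuous_on continuous_on_subset by blast
      then have "bounded (h ` cball z0 r)"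
        using compact_continuous_image compact_imp_bounded compact_cball by blast
      then show ?thesis by (auto simp: bounded_iff)
    qed
    obtain Ma where Ma: "\<And>z. z \<in> cball z0 r \<Longrightarrow> norm (a z) \<le> Ma"
      using bdd[OF hol(1)] by blast
    obtain Mb where Mb: "\<And>z. z \<in> cball z0 r \<Longrightarrow> norm (b z) \<le> Mb"
      using bdd[OF hol(2)] by blast
    obtain Mc where Mc: "\<And>z. z \<in> cball z0 r \<Longrightarrow> norm (c z) \<le> Mc"
      using bdd[OF hol(3)] by blast
    obtain Md where Md: "\<And>z. z \<in> cball z0 r \<Longrightarrow> norm (d z) \<le> Md"
      using bdd[OF hol(4)] by blast
    obtain Me where Me: "\<And>z. z \<in> cball z0 r \<Longrightarrow> norm (e z) \<le> Me"
      using bdd[OF hol(5)] by blast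
    obtain Mf where Mf: "\<And>z. z \<in> cball z0 r \<Longrightarrow> norm (f z) \<le> Mf"
      using bdd[OF hol(6)] by blast
    obtain Mg where Mg: "\<And>z. z \<in> cball z0 r \<Longrightarrow> norm (g z) \<le> Mg"
      using bdd[OF hol(7)] by blast
    define M where "M = Max {Ma, Mb, Mc, Md, Me, Mf, Mg}"
    have M: "norm (a z) \<le> M" "norm (b z) \<le> M" "norm (c z) \<le> M" "norm (d z) \<le> M" "norm (e z) \<le> M" "norm (f z) \<le> M" "norm (g z) \<le> M"
      if "z \<in> cball z0 r" for z
      using Ma[OF that] Mb[OF that] Mc[OF that] Md[OF that] Me[OF that] Mf[OF that] Mg[OF that] by (auto simp: M_def le_max_iff_disj)
    obtain N where N: "N \<ge> 1" and N_bound: "\<forall>n\<ge>N. \<forall>a b c d e f g :: complex.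
      norm a \<le> M \<longrightarrow> norm b \<le> M \<longrightarrow> norm c \<le> M \<longrightarrow> norm d \<le> M \<longrightarrow> norm e \<le> M \<longrightarrow> norm f \<le> M \<longrightarrow> norm g \<le> M \<longrightarrow>
      e + f + g - a - b - c - d = 1 \<longrightarrow>
      real (n + 1) * norm ((a + of_nat n) * (b + of_nat n) * (c + of_nat n) * (d + of_nat n)) \<le>
      (real n - 1 / 2) * norm ((1 + of_nat n) * (e + of_nat n) * (f + of_nat n) * (g + of_nat n))"
      using product_ratio_bound[of M] by (elim exE conjE) (rule that)
    obtain B where B: "\<And>z. z \<in> cball z0 r \<Longrightarrow> norm (T N z) \<le> B"
      using bdd[OF holT] by blast
    have bound: "norm (T n z) \<le> sqrt (real N ^ 3) * B / sqrt (real n ^ 3)" if n: "n \<ge> N" and z: "z \<in> cball z0 r" for n z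
    proof -
      have zS: "z \<in> S" using z r by blast
      have step: "real (m + 1) * norm (T (Suc m) z) \<le> (real m - 1 / 2) * norm (T m z)" if m: "m \<ge> N" for m
      proof -
        have UD: "real (m + 1) * norm (U m z) \<le> (real m - 1 / 2) * norm (D m z)"
          unfolding U_def D_def by (rule N_bound[rule_format, OF m M[OF z] saal[OF zS]])
        have "norm (T (Suc m) z) * norm (D m z) = norm (T m z) * norm (U m z)"
          using arg_cong[OF T_Suc[OF zS, of m], of norm] by (simp only: norm_mult)
        then have "(real (m + 1) * norm (T (Suc m) z)) * norm (D m z) = norm (T m z) * (real (m + 1) * norm (U m z))"
          by (simp add: mult_ac)
        also have "\<dots> \<le> norm (T m z) * ((real m - 1 / 2) * norm (D m z))"
          using UD by (rule mult_left_mono) simp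
        finally have "(real (m + 1) * norm (T (Suc m) z)) * norm (D m z) \<le> ((real m - 1 / 2) * norm (T m z)) * norm (D m z)"
          by (simp add: mult_ac)
        then show ?thesis
          by (rule mult_right_le_imp_le) (use D_nz[OF zS] in simp)
      qed
      have "norm (T n z) \<le> sqrt (real N ^ 3) * norm (T N z) / sqrt (real n ^ 3)"
        by (rule three_halves_decay[of N "\<lambda>n. norm (T n z)"]) (use N step n in auto)
      also have "\<dots> \<le> sqrt (real N ^ 3) * B / sqrt (real n ^ 3)"
        using B[OF z] by (intro divide_right_mono mult_left_mono) auto
      finally show ?thesis .
    qed
    have summ: "summable (\<lambda>n. sqrt (real N ^ 3) * B / sqrt (real n ^ 3))"
    proof -
      have "summable (\<lambda>n. sqrt (real N ^ 3) * B * real n powr (- 3 / 2))"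
        by (intro summable_mult) (simp add: summable_real_powr_iff)
      then show ?thesis
      proof (rule summable_cong[THEN iffD1, rotated])
        show "\<forall>\<^sub>F n in sequentially. sqrt (real N ^ 3) * B * real n powr (- 3 / 2) = sqrt (real N ^ 3) * B / sqrt (real n ^ 3)"
          using eventually_gt_at_top[of 0]
        proof eventually_elim
          case (elim n)
          have n3: "real n ^ 3 = real n powr 3" using elim by simp
          have n32: "sqrt (real n ^ 3) = real n powr (3 / 2)"
            unfolding n3 powr_half_sqrt[symmetric, OF powr_ge_zero] powr_powr by simp
          have "real n powr (- 3 / 2) = inverse (real n powr (3 / 2))"
            using powr_minus[of "real n" "3 / 2"] by simp
          then show ?case unfolding n32 divide_inverse by (rule arg_cong)
        qed
      qed
    qed
    have "uniform_limit (cball z0 r) (\<lambda>n z. \<Sum>k<n. T k z) (\<lambda>z. \<Sum>k. T k z) sequentially"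
    proof (rule Weierstrass_m_test_ev[OF _ summ])
      show "\<forall>\<^sub>F n in sequentially. \<forall>z\<in>cball z0 r. norm (T n z) \<le> sqrt (real N ^ 3) * B / sqrt (real n ^ 3)"
        using eventually_ge_at_top[of N] by eventually_elim (intro ballI bound)
    qed
    with r show ?thesis by (intro exI[of _ r] conjI)
  qed
  have "(\<lambda>z. \<Sum>k. T k z) holomorphic_on S"
    by (rule holomorphic_uniform_sequence[OF S, where f = "\<lambda>n z. \<Sum>k<n. T k z"])
      (intro holomorphic_on_sum holT, rule lim)
  then show ?thesis
    by (simp add: hyp4F3_def T_def)
qed

lemma sin_pi_eq_0_iff: "sin (of_real pi * e) = (0 :: complex) \<longleftrightarrow> e \<in> \<int>"
proof -
  have "sin (of_real pi * e) = (0 :: complex) \<longleftrightarrow> (\<exists>n::int. of_real pi * e = of_real (of_int n * pi))"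
    by (rule sin_eq_0)
  also have "\<dots> \<longleftrightarrow> (\<exists>n::int. e = of_int n)"
    by (intro ex_cong1) (simp add: mult.commute)
  finally show ?thesis by (auto elim: Ints_cases)
qed

text \<open>The shifted parameters of the second series satisfy the Saalschuetz condition again, so
  the same convergence result serves both series.\<close>

theorem L_fun_holomorphic:
  assumes S: "open S"
    and hol: "a holomorphic_on S" "b holomorphic_on S" "c holomorphic_on S" "d holomorphic_on S"
      "e holomorphic_on S" "f holomorphic_on S" "g holomorphic_on S"
    and defd: "\<And>z. z \<in> S \<Longrightarrow> e z \<notin> \<int>" "\<And>z. z \<in> S \<Longrightarrow> f z \<notin> \<int>\<^sub>\<le>\<^sub>0" "\<And>z. z \<in> S \<Longrightarrow> g z \<notin> \<int>\<^sub>\<le>\<^sub>0"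
      "\<And>z. z \<in> S \<Longrightarrow> 1 + f z - e z \<notin> \<int>\<^sub>\<le>\<^sub>0" "\<And>z. z \<in> S \<Longrightarrow> 1 + g z - e z \<notin> \<int>\<^sub>\<le>\<^sub>0"
    and saal: "\<And>z. z \<in> S \<Longrightarrow> e z + f z + g z - a z - b z - c z - d z = 1"
  shows "(\<lambda>z. L_fun (a z) (b z) (c z) (d z) (e z) (f z) (g z)) holomorphic_on S"
proof -
  have e: "e z \<notin> \<int>\<^sub>\<le>\<^sub>0" "2 - e z \<notin> \<int>\<^sub>\<le>\<^sub>0" if "z \<in> S" for z
  proof -
    show "e z \<notin> \<int>\<^sub>\<le>\<^sub>0" using defd(1)[OF that] nonpos_Ints_Int by blast
    have "2 - e z \<in> \<int> \<Longrightarrow> 2 - (2 - e z) \<in> \<int>" by (intro Ints_diff) auto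
    then show "2 - e z \<notin> \<int>\<^sub>\<le>\<^sub>0" using defd(1)[OF that] nonpos_Ints_Int by auto
  qed
  have s0: "sin (of_real pi * e z) \<noteq> 0" if "z \<in> S" for z
    using defd(1)[OF that] by (simp add: sin_pi_eq_0_iff)
  have H1: "(\<lambda>z. hyp4F3 (a z) (b z) (c z) (d z) (e z) (f z) (g z)) holomorphic_on S"
    by (rule hyp4F3_holomorphic[OF S hol]) (simp_all add: e defd saal)
  have H2: "(\<lambda>z. hyp4F3 (1 + a z - e z) (1 + b z - e z) (1 + c z - e z) (1 + d z - e z)
      (1 + f z - e z) (1 + g z - e z) (2 - e z)) holomorphic_on S"
  proof (rule hyp4F3_holomorphic[OF S])
    show "1 + f z - e z + (1 + g z - e z) + (2 - e z) - (1 + a z - e z) - (1 + b z - e z) - (1 + c z - e z) - (1 + d z - e z) = 1"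
      if "z \<in> S" for z
      using saal[OF that] by (simp add: algebra_simps)
  qed (simp_all add: e defd holomorphic_intros hol)
  show ?thesis
    unfolding L_fun_def using s0 by (intro holomorphic_intros H1 H2 hol) auto
qed

section \<open>Invariance\<close>

text \<open>The linear form with V as its level set 1; its kernel consists of the directions of
  lines inside V.\<close>

definition excess :: "complex^7 \<Rightarrow> complex" where
  "excess x = x$5 + x$6 + x$7 - x$1 - x$2 - x$3 - x$4"

lemma V_iff_excess: "x \<in> V \<longleftrightarrow> excess x = 1"
  by (simp add: V_def excess_def)

lemma excess_line: "excess (x + z *s v) = excess x + z * excess v"
  by (simp add: excess_def algebra_simps)

lemma open_avoiding_closed:
  fixes h :: "complex \<Rightarrow> complex"
  assumes "continuous_on UNIV h" "closed C"
  shows "open {z. h z \<notin> C}"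
proof -
  have "open (h -` (- C))" using assms by (intro open_vimage) auto
  then show ?thesis by (simp add: vimage_def)
qed

lemma open_L_defined_line: "open {z. L_defined (x + z *s v)}"
  unfolding L_defined_def vector_add_component vector_smult_component
  by (intro open_Collect_conj open_avoiding_closed continuous_intros) auto

lemma L_line_holomorphic:
  assumes "excess x = 1" "excess v = 0"
  shows "(\<lambda>z. L (x + z *s v)) holomorphic_on {z. L_defined (x + z *s v)}"
proof -
  have "excess (x + z *s v) = 1" for z
    by (simp add: excess_line assms)
  note saal = this[unfolded excess_def vector_add_component vector_smult_component]
  show ?thesis
    unfolding L_def vector_add_component vector_smult_component
    by (rule L_fun_holomorphic[OF open_L_defined_line])
      (rule saal | (intro holomorphic_intros; fail) | (simp add: L_defined_def; fail))+
qed

text \<open>The hypothesis on \<alpha> takes care of a form that is constant along the line;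
  otherwise each element of C is hit at most once.\<close>

lemma countable_line_hits:
  fixes \<alpha> \<beta> :: complex
  assumes "countable C" "\<alpha> \<notin> C"
  shows "countable {z. \<alpha> + z * \<beta> \<in> C}"
proof (cases "\<beta> = 0")
  case False
  have "{z. \<alpha> + z * \<beta> \<in> C} \<subseteq> (\<lambda>w. (w - \<alpha>) / \<beta>) ` C"
  proof
    fix z assume "z \<in> {z. \<alpha> + z * \<beta> \<in> C}"
    then show "z \<in> (\<lambda>w. (w - \<alpha>) / \<beta>) ` C"
      using False by (intro image_eqI[of _ _ "\<alpha> + z * \<beta>"]) auto
  qed
  then show ?thesis by (rule countable_subset) (intro countable_image assms(1))
qed (use assms in simp)

lemma countable_L_undefined_line:
  assumes "L_defined x"
  shows "countable {z. \<not> L_defined (x + z *s v)}"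
proof -
  have cZ: "countable (\<int> :: complex set)" by (simp add: Ints_def)
  have cN: "countable (\<int>\<^sub>\<le>\<^sub>0 :: complex set)"
    by (rule countable_subset[OF nonpos_Ints_subset_Ints cZ])
  have eqs: "1 + (x$6 + z * v$6) - (x$5 + z * v$5) = (1 + x$6 - x$5) + z * (v$6 - v$5)"
    "1 + (x$7 + z * v$7) - (x$5 + z * v$5) = (1 + x$7 - x$5) + z * (v$7 - v$5)" for z
    by (simp_all add: algebra_simps)
  have "{z. \<not> L_defined (x + z *s v)} =
     {z. x$5 + z * v$5 \<in> \<int>} \<union> {z. x$6 + z * v$6 \<in> \<int>\<^sub>\<le>\<^sub>0} \<union> {z. x$7 + z * v$7 \<in> \<int>\<^sub>\<le>\<^sub>0} \<union>
     {z. (1 + x$6 - x$5) + z * (v$6 - v$5) \<in> \<int>\<^sub>\<le>\<^sub>0} \<union> {z. (1 + x$7 - x$5) + z * (v$7 - v$5) \<in> \<int>\<^sub>\<le>\<^sub>0}"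
    by (auto simp: L_defined_def eqs)
  also have "countable \<dots>"
    by (intro countable_Un countable_line_hits[OF cZ] countable_line_hits[OF cN])
      (use assms in \<open>simp_all add: L_defined_def\<close>)
  finally show ?thesis .
qed

text \<open>The limit point may itself be an integer; close to it, another integer would make z
  \<beta> a nonzero integer of norm below 1.\<close>

lemma eventually_line_not_Ints:
  fixes \<alpha> \<beta> :: complex
  assumes "\<beta> \<noteq> 0"
  shows "\<forall>\<^sub>F z in at 0. \<alpha> + z * \<beta> \<notin> \<int>"
proof (cases "\<alpha> \<in> \<int>")
  case False
  have "((\<lambda>z. \<alpha> + z * \<beta>) \<longlongrightarrow> \<alpha> + 0 * \<beta>) (at 0)"
    by (intro tendsto_intros)
  from topological_tendstoD[OF this, of "- \<int>"] show ?thesis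
    using False by (simp add: open_Compl)
next
  case True
  have "\<alpha> + z * \<beta> \<notin> \<int>" if z: "z \<noteq> 0" "norm z < 1 / norm \<beta>" for z
  proof
    assume "\<alpha> + z * \<beta> \<in> \<int>"
    then have "\<alpha> + z * \<beta> - \<alpha> \<in> \<int>" using True by (intro Ints_diff)
    then obtain n where n: "z * \<beta> = of_int n" by (auto elim: Ints_cases)
    then have "n \<noteq> 0" using z assms by auto
    have "norm (z * \<beta>) < 1" using z assms by (simp add: norm_mult field_simps)
    then show False using \<open>n \<noteq> 0\<close> unfolding n by simp
  qed
  then show ?thesis
    using assms unfolding eventually_at by (intro exI[of _ "1 / norm \<beta>"]) (simp add: dist_norm)
qed

text \<open>A direction along which none of the linear forms \<open>e, f, g, f - e, g - e\<close> is constant, while the excess is.\<close>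

definition generic_direction :: "complex^7" where
  "generic_direction = vector [6, 0, 0, 0, 1, 2, 3]"

text \<open>The entry 6 balances 1 + 2 + 3; these three are distinct, so f - e and g - e vary along
  the line too.\<close>

lemma excess_generic_direction: "excess generic_direction = 0"
  unfolding excess_def generic_direction_def vector_7 by simp

lemma eventually_L_defined_generic:
  "\<forall>\<^sub>F z in at 0. L_defined (y + z *s generic_direction)"
proof -
  have "\<forall>\<^sub>F z in at 0. y$5 + z * 1 \<notin> \<int> \<and> y$6 + z * 2 \<notin> \<int> \<and> y$7 + z * 3 \<notin> \<int> \<and>
      (1 + y$6 - y$5) + z * 1 \<notin> \<int> \<and> (1 + y$7 - y$5) + z * 2 \<notin> \<int>"
    by (intro eventually_conj eventually_line_not_Ints) auto
  then show ?thesis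
  proof eventually_elim
    case (elim z)
    have eqs: "1 + (y$6 + z * 2) - (y$5 + z * 1) = (1 + y$6 - y$5) + z * 1"
      "1 + (y$7 + z * 3) - (y$5 + z * 1) = (1 + y$7 - y$5) + z * 2"
      by (simp_all add: algebra_simps)
    show ?case
      unfolding L_defined_def vector_add_component vector_smult_component generic_direction_def vector_7 eqs
      using elim nonpos_Ints_Int by blast
  qed
qed

lemma eventually_L_defined_line:
  assumes "L_defined x"
  shows "\<forall>\<^sub>F z in at 0. L_defined (x + z *s v)"
proof -
  have "\<forall>\<^sub>F z in nhds 0. z \<in> {z. L_defined (x + z *s v)}"
    using assms by (intro eventually_nhds_in_open open_L_defined_line) simp
  then show ?thesis by (simp add: eventually_nhds_conv_at)
qed

lemma tendsto_L_line:
  assumes "excess x = 1" "excess v = 0" "L_defined x"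
  shows "((\<lambda>z. L (x + z *s v)) \<longlongrightarrow> L x) (at 0)"
proof -
  have "isCont (\<lambda>z. L (x + z *s v)) 0"
    using L_line_holomorphic[OF assms(1,2), THEN holomorphic_on_imp_continuous_on]
      open_L_defined_line[of x v] assms(3)
    by (simp add: continuous_on_eq_continuous_at)
  then show ?thesis by (simp add: isCont_def)
qed

text \<open>Made to be closed under products: preservation of the excess at all vectors covers
  directions as well as points, and the right inverse allows a chosen perturbation of an
  intermediate point to be pulled back.\<close>

definition L_invariant :: "complex^7^7 \<Rightarrow> bool" where
  "L_invariant M \<longleftrightarrow> (\<forall>x. excess (M *v x) = excess x) \<and> (\<exists>N. M ** N = mat 1) \<and>
     (\<forall>x. excess x = 1 \<longrightarrow> L_defined x \<longrightarrow> L_defined (M *v x) \<longrightarrow> L x = L (M *v x))"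

lemma matrix_vector_line:
  fixes M :: "complex^7^7"
  shows "M *v (x + z *s v) = M *v x + z *s (M *v v)"
  by (simp add: matrix_vector_right_distrib vector_scalar_commute)

text \<open>The intermediate point \<open>N x\<close> need not be in the domain of \<open>L\<close>; it is moved there by a small
  perturbation of \<open>x\<close>, and continuity of \<open>L\<close> along lines removes the perturbation.\<close>

lemma L_invariant_mult:
  assumes M: "L_invariant M" and N: "L_invariant N"
  shows "L_invariant (M ** N)"
  unfolding L_invariant_def
proof (intro conjI allI impI)
  show "excess (M ** N *v x) = excess x" for x
    using M N by (simp add: L_invariant_def flip: matrix_vector_mul_assoc)
  obtain M' N' where M': "M ** M' = mat 1" and N': "N ** N' = mat 1"
    using M N by (auto simp: L_invariant_def)
  have "M ** N ** (N' ** M') = M ** (N ** N') ** M'" by (simp only: matrix_mul_assoc)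
  also have "\<dots> = mat 1" by (simp only: N' matrix_mul_rid M')
  finally show "\<exists>K. M ** N ** K = mat 1" ..
  fix x assume x: "excess x = 1" "L_defined x" "L_defined (M ** N *v x)"
  \<comment> \<open>The intermediate point N x is thereby moved in the generic direction, while x
    and M N x tolerate any small perturbation since the domain is open along lines.\<close>
  define v where "v = N' *v generic_direction"
  have Nv: "N *v v = generic_direction"
    by (simp add: v_def matrix_vector_mul_assoc N')
  have ex_v: "excess v = 0"
  proof -
    have "excess (N *v v) = excess v" using N unfolding L_invariant_def by blast
    then show ?thesis by (simp only: Nv excess_generic_direction)
  qed
  have ex_MNx: "excess (M *v (N *v x)) = 1" and ex_MNv: "excess (M *v (N *v v)) = 0"
    using M N x(1) ex_v by (simp_all add: L_invariant_def)
  have def_MNx: "L_defined (M *v (N *v x))"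
    using x(3) by (simp add: matrix_vector_mul_assoc)
  have "\<forall>\<^sub>F z in at 0. L_defined (x + z *s v) \<and> L_defined (N *v x + z *s generic_direction) \<and>
      L_defined (M *v (N *v x) + z *s (M *v (N *v v)))"
    by (intro eventually_conj eventually_L_defined_line eventually_L_defined_generic x def_MNx)
  then have "\<forall>\<^sub>F z in at 0. L (x + z *s v) = L (M *v (N *v x) + z *s (M *v (N *v v)))"
  proof eventually_elim
    case (elim z)
    have ex: "excess (x + z *s v) = 1" by (simp add: excess_line x ex_v)
    have def_N: "L_defined (N *v (x + z *s v))" and def_MN: "L_defined (M *v (N *v (x + z *s v)))"
      using elim by (simp_all only: matrix_vector_line Nv)
    have "L (x + z *s v) = L (N *v (x + z *s v))"
      using N ex elim def_N by (simp add: L_invariant_def)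
    also have "\<dots> = L (M *v (N *v (x + z *s v)))"
      using M N ex def_N def_MN by (simp add: L_invariant_def)
    finally show ?case by (simp only: matrix_vector_line)
  qed
  then have "((\<lambda>z. L (M *v (N *v x) + z *s (M *v (N *v v)))) \<longlongrightarrow> L x) (at 0)"
    by (rule Lim_transform_eventually[OF tendsto_L_line[OF x(1) ex_v x(2)]])
  then have "L x = L (M *v (N *v x))"
    by (rule tendsto_unique[OF at_neq_bot _ tendsto_L_line[OF ex_MNx ex_MNv def_MNx]])
  then show "L x = L (M ** N *v x)" by (simp add: matrix_vector_mul_assoc)
qed

lemma L_invariant_one: "L_invariant (mat 1)"
  by (auto simp: L_invariant_def intro: exI[of _ "mat 1"])

lemma involution_right_inverse:
  fixes M :: "complex^7^7"
  assumes "\<And>x. M *v (M *v x) = x"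
  shows "\<exists>N. M ** N = mat 1"
  using assms by (intro exI[of _ M]) (simp add: matrix_eq flip: matrix_vector_mul_assoc)

section \<open>The generators and the involution S\<close>

lemma L_fun_permute:
  "L_fun b a c d e f g = L_fun a b c d e f g" "L_fun a c b d e f g = L_fun a b c d e f g"
  "L_fun a b d c e f g = L_fun a b c d e f g" "L_fun a b c d e g f = L_fun a b c d e f g"
  by (simp_all add: L_fun_def hyp4F3_def mult_ac)

lemma L_invariant_transpositions:
  "L_invariant (perm_matrix (Transposition.transpose 1 2))"
  "L_invariant (perm_matrix (Transposition.transpose 2 3))"
  "L_invariant (perm_matrix (Transposition.transpose 3 4))"
  "L_invariant (perm_matrix (Transposition.transpose 6 7))"
proof -
  have inv: "\<exists>N. perm_matrix (Transposition.transpose i j) ** N = mat 1" for i j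
    by (rule involution_right_inverse) (simp add: vec_eq_iff perm_matrix_transpose_vec)
  show "L_invariant (perm_matrix (Transposition.transpose 1 2))"
    unfolding L_invariant_def L_def excess_def perm_matrix_transpose_vec
    using inv by (simp add: transpose_def L_fun_permute)
  show "L_invariant (perm_matrix (Transposition.transpose 2 3))"
    unfolding L_invariant_def L_def excess_def perm_matrix_transpose_vec
    using inv by (simp add: transpose_def L_fun_permute)
  show "L_invariant (perm_matrix (Transposition.transpose 3 4))"
    unfolding L_invariant_def L_def excess_def perm_matrix_transpose_vec
    using inv by (simp add: transpose_def L_fun_permute)
  show "L_invariant (perm_matrix (Transposition.transpose 6 7))"
    unfolding L_invariant_def L_def excess_def perm_matrix_transpose_vec
    using inv by (simp add: transpose_def L_fun_permute)
qed

text \<open>The substitution of \<open>L_fun_local_symmetry\<close>, made linear by reading the constant \<open>1\<close> as the excess.\<close>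

definition S_mat :: "complex^7^7" where
  "S_mat = vector
    [vector [ 0,  0, 0, -1, 0, 1, 0],
     vector [ 0,  0, 0, -1, 0, 0, 1],
     vector [ 0,  0, 1,  0, 0, 0, 0],
     vector [-1, -1, 0, -1, 0, 1, 1],
     vector [-1, -1, 0, -2, 1, 1, 1],
     vector [ 0, -1, 0, -1, 0, 1, 1],
     vector [-1,  0, 0, -1, 0, 1, 1]]"

lemma S_mat_vec:
  "S_mat *v x = vector [x$6 - x$4, x$7 - x$4, x$3, excess x + x$3 - x$5, excess x + x$3 - x$4,
     excess x + x$1 + x$3 - x$5, excess x + x$2 + x$3 - x$5]"
  unfolding vec_eq_iff forall_7 matrix_vector_mult_def S_mat_def excess_def
  by (simp only: vector_7 vec_lambda_beta sum_7) simp

lemma excess_S_mat: "excess (S_mat *v x) = excess x"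
  unfolding S_mat_vec excess_def[of "vector _"] vector_7 by (simp add: excess_def)

lemma S_mat_involution: "S_mat *v (S_mat *v x) = x"
  unfolding S_mat_vec[of "S_mat *v x"] excess_S_mat
  unfolding S_mat_vec vec_eq_iff forall_7 by (simp only: vector_7) simp

text \<open>S is an involution, so the first three factors form the conjugate of the transposition
  (23) by S.\<close>

lemma A_mat_factorization:
  "A_mat = S_mat ** perm_matrix (Transposition.transpose 2 3) ** S_mat **
     perm_matrix (Transposition.transpose 3 4)"
proof -
  have "A_mat *v x = S_mat *v (perm_matrix (Transposition.transpose 2 3) *v (S_mat *v
     (perm_matrix (Transposition.transpose 3 4) *v x)))" for x
  proof -
    define y where "y = perm_matrix (Transposition.transpose 3 4) *v x"
    define w where "w = perm_matrix (Transposition.transpose 2 3) *v (S_mat *v y)"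
    have y: "y$1 = x$1" "y$2 = x$2" "y$3 = x$4" "y$4 = x$3" "y$5 = x$5" "y$6 = x$6" "y$7 = x$7"
      by (simp_all add: y_def perm_matrix_transpose_vec transpose_def)
    have ey: "excess y = excess x" by (simp add: excess_def y)
    have w: "w$1 = x$6 - x$3" "w$2 = x$4" "w$3 = x$7 - x$3" "w$4 = excess x + x$4 - x$5"
      "w$5 = excess x + x$4 - x$3" "w$6 = excess x + x$1 + x$4 - x$5" "w$7 = excess x + x$2 + x$4 - x$5"
      unfolding w_def perm_matrix_transpose_vec S_mat_vec ey
      by (simp_all add: transpose_def vector_7 y)
    have ew: "excess w = excess x" unfolding excess_def[of w] w by (simp add: excess_def)
    have "A_mat *v x = S_mat *v w"
      unfolding A_mat_vec S_mat_vec ew w vec_eq_iff forall_7 by (simp only: vector_7) (simp add: excess_def)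
    then show ?thesis by (simp add: w_def y_def)
  qed
  then show ?thesis by (simp add: matrix_eq flip: matrix_vector_mul_assoc)
qed

text \<open>A fixed point of \<open>S_mat\<close> at which \<open>L_fun_local_symmetry\<close> applies.\<close>

definition base_point :: "complex^7" where
  "base_point = vector [1/4, 1/4, 1/4, 1/2, 3/4, 3/4, 3/4]"

lemma base_point_nth:
  "base_point$1 = 1/4" "base_point$2 = 1/4" "base_point$3 = 1/4" "base_point$4 = 1/2"
  "base_point$5 = 3/4" "base_point$6 = 3/4" "base_point$7 = 3/4"
  by (simp_all only: base_point_def vector_7)

lemma excess_base_point: "excess base_point = 1"
  by (simp add: excess_def base_point_nth)

text \<open>Hence S maps lines through this point to lines through this point, and a neighbourhood
  of it lies in both domains.\<close>

lemma S_mat_base_point: "S_mat *v base_point = base_point"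
  unfolding S_mat_vec excess_base_point vec_eq_iff forall_7 by (simp only: vector_7 base_point_nth) simp

lemma L_defined_base_point: "L_defined base_point"
proof -
  have "(3/4 :: complex) \<notin> \<int>"
  proof
    assume "(3/4 :: complex) \<in> \<int>"
    then obtain n where "(3/4 :: complex) = of_int n" by (auto elim: Ints_cases)
    then have "3 / 4 = real_of_int n" by (metis Re_divide_numeral complex_Re_numeral complex_Re_of_int)
    then have "3 = 4 * n" by linarith
    then show False by presburger
  qed
  moreover have "(3/4 :: complex) \<notin> \<int>\<^sub>\<le>\<^sub>0" "(1 :: complex) \<notin> \<int>\<^sub>\<le>\<^sub>0"
    by (rule Re_pos_not_nonpos_Int, simp)+
  ultimately show ?thesis by (simp add: L_defined_def base_point_nth)
qed

text \<open>Continuation along the line with p(0) the base point and p(1) = x: the identity holds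
  near 0 by the integral, and both sides are holomorphic on a connected set containing 0 and
  1.\<close>

theorem L_invariant_S_mat: "L_invariant S_mat"
  unfolding L_invariant_def
proof (intro conjI allI impI)
  show "excess (S_mat *v x) = excess x" for x by (rule excess_S_mat)
  show "\<exists>N. S_mat ** N = mat 1"
    by (rule involution_right_inverse) (rule S_mat_involution)
  fix x assume x: "excess x = 1" "L_defined x" "L_defined (S_mat *v x)"
  define v where "v = x - base_point"
  define p where "p = (\<lambda>z. base_point + z *s v)"
  have p0: "p 0 = base_point" and p1: "p 1 = x" by (simp_all add: p_def v_def)
  have ev: "excess v = 0"
    using excess_line[of base_point 1 v] x(1) excess_base_point by (simp add: v_def)
  have ex_p: "excess (p z) = 1" for z by (simp add: p_def excess_line excess_base_point ev)
  have Sp: "S_mat *v p z = base_point + z *s (S_mat *v v)" for z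
    by (simp add: p_def matrix_vector_line S_mat_base_point)
  define T where "T = {z. L_defined (p z)} \<inter> {z. L_defined (S_mat *v p z)}"
  have openT: "open T"
    unfolding T_def Sp unfolding p_def by (intro open_Int open_L_defined_line)
  have connT: "connected T"
  proof -
    have c1: "countable {z. \<not> L_defined (p z)}"
      unfolding p_def by (rule countable_L_undefined_line[OF L_defined_base_point])
    have c2: "countable {z. \<not> L_defined (S_mat *v p z)}"
      unfolding Sp by (rule countable_L_undefined_line[OF L_defined_base_point])
    have "connected (UNIV - ({z. \<not> L_defined (p z)} \<union> {z. \<not> L_defined (S_mat *v p z)}))"
      using c1 c2 by (intro connected_open_diff_countable) auto
    moreover have "UNIV - ({z. \<not> L_defined (p z)} \<union> {z. \<not> L_defined (S_mat *v p z)}) = T"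
      by (auto simp: T_def)
    ultimately show ?thesis by simp
  qed
  \<comment> \<open>The inequalities of \<open>L_fun_local_symmetry\<close>. They are strict, so
    they hold on an open set of z around 0.\<close>
  define R where "R = (\<lambda>y :: complex^7.
     0 < Re (1 + y$1 + y$2 - y$5) \<and> Re (1 + y$1 + y$2 - y$5) < 1 \<and>
     0 < Re (y$5) \<and> Re (y$5) < 1 \<and> 0 < Re (y$1) \<and> Re (y$1) < 1 \<and> 0 < Re (y$2) \<and> Re (y$2) < 1 \<and>
     0 < Re (y$3) \<and> Re (y$3) < Re (y$4) \<and> Re (y$4) < 1 \<and> 0 < Re (y$6) \<and> 0 < Re (y$7) \<and>
     0 < Re (y$6 - y$4) \<and> Re (y$6 - y$4) < 1 \<and> 0 < Re (y$7 - y$4) \<and> Re (y$7 - y$4) < 1)"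
  have openR: "open {z. R (p z)}"
    unfolding R_def p_def vector_add_component vector_smult_component
    by (intro open_Collect_conj open_Collect_less continuous_intros)
  have LS: "L y = L (S_mat *v y)" if "R y" "excess y = 1" for y
  proof -
    have "L (S_mat *v y) = L_fun (y$6 - y$4) (y$7 - y$4) (y$3) (1 + y$3 - y$5) (1 + y$3 - y$4)
        (1 + y$1 + y$3 - y$5) (1 + y$2 + y$3 - y$5)"
      unfolding L_def S_mat_vec that(2) vector_7 ..
    also have "\<dots> = L y"
      unfolding L_def
      by (rule L_fun_local_symmetry[symmetric]) (use that in \<open>auto simp: R_def excess_def\<close>)
    finally show ?thesis by simp
  qed
  have "L (p 1) = L (S_mat *v p 1)"
  proof (rule analytic_continuation_open[where s = "T \<inter> {z. R (p z)}" and s' = T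
        and f = "\<lambda>z. L (p z)" and g = "\<lambda>z. L (S_mat *v p z)"])
    show "open (T \<inter> {z. R (p z)})" using openT openR by blast
    have "0 \<in> T \<inter> {z. R (p z)}"
      by (simp add: T_def p0 S_mat_base_point L_defined_base_point R_def base_point_nth)
    then show "T \<inter> {z. R (p z)} \<noteq> {}" by blast
    show "(\<lambda>z. L (p z)) holomorphic_on T"
      unfolding T_def p_def
      by (rule holomorphic_on_subset[OF L_line_holomorphic[OF excess_base_point ev]]) auto
    show "(\<lambda>z. L (S_mat *v p z)) holomorphic_on T"
      unfolding T_def Sp
      by (rule holomorphic_on_subset[OF L_line_holomorphic[OF excess_base_point]])
        (auto simp: excess_S_mat ev)
    show "L (p z) = L (S_mat *v p z)" if "z \<in> T \<inter> {z. R (p z)}" for z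
      using that by (intro LS ex_p) auto
    show "1 \<in> T" using x by (simp add: T_def p1)
  qed (use openT connT in auto)
  then show "L x = L (S_mat *v x)" by (simp add: p1)
qed

lemma L_invariant_generators: "M \<in> GL_generators \<Longrightarrow> L_invariant M"
  unfolding GL_generators_def A_mat_factorization
  using L_invariant_transpositions L_invariant_S_mat by (auto intro!: L_invariant_mult)

text \<open>Inverses in the generated group cost nothing extra because every generator is its own
  inverse.\<close>

lemma L_invariant_G_L:
  assumes "\<alpha> \<in> G_L"
  shows "L_invariant \<alpha>"
proof -
  have self_inv: "inv\<^bsub>GL7\<^esub> M = M" if "M \<in> GL_generators" for M
    using group.inv_equality[OF group_GL7, of M M] GL_generators_subset that
      GL_generators_involutive[OF that] by (auto simp: GL7_def)
  have "L_invariant \<beta>" if "\<beta> \<in> generate GL7 GL_generators" for \<beta>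
    using that
  proof (induction rule: generate.induct)
    case one
    then show ?case by (simp add: GL7_def L_invariant_one)
  next
    case (eng h1 h2)
    then show ?case by (simp add: GL7_def L_invariant_mult)
  qed (simp_all add: self_inv L_invariant_generators)
  then show ?thesis using assms unfolding G_L_def by blast
qed

theorem mainTheorem2:
  fixes \<alpha> :: "complex^7^7" and x :: "complex^7"
  assumes "\<alpha> \<in> G_L" and "x \<in> V" and "L_defined x" and "L_defined (\<alpha> *v x)"
  shows "L x = L (\<alpha> *v x)"
  using L_invariant_G_L[OF assms(1)] assms(2-4) by (simp add: L_invariant_def V_iff_excess)

end
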